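(* Let $\alpha>1$, $m\ge 3$ an integer and $f\in\mathcal{M}_{\alpha,m}$. Then for all $s$ with $\frac12<\operatorname{Re}(s)<1$, $$\frac{\zeta^3(s)}{\zeta(2s)}f^*(s)=\int_0^\infty\left(\sum_{n=1}^\infty d(n^2)f(nx)-R_3(x)\right)x^{s-1}\,dx$$ and $$\frac{\zeta^4(s)}{\zeta(2s)}f^*(s)=\int_0^\infty\left(\sum_{n=1}^\infty d(n)^2f(nx)-R_4(x)\right)x^{s-1}\,dx,$$ where for $x>0$, $R_j(x)=\operatorname*{res}_{w=1}\left(\frac{\zeta^j(w)}{\zeta(2w)}f^*(w)x^{-w}\right)$, $j=3,4$.
   Context: For $\alpha>1$ and $m\in\mathbb{N}_0$, the class $\mathcal{M}_{\alpha,m}$ consists of the functions $f$ defined on $[0,\infty)$ such that $f\in\mathcal{C}^{(m)}([0,\infty))$ and $f^{(j)}(x)=\mathcal{O}(x^{-\alpha-j})$ as $x\to\infty$, for all $j=0,1,\dots,m$. $f^*(s)=\int_0^\infty f(x)x^{s-1}dx$ is the Mellin transform of $f$ (analytic for $0<\operatorname{Re}s<\alpha$). $\zeta$ is the Riemann zeta function and $d(n)$ is the number of divisors of $n$. *)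

theory Defs
  imports "HOL-Complex_Analysis.Complex_Analysis"
begin

text \<open>Riemann zeta function: the analytic continuation to the complement of 1 of the
Dirichlet series sum over n >= 1 of n^(-s) (convergent for Re s > 1).  The value at the
pole s = 1 is fixed to 0 by convention (it is never used).\<close>
definition riemann_zeta :: "complex \<Rightarrow> complex" where
  "riemann_zeta = (THE g. g holomorphic_on (- {1}) \<and>
       (\<forall>s. 1 < Re s \<longrightarrow> g s = (\<Sum>n. 1 / (of_nat (Suc n)) powr s)) \<and>
       g 1 = 0)"

definition divisor_count :: "nat \<Rightarrow> nat" where
  "divisor_count n = card {d. d dvd n}"

definition mellin :: "(real \<Rightarrow> complex) \<Rightarrow> complex \<Rightarrow> complex" where
  "mellin f s = integral {0<..} (\<lambda>x. f x * of_real x powr (s - 1))"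

definition M_class :: "real \<Rightarrow> nat \<Rightarrow> (real \<Rightarrow> complex) \<Rightarrow> bool" where
  "M_class \<alpha> m f \<longleftrightarrow>
     (\<exists>D :: nat \<Rightarrow> real \<Rightarrow> complex.
        D 0 = f \<and>
        (\<forall>j<m. \<forall>x\<ge>0. (D j has_vector_derivative D (Suc j) x) (at x within {0..})) \<and>
        (\<forall>j\<le>m. continuous_on {0..} (D j)) \<and>
        (\<forall>j\<le>m. \<exists>C X. \<forall>x\<ge>X. norm (D j x) \<le> C * x powr (- \<alpha> - real j)))"

end

theory Submission
  imports Defs "HOL-Real_Asymp.Real_Asymp"
begin

text \<open>
For $\mathrm{Re}\, w > 1$ an Euler product identifies $Z = \zeta^j / \zeta(2 \cdot)$ with the Dirichlet
series of $d(n^2)$ or $d(n)^2$. Mellin inversion of $f$ therefore writes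
$\sum a(n) f(nx)$ as the integral of $Z(w) f^*(w) x^{-w} / 2 \pi i$ over a line $\mathrm{Re}\, w = c > 1$.
Three integrations by parts give $f^*(w) = O(|\mathrm{Im}\, w|^{-3})$, while
$\zeta(w) = O(|\mathrm{Im}\, w|^{1 - \sigma})$ for $\mathrm{Re}\, w \ge \sigma$, so that $Z$ grows with an exponent
$4 (1 - \sigma) < 2$ and the line may be moved to any $\mathrm{Re}\, w = \sigma$ with $1/2 < \sigma < 1$;
this picks up $R_j(x)$. To take the Mellin transform at $s$ of what remains, use a line to the
left of $s$ for $0 < x < 1$ and one to the right of $s$ for $x > 1$: by Fubini the two pieces add up
to Cauchy's integral of $Z(w) f^*(w) / (w - s)$ around the strip between the two lines.

Continuation and growth of $\zeta$ both come from Jensen's formula, which expresses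
$(s - 1) \zeta(s)$ as the integral of $w^{1-s} (\pi / \sin \pi w)^2 / 2 \pi i$ over $\mathrm{Re}\, w = 1/2$:
moving the line to $\mathrm{Re}\, w = N + 1/2$ splits off $(s - 1) \sum_{n \le N} n^{-s}$.
\<close>

section \<open>Integrals over vertical lines and parameter integrals\<close>

text \<open>The kernel 1 / (s (s + 1) (s + 2)) produced by three integrations by parts is absolutely
  integrable on vertical lines, so Mellin inversion needs no Fourier theory: express
  \<open>mellin f\<close> through the third derivative, interchange the integrals, evaluate the
  inner one as a Perron integral, and recognize Taylor's formula based at infinity. The cubic decay
  tolerates any growth of \<open>Z\<close> with exponent below 2. As 1 / zeta(2w) is bounded for Re
  w >= \<sigma> > 1/2, only the powers of zeta grow, and the elementary exponent 1 - \<sigma> is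
  just good enough up to the fourth power; no functional equation or convexity bound enters. Zeta is
  given by a definite description, so its continuation has to be constructed. In Jensen's formula
  the free parameter is N: letting it tend to infinity for Re s > 1 recovers the Dirichlet series,
  while N of the size of |Im s| balances partial sum against remainder. Convergence of the final
  integral is not read off from pointwise bounds for the remainder; Fubini's theorem delivers
  integrability on each piece.\<close>

lemma contour_integral_rectpath_decompose:
  assumes "a < b" "0 < T" "continuous_on (path_image (rectpath (Complex a (-T)) (Complex b T))) f"
  shows "contour_integral (rectpath (Complex a (-T)) (Complex b T)) f =
     contour_integral (linepath (Complex a (-T)) (Complex b (-T))) f
     + \<i> * integral {-T..T} (\<lambda>t. f (Complex b t))
     + contour_integral (linepath (Complex b T) (Complex a T)) f
     - \<i> * integral {-T..T} (\<lambda>t. f (Complex a t))"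
proof -
  let ?a1 = "Complex a (-T)" and ?a2 = "Complex b (-T)" and ?a3 = "Complex b T" and ?a4 = "Complex a T"
  have rp: "rectpath ?a1 ?a3 = linepath ?a1 ?a2 +++ linepath ?a2 ?a3 +++ linepath ?a3 ?a4 +++ linepath ?a4 ?a1"
    by (simp add: rectpath_def Let_def)
  have im: "path_image (rectpath ?a1 ?a3) = closed_segment ?a1 ?a2 \<union> (closed_segment ?a2 ?a3 \<union> (closed_segment ?a3 ?a4 \<union> closed_segment ?a4 ?a1))"
    unfolding rp by (simp add: path_image_join)
  have c: "f contour_integrable_on linepath ?a1 ?a2" "f contour_integrable_on linepath ?a2 ?a3"
     "f contour_integrable_on linepath ?a3 ?a4" "f contour_integrable_on linepath ?a4 ?a1"
    using assms(3) unfolding im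
    by (auto intro!: contour_integrable_continuous_linepath elim!: continuous_on_subset)
  have e: "contour_integral (rectpath ?a1 ?a3) f = contour_integral (linepath ?a1 ?a2) f
    + (contour_integral (linepath ?a2 ?a3) f + (contour_integral (linepath ?a3 ?a4) f + contour_integral (linepath ?a4 ?a1) f))"
    unfolding rp using c by (simp add: contour_integrable_join)
  have l: "contour_integral (linepath ?a2 ?a3) f = \<i> * integral {-T..T} (\<lambda>t. f (Complex b t))"
    by (rule contour_integral_linepath_same_Re) (use assms in auto)
  have "contour_integral (linepath ?a4 ?a1) f = - contour_integral (linepath ?a1 ?a4) f"
    using c(4) by (metis contour_integral_reversepath reversepath_linepath valid_path_linepath)
  also have "contour_integral (linepath ?a1 ?a4) f = \<i> * integral {-T..T} (\<lambda>t. f (Complex a t))"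
    by (rule contour_integral_linepath_same_Re) (use assms in auto)
  finally show ?thesis using e l by simp
qed

text \<open>Bridge between the two integrals in use: contour integrals yield gauge integrals over
  segments, whereas Fubini and dominated convergence work with Lebesgue integrals over the whole
  line.\<close>

lemma tendsto_integral_symmetric_interval:
  fixes f :: "real \<Rightarrow> complex"
  assumes "integrable lborel f"
  shows "(\<lambda>n. integral {-real n..real n} f) \<longlonglongrightarrow> (LINT t|lborel. f t)"
proof -
  have "(\<lambda>n. LINT t|lborel. indicator {-real n..real n} t *\<^sub>R f t) \<longlonglongrightarrow> (LINT t|lborel. f t)"
  proof (rule integral_dominated_convergence)
    show "integrable lborel (\<lambda>t. norm (f t))" using assms by (rule integrable_norm)
    show "AE x in lborel. (\<lambda>i. indicat_real {- real i..real i} x *\<^sub>R f x) \<longlonglongrightarrow> f x"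
    proof (rule AE_I2, rule tendsto_eventually)
      fix x :: real
      obtain N :: nat where "\<bar>x\<bar> \<le> real N" using real_arch_simple by blast
      then show "\<forall>\<^sub>F n in sequentially. indicat_real {- real n..real n} x *\<^sub>R f x = f x"
        by (intro eventually_sequentiallyI[of N]) (auto simp: indicator_def)
    qed
  qed (use assms in \<open>auto simp: indicator_def\<close>)
  moreover have "(LINT t|lborel. indicator {-real n..real n} t *\<^sub>R f t) = integral {-real n..real n} f" for n
  proof -
    have "set_integrable lborel {-real n..real n} f"
      unfolding set_integrable_def using assms by (intro integrable_mult_indicator) auto
    from set_borel_integral_eq_integral(2)[OF this] show ?thesis
      by (simp add: set_lebesgue_integral_def)
  qed
  ultimately show ?thesis by simp
qed

lemma continuous_on_vertical_line:
  fixes g :: "complex \<Rightarrow> complex"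
  assumes "continuous_on {s. Re s = c} g"
  shows "continuous_on UNIV (\<lambda>t. g (Complex c t))"
  using assms by (rule continuous_on_compose2) (auto simp: Complex_eq intro!: continuous_intros)

text \<open>Lets a single majorant, the sum of the powers at the two edges, serve a whole strip of
  exponents and all positive \<open>x\<close> at once.\<close>

lemma powr_le_powr_add_powr:
  fixes x :: real
  assumes "0 < x" "a \<le> r" "r \<le> b"
  shows "x powr r \<le> x powr a + x powr b"
proof (cases "1 \<le> x")
  case True
  then have "x powr r \<le> x powr b" using assms by (intro powr_mono) auto
  then show ?thesis by (simp add: add_increasing)
next
  case False
  then have "x powr r \<le> x powr a" using assms by (intro powr_mono') auto
  then show ?thesis by (simp add: add_increasing2)
qed

text \<open>Rectangles of growing height exhaust the strip, and \<open>B\<close> makes their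
  horizontal sides vanish. The factor is \<open>2 * pi\<close> without the imaginary unit because
  the integrals are taken in the height \<open>t\<close>, with dw = i dt. The margins
  \<open>l < a\<close> and \<open>b < r\<close> provide an open connected set around the closed
  rectangles.\<close>

lemma strip_residue_theorem:
  fixes \<Phi> :: "complex \<Rightarrow> complex" and B :: "real \<Rightarrow> real"
  assumes ab: "l < a" "a < b" "b < r" and P: "finite P" "P \<subseteq> {s. a < Re s \<and> Re s < b}"
    and holo: "\<Phi> holomorphic_on {s. l < Re s \<and> Re s < r} - P"
    and B: "(B \<longlongrightarrow> 0) at_top"
    and bound: "\<And>s. a \<le> Re s \<Longrightarrow> Re s \<le> b \<Longrightarrow> Y \<le> \<bar>Im s\<bar> \<Longrightarrow> norm (\<Phi> s) \<le> B \<bar>Im s\<bar>"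
    and int: "integrable lborel (\<lambda>t. \<Phi> (Complex a t))" "integrable lborel (\<lambda>t. \<Phi> (Complex b t))"
  shows "(LINT t|lborel. \<Phi> (Complex b t)) - (LINT t|lborel. \<Phi> (Complex a t)) = 2 * pi * (\<Sum>p\<in>P. residue \<Phi> p)"
proof -
  define Ia where "Ia = (\<lambda>n::nat. integral {-real n..real n} (\<lambda>t. \<Phi> (Complex a t)))"
  define Ib where "Ib = (\<lambda>n::nat. integral {-real n..real n} (\<lambda>t. \<Phi> (Complex b t)))"
  define R where "R = (\<Sum>p\<in>P. residue \<Phi> p)"
  let ?S = "{s. l < Re s \<and> Re s < r}"
  have S: "?S = {s. l < Re s} \<inter> {s. Re s < r}" by auto
  have opS: "open ?S" unfolding S by (intro open_Int open_halfspace_Re_gt open_halfspace_Re_lt)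
  have conS: "connected ?S" unfolding S
    by (intro convex_connected convex_Int convex_halfspace_Re_gt convex_halfspace_Re_lt)
  obtain K where K: "\<And>p. p \<in> P \<Longrightarrow> \<bar>Im p\<bar> \<le> K"
    using P(1) by (metis finite_imageI imageI finite_nat_set_iff_bounded_le Max_ge)
  \<comment> \<open>Beyond \<open>K\<close> all poles lie inside the rectangle and have winding
    number 1; beyond \<open>Y\<close> both horizontal sides, of length \<open>b - a\<close>, are
    controlled by \<open>B\<close>.\<close>
  have est: "norm (Ib n - Ia n - 2 * pi * R) \<le> 2 * ((b - a) * B (real n))"
    if n: "real n > max 1 (max K Y)" for n :: nat
  proof -
    define T where "T = real n"
    have T: "T > 1" "T > K" "T > Y" using n by (auto simp: T_def)
    let ?g = "rectpath (Complex a (-T)) (Complex b T)"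
    have im: "path_image ?g = cbox (Complex a (-T)) (Complex b T) - box (Complex a (-T)) (Complex b T)"
      using ab T by (intro path_image_rectpath_cbox_minus_box) auto
    have Pbox: "P \<subseteq> box (Complex a (-T)) (Complex b T)"
      using P(2) K T by (fastforce simp: in_box_complex_iff)
    have cb: "cbox (Complex a (-T)) (Complex b T) \<subseteq> ?S" using ab by (auto simp: in_cbox_complex_iff)
    have im2: "path_image ?g \<subseteq> ?S - P" using im Pbox cb by auto
    have cont: "continuous_on (path_image ?g) \<Phi>"
      using holo im2 by (meson continuous_on_subset holomorphic_on_imp_continuous_on)
    have "contour_integral ?g \<Phi> = 2 * pi * \<i> * (\<Sum>p\<in>P. winding_number ?g p * residue \<Phi> p)"
    proof (rule Residue_theorem[OF opS conS P(1) holo _ _ im2])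
      show "\<forall>z. z \<notin> ?S \<longrightarrow> winding_number ?g z = 0"
      proof (intro allI impI)
        fix z assume "z \<notin> ?S"
        then have "z \<notin> cbox (Complex a (-T)) (Complex b T)" using cb by blast
        then show "winding_number ?g z = 0"
          using ab T by (intro winding_number_rectpath_outside) auto
      qed
    qed auto
    also have "(\<Sum>p\<in>P. winding_number ?g p * residue \<Phi> p) = R"
      unfolding R_def using Pbox by (intro sum.cong) (auto simp: winding_number_rectpath)
    finally have g: "contour_integral ?g \<Phi> = 2 * pi * \<i> * R" .
    have dec: "contour_integral ?g \<Phi> = contour_integral (linepath (Complex a (-T)) (Complex b (-T))) \<Phi>
     + \<i> * Ib n + contour_integral (linepath (Complex b T) (Complex a T)) \<Phi> - \<i> * Ia n"
      unfolding Ia_def Ib_def T_def[symmetric] 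
      by (rule contour_integral_rectpath_decompose) (use ab T cont in auto)
    have hb: "norm (contour_integral (linepath (Complex x y) (Complex x' y)) \<Phi>) \<le> (b - a) * B T"
      if "x \<in> {a,b}" "x' \<in> {a,b}" "x \<noteq> x'" "\<bar>y\<bar> = T" for x x' y
    proof -
      have sub: "z \<in> path_image ?g \<and> a \<le> Re z \<and> Re z \<le> b \<and> \<bar>Im z\<bar> = T"
        if "z \<in> closed_segment (Complex x y) (Complex x' y)" for z
        using that \<open>x \<in> {a,b}\<close> \<open>x' \<in> {a,b}\<close> \<open>\<bar>y\<bar> = T\<close> ab T
        by (auto simp: closed_segment_same_Im closed_segment_eq_real_ivl path_image_rectpath split: if_splits)
      have "norm (contour_integral (linepath (Complex x y) (Complex x' y)) \<Phi>) \<le> B T * norm (Complex x' y - Complex x y)"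
      proof (rule contour_integral_bound_linepath)
        show "\<Phi> contour_integrable_on linepath (Complex x y) (Complex x' y)"
          using sub cont by (intro contour_integrable_continuous_linepath) (auto elim!: continuous_on_subset)
        have "norm (\<Phi> (Complex x y)) \<le> B T" using bound[of "Complex x y"] that ab T by auto
        then show "0 \<le> B T" using norm_ge_zero order_trans by blast
        show "norm (\<Phi> z) \<le> B T" if "z \<in> closed_segment (Complex x y) (Complex x' y)" for z
          using bound[of z] sub[OF that] T by auto
      qed
      also have "norm (Complex x' y - Complex x y) = b - a"
        using that ab by (auto simp: cmod_def)
      finally show ?thesis by (simp add: mult.commute)
    qed
    have "norm (Ib n - Ia n - 2 * pi * R) = norm (\<i> * (Ib n - Ia n - 2 * pi * R))" by (simp add: norm_mult)
    also have "\<i> * (Ib n - Ia n - 2 * pi * R) = 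
      - contour_integral (linepath (Complex a (-T)) (Complex b (-T))) \<Phi> - contour_integral (linepath (Complex b T) (Complex a T)) \<Phi>"
      using g dec by (simp add: algebra_simps)
    also have "norm \<dots> \<le> (b - a) * B T + (b - a) * B T"
      using ab T by (intro order_trans[OF norm_triangle_ineq4] add_mono) (simp_all only: norm_minus_cancel, auto intro!: hb)
    finally show ?thesis by (simp add: T_def algebra_simps)
  qed
  have lim: "(\<lambda>n. Ib n - Ia n - 2 * pi * R) \<longlonglongrightarrow> (LINT t|lborel. \<Phi> (Complex b t)) - (LINT t|lborel. \<Phi> (Complex a t)) - 2 * pi * R"
    unfolding Ia_def Ib_def by (intro tendsto_intros tendsto_integral_symmetric_interval int)
  have "(\<lambda>n. Ib n - Ia n - 2 * pi * R) \<longlonglongrightarrow> 0"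
  proof (rule Lim_null_comparison)
    have "filterlim real at_top sequentially" by (rule filterlim_real_sequentially)
    then have "\<forall>\<^sub>F n in sequentially. real n > max 1 (max K Y)" unfolding filterlim_at_top_dense by blast
    then show "\<forall>\<^sub>F n in sequentially. norm (Ib n - Ia n - 2 * pi * R) \<le> 2 * ((b - a) * B (real n))"
      by (rule eventually_mono) (use est in auto)
    have "(\<lambda>n. B (real n)) \<longlonglongrightarrow> 0" by (rule filterlim_compose[OF B filterlim_real_sequentially])
    then have "(\<lambda>n. 2 * ((b - a) * B (real n))) \<longlonglongrightarrow> 2 * ((b - a) * 0)" by (intro tendsto_intros)
    then show "(\<lambda>n. 2 * ((b - a) * B (real n))) \<longlonglongrightarrow> 0" by simp
  qed
  from LIMSEQ_unique[OF lim this] show ?thesis by (simp add: R_def)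
qed

lemma set_integrable_powr_atLeast:
  fixes \<beta> :: real assumes "\<beta> > 1" "T > 0"
  shows "set_integrable lborel {T..} (\<lambda>t. t powr (-\<beta>))"
proof -
  have "((\<lambda>x. x powr (-\<beta>)) has_integral -(T powr (-\<beta>+1)) / (-\<beta>+1)) {T..}"
    by (rule has_integral_powr_to_inf) (use assms in auto)
  then have "(\<lambda>t. t powr (-\<beta>)) absolutely_integrable_on {T..}"
    by (intro nonnegative_absolutely_integrable_1) (auto simp: integrable_on_def)
  then show ?thesis unfolding set_integrable_def by (subst (asm) integrable_completion) auto
qed

lemma integrable_line_powr_decay:
  fixes \<phi> :: "real \<Rightarrow> complex"
  assumes cont: "continuous_on UNIV \<phi>" and "\<beta> > 1"
    and "\<And>t. T \<le> \<bar>t\<bar> \<Longrightarrow> norm (\<phi> t) \<le> C * \<bar>t\<bar> powr (-\<beta>)"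
  shows "integrable lborel \<phi>"
proof -
  define S where "S = max 1 T"
  have S: "S \<ge> 1" "S \<ge> T" by (auto simp: S_def)
  obtain M where M: "\<And>t. t \<in> {-S..S} \<Longrightarrow> norm (\<phi> t) \<le> M"
    using compact_imp_bounded[OF compact_continuous_image[of "{-S..S}" \<phi>]] continuous_on_subset[OF cont]
    unfolding bounded_iff by fastforce
  define w where "w = (\<lambda>t. indicator {-S..S} t * M + \<bar>C\<bar> * (indicator {S..} t * t powr (-\<beta>)) + \<bar>C\<bar> * (indicator {S..} (-t) * (-t) powr (-\<beta>)))"
  have i: "integrable lborel (\<lambda>t. indicator {S..} t * t powr (-\<beta>))"
    using set_integrable_powr_atLeast[of \<beta> S] assms S by (simp add: set_integrable_def)
  have "integrable lborel (\<lambda>t. indicator {S..} (-t) * (-t) powr (-\<beta>))"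
    using lborel_integrable_real_affine[OF i, of "-1" 0] by simp
  moreover have "integrable lborel (indicat_real {-S..S})" by (intro integrable_real_indicator emeasure_bounded_finite) auto
  ultimately have w: "integrable lborel w" using i unfolding w_def
    by (intro Bochner_Integration.integrable_add integrable_mult_right integrable_mult_left) auto
  show ?thesis
  proof (rule Bochner_Integration.integrable_bound[OF w])
    show "\<phi> \<in> borel_measurable lborel" using borel_measurable_continuous_onI[OF cont] by simp
    have "norm (\<phi> t) \<le> w t" for t
    proof -
      consider "t \<in> {-S..S}" | "t > S" | "t < -S" by fastforce
      then show ?thesis
      proof cases
        case 1
        have "norm (\<phi> t) \<le> M" using M 1 by blast
        also have "M \<le> w t" using 1 by (simp add: w_def)
        finally show ?thesis .
      next
        case 2
        have "norm (\<phi> t) \<le> C * \<bar>t\<bar> powr (-\<beta>)" by (rule assms(3)) (use 2 S in auto)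
        also have "\<dots> \<le> \<bar>C\<bar> * \<bar>t\<bar> powr (-\<beta>)" by (intro mult_right_mono) auto
        finally show ?thesis using 2 S by (simp add: w_def)
      next
        case 3
        have "norm (\<phi> t) \<le> C * \<bar>t\<bar> powr (-\<beta>)" by (rule assms(3)) (use 3 S in auto)
        also have "\<dots> \<le> \<bar>C\<bar> * \<bar>t\<bar> powr (-\<beta>)" by (intro mult_right_mono) auto
        finally show ?thesis using 3 S by (simp add: w_def)
      qed
    qed
    then show "AE t in lborel. norm (\<phi> t) \<le> norm (w t)"
      by (intro AE_I2) (metis abs_ge_self order_trans real_norm_def)
  qed
qed


text \<open>Only \<open>F\<close> itself has to be dominated. Cauchy's inequality on discs of radius
  \<open>r/4\<close> converts this into the bound \<open>4 * G x / r\<close> for the derivative,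
  hence for the difference quotients with \<open>norm h < r / 2\<close>, and dominated convergence
  moves the limit under the integral.\<close>

lemma holomorphic_on_LINT:
  fixes F :: "complex \<Rightarrow> 'a \<Rightarrow> complex"
  assumes U: "open U"
    and meas: "\<And>s. s \<in> U \<Longrightarrow> F s \<in> borel_measurable M"
    and holo: "\<And>x. x \<in> space M \<Longrightarrow> (\<lambda>s. F s x) holomorphic_on U"
    and dom: "\<And>s. s \<in> U \<Longrightarrow> \<exists>r>0. \<exists>G. integrable M G \<and> (\<forall>z\<in>ball s r \<inter> U. \<forall>x\<in>space M. norm (F z x) \<le> G x)"
  shows "(\<lambda>s. LINT x|M. F s x) holomorphic_on U"
  unfolding holomorphic_on_open[OF U]
proof
  fix s assume s: "s \<in> U"
  obtain r0 G where r0: "r0 > 0" "integrable M G" "\<And>z x. z \<in> ball s r0 \<inter> U \<Longrightarrow> x \<in> space M \<Longrightarrow> norm (F z x) \<le> G x"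
    using dom[OF s] by blast
  obtain r1 where r1: "r1 > 0" "ball s r1 \<subseteq> U" using U s open_contains_ball by blast
  define r where "r = min r0 r1"
  have r: "r > 0" "ball s r \<subseteq> U" using r0 r1 by (auto simp: r_def)
  have G: "norm (F z x) \<le> G x" if "z \<in> ball s r" "x \<in> space M" for z x
    using r0(3)[of z x] that r by (auto simp: r_def)
  have holor: "(\<lambda>z. F z x) holomorphic_on ball s r" if "x \<in> space M" for x
    using holo[OF that] r(2) by (rule holomorphic_on_subset)
  define D where "D = (\<lambda>x. deriv (\<lambda>z. F z x) s)"
  have quot: "norm ((F (s + h) x - F s x) / h) \<le> 4 * G x / r"
    if h: "h \<noteq> 0" "norm h < r / 2" and x: "x \<in> space M" for h x
  proof -
    have "norm (F (s + h) x - F s x) \<le> (4 * G x / r) * norm (s + h - s)"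
    proof (rule field_differentiable_bound[where S = "ball s (r/2)" and f' = "deriv (\<lambda>z. F z x)"])
      fix z assume z: "z \<in> ball s (r/2)"
      have "dist s z < r/2" using z by simp
      have sub: "cball z (r/4) \<subseteq> ball s r"
      proof
        fix u assume "u \<in> cball z (r/4)"
        then have "dist s u \<le> dist s z + r/4" using dist_triangle[of s u z] by simp
        then show "u \<in> ball s r" using \<open>dist s z < r/2\<close> r(1) by simp
      qed
      have "(\<lambda>z. F z x) field_differentiable at z"
        using holor[OF x] sub r(1) by (meson open_ball centre_in_cball holomorphic_on_imp_differentiable_at less_eq_real_def subset_eq zero_less_divide_iff zero_less_numeral)
      then show "((\<lambda>z. F z x) has_field_derivative deriv (\<lambda>z. F z x) z) (at z within ball s (r/2))"
        using DERIV_deriv_iff_field_differentiable has_field_derivative_at_within by blast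
      have "norm ((deriv ^^ 1) (\<lambda>z. F z x) z) \<le> fact 1 * G x / (r/4) ^ 1"
      proof (rule Cauchy_inequality)
        show "(\<lambda>z. F z x) holomorphic_on ball z (r/4)"
          using holor[OF x] sub ball_subset_cball by (meson holomorphic_on_subset subset_trans)
        show "continuous_on (cball z (r/4)) (\<lambda>z. F z x)"
          using holor[OF x] sub by (meson holomorphic_on_subset holomorphic_on_imp_continuous_on)
        show "norm (F w x) \<le> G x" if "norm (z - w) = r/4" for w
          using G[of w x] sub that x by (auto simp: dist_norm)
      qed (use r in auto)
      then show "norm (deriv (\<lambda>z. F z x) z) \<le> 4 * G x / r" by (simp add: field_simps)
    qed (use h r in \<open>auto simp: dist_norm\<close>)
    then show ?thesis using h by (simp add: norm_divide divide_le_eq)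
  qed
  have lim: "((\<lambda>h. (F (s + h) x - F s x) / h) \<longlongrightarrow> D x) (at 0)" if x: "x \<in> space M" for x
  proof -
    have "(\<lambda>z. F z x) field_differentiable at s"
      using holor[OF x] r(1) by (meson open_ball centre_in_ball holomorphic_on_imp_differentiable_at)
    then show ?thesis unfolding D_def
      by (simp add: DERIV_deriv_iff_field_differentiable[symmetric] DERIV_def)
  qed
  \<comment> \<open>\<open>D\<close> is measurable as a pointwise limit of measurable quotients, so
    one sequence of increments yields both claims.\<close>
  have seq: "(\<lambda>n. LINT x|M. (F (s + X n) x - F s x) / X n) \<longlonglongrightarrow> (LINT x|M. D x)"
    and Dm: "D \<in> borel_measurable M"
    if X: "\<And>n. X n \<noteq> 0" "\<And>n. norm (X n) < r/2" "X \<longlonglongrightarrow> 0" for X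
  proof -
    have sX: "s + X n \<in> U" for n using r X(2)[of n] by (auto simp: dist_norm subset_eq)
    have m: "(\<lambda>x. (F (s + X n) x - F s x) / X n) \<in> borel_measurable M" for n
      using meas[OF sX[of n]] meas[OF s] by measurable
    have X0: "filterlim X (at 0) sequentially"
      using X unfolding filterlim_at by auto
    have l: "(\<lambda>n. (F (s + X n) x - F s x) / X n) \<longlonglongrightarrow> D x" if "x \<in> space M" for x
      using filterlim_compose[OF lim[OF that] X0] by simp
    show Dm: "D \<in> borel_measurable M"
      by (rule borel_measurable_LIMSEQ_metric[OF m l])
    show "(\<lambda>n. LINT x|M. (F (s + X n) x - F s x) / X n) \<longlonglongrightarrow> (LINT x|M. D x)"
    proof (rule integral_dominated_convergence[where w = "\<lambda>x. 4 * G x / r"])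
      show "integrable M (\<lambda>x. 4 * G x / r)" using r0(2) by auto
      show "AE x in M. (\<lambda>n. (F (s + X n) x - F s x) / X n) \<longlonglongrightarrow> D x" using l by (intro AE_I2)
      show "AE x in M. norm ((F (s + X n) x - F s x) / X n) \<le> 4 * G x / r" for n
        using quot[OF X(1)[of n] X(2)[of n]] by (intro AE_I2)
    qed (use Dm m in auto)
  qed
  have int: "integrable M (F z)" if "z \<in> ball s r" for z
  proof (rule Bochner_Integration.integrable_bound[OF r0(2)])
    show "F z \<in> borel_measurable M" using meas r that by blast
    show "AE x in M. norm (F z x) \<le> norm (G x)"
      using G[OF that] by (intro AE_I2) (metis abs_ge_self order_trans real_norm_def)
  qed
  have "((\<lambda>s. LINT x|M. F s x) has_field_derivative (LINT x|M. D x)) (at s)"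
    unfolding DERIV_def tendsto_at_iff_sequentially
  proof (intro allI impI)
    fix X :: "nat \<Rightarrow> complex" assume X: "\<forall>i. X i \<in> UNIV - {0}" "X \<longlonglongrightarrow> 0"
    obtain N where N: "\<And>n. n \<ge> N \<Longrightarrow> norm (X n) < r/2"
      using X(2) r(1) by (metis LIMSEQ_iff diff_zero half_gt_zero)
    have "(\<lambda>n. LINT x|M. (F (s + X (n + N)) x - F s x) / X (n + N)) \<longlonglongrightarrow> (LINT x|M. D x)"
      by (rule seq) (use X N LIMSEQ_ignore_initial_segment[OF X(2), of N] in auto)
    moreover have "(LINT x|M. (F (s + X (n + N)) x - F s x) / X (n + N)) = 
       ((LINT x|M. F (s + X (n + N)) x) - (LINT x|M. F s x)) / X (n + N)" for n
    proof -
      have "s + X (n + N) \<in> ball s r" using N[of "n + N"] r(1) by (simp add: dist_norm)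
      then show ?thesis using int[of s] int[of "s + X (n + N)"] r(1) by simp
    qed
    ultimately have "(\<lambda>n. ((LINT x|M. F (s + X (n + N)) x) - (LINT x|M. F s x)) / X (n + N)) \<longlonglongrightarrow> (LINT x|M. D x)"
      by (simp only:)
    from LIMSEQ_offset[OF this] 
    show "((\<lambda>h. ((LINT x|M. F (s + h) x) - (LINT x|M. F s x)) / h) \<circ> X) \<longlonglongrightarrow> (LINT x|M. D x)"
      by (simp add: o_def)
  qed
  then show "\<exists>f'. ((\<lambda>s. LINT x|M. F s x) has_field_derivative f') (at s)" by blast
qed

section \<open>Fubini for complex powers with constant real part of the exponent\<close>

lemma powr_complex_of_real_pos:
  assumes "y > 0"
  shows "complex_of_real y powr z = of_real (y powr Re z) * exp (\<i> * of_real (Im z * ln y))"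
proof -
  have "complex_of_real y powr z = exp (z * of_real (ln y))"
    using assms by (simp add: powr_def Ln_of_real)
  also have "z * of_real (ln y) = of_real (Re z * ln y) + \<i> * of_real (Im z * ln y)"
    by (simp add: complex_eq_iff)
  also have "exp \<dots> = of_real (y powr Re z) * exp (\<i> * of_real (Im z * ln y))"
    using assms by (simp only: exp_add powr_def exp_of_real) simp
  finally show ?thesis .
qed

lemma norm_powr_of_real_pos: "y > 0 \<Longrightarrow> norm (complex_of_real y powr z) = y powr Re z"
  by (simp add: powr_complex_of_real_pos norm_mult)

text \<open>Since all exponents have real part \<open>\<rho>\<close>, the power is
  \<open>y powr \<rho>\<close> times the unimodular factor \<open>E t y\<close>. With the modulus
  absorbed into \<open>H\<close>, the absolute value of the integrand is a product of a function of
  \<open>t\<close> and a function of \<open>y\<close>, so integrability on the plane reduces to that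
  of the two factors.\<close>

lemma Fubini_powr:
  fixes \<Phi> h :: "real \<Rightarrow> complex" and e :: "real \<Rightarrow> complex"
  assumes \<Phi>: "integrable lborel \<Phi>" and S: "S \<in> sets borel" "S \<subseteq> {0<..}"
    and h: "set_integrable lborel S (\<lambda>y. h y * of_real (y powr \<rho>))"
    and e: "e \<in> borel_measurable borel" "\<And>t. Re (e t) = \<rho>"
  shows "(LINT t|lborel. \<Phi> t * (LINT y:S|lborel. h y * of_real y powr e t)) =
      (LINT y:S|lborel. h y * (LINT t|lborel. \<Phi> t * of_real y powr e t))" (is ?th1)
    and "set_integrable lborel S (\<lambda>y. h y * (LINT t|lborel. \<Phi> t * of_real y powr e t))" (is ?th2)
proof -
  define H where "H = (\<lambda>y. indicator S y *\<^sub>R (h y * of_real (y powr \<rho>)))"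
  have H: "integrable lborel H" using h unfolding H_def set_integrable_def .
  define E where "E = (\<lambda>t y. exp (\<i> * complex_of_real (Im (e t) * ln y)))"
  define k where "k = (\<lambda>t y. \<Phi> t * H y * E t y)"
  have [measurable]: "\<Phi> \<in> borel_measurable borel" "H \<in> borel_measurable borel"
    using borel_measurable_integrable[OF \<Phi>] borel_measurable_integrable[OF H] by auto
  note [measurable] = e(1)
  have Imm[measurable]: "(Im :: complex \<Rightarrow> real) \<in> borel_measurable borel"
    by (intro borel_measurable_continuous_onI continuous_intros)
  have km: "(\<lambda>(t, y). k t y) \<in> borel_measurable (lborel \<Otimes>\<^sub>M lborel)"
    unfolding k_def E_def by measurable
  have nE: "norm (E t y) = 1" for t y unfolding E_def by simp
  have norm_k: "norm (k t y) = norm (\<Phi> t) * norm (H y)" for t y by (simp add: k_def norm_mult nE)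
  have ki: "integrable (lborel \<Otimes>\<^sub>M lborel) (\<lambda>(t, y). k t y)"
  proof (rule lborel_pair.Fubini_integrable[OF km])
    have "integrable lborel (\<lambda>t. norm (\<Phi> t) * (LINT y|lborel. norm (H y)))"
      using integrable_norm[OF \<Phi>] by simp
    then show "integrable lborel (\<lambda>x. LINT y|lborel. norm (case (x, y) of (t, y) \<Rightarrow> k t y))"
      by (simp add: norm_k)
    show "AE x in lborel. integrable lborel (\<lambda>y. case (x, y) of (t, y) \<Rightarrow> k t y)"
    proof (rule AE_I2, simp)
      fix t
      have "integrable lborel (\<lambda>y. norm (\<Phi> t) * norm (H y))" using integrable_norm[OF H] by simp
      then show "integrable lborel (k t)"
        by (rule Bochner_Integration.integrable_bound) (auto simp: norm_k, unfold k_def E_def, measurable)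
    qed
  qed
  have fub: "(LINT y|lborel. (LINT t|lborel. k t y)) = (LINT t|lborel. (LINT y|lborel. k t y))"
    by (rule lborel_pair.Fubini_integral[OF ki])
  have pw: "indicator S y *\<^sub>R (h y * of_real y powr e t) = H y * E t y" for y t
    using S(2) powr_complex_of_real_pos[of y "e t"] by (auto simp: H_def E_def e(2) indicator_def)
  have 1: "(LINT y|lborel. k t y) = \<Phi> t * (LINT y:S|lborel. h y * of_real y powr e t)" for t
    unfolding set_lebesgue_integral_def pw k_def by (simp add: mult.assoc)
  have 2: "(LINT t|lborel. k t y) = indicator S y *\<^sub>R (h y * (LINT t|lborel. \<Phi> t * of_real y powr e t))" for y
  proof -
    have "(LINT t|lborel. k t y) = (LINT t|lborel. (indicator S y *\<^sub>R h y) * (\<Phi> t * of_real y powr e t))"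
    proof (rule Bochner_Integration.integral_cong)
      fix t show "k t y = (indicator S y *\<^sub>R h y) * (\<Phi> t * of_real y powr e t)"
        using pw[of y t] by (cases "y \<in> S") (auto simp: k_def)
    qed auto
    then show ?thesis by simp
  qed
  show ?th1 using fub unfolding 1 2 set_lebesgue_integral_def by simp
  have "integrable lborel (\<lambda>y. LINT t|lborel. k t y)"
    using lborel_pair.integrable_snd[OF ki] by simp
  then show ?th2 unfolding 2 set_integrable_def .
qed

section \<open>Jensen's formula for the zeta function\<close>

text \<open>Near an integer N the squared cosecant is \<open>1 / (w - N)^2\<close> plus a
  holomorphic function. The residue of the kernel is therefore the derivative of
  \<open>w powr (1 - s)\<close> at N, that is \<open>(1 - s) * N powr (-s)\<close>, a term of the
  zeta series up to the factor \<open>1 - s\<close>.\<close>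

definition jensen_kernel :: "complex \<Rightarrow> complex \<Rightarrow> complex" where
  "jensen_kernel s w = w powr (1 - s) * (of_real pi / sin (of_real pi * w)) ^ 2"

definition jensen_integral :: "real \<Rightarrow> complex \<Rightarrow> complex" where
  "jensen_integral c s = (LINT t|lborel. jensen_kernel s (Complex c t))"

section \<open>Bounds for the Jensen kernel\<close>

lemma power_le_fact_exp: "0 \<le> x \<Longrightarrow> x ^ n \<le> fact n * exp (x::real)"
proof -
  assume x: "0 \<le> x"
  have "(\<lambda>k. x ^ k /\<^sub>R fact k) sums exp x" by (rule exp_converges)
  then have "sum (\<lambda>k. x ^ k /\<^sub>R fact k) {n} \<le> exp x"
    using x by (metis (no_types, lifting) finite.emptyI finite.insertI inverse_nonnegative_iff_nonnegative fact_ge_zero scaleR_nonneg_nonneg sum_le_suminf sums_iff zero_le_power)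
  then show ?thesis by (simp add: field_simps)
qed

lemma integrable_exp_minus_abs: "integrable lborel (\<lambda>v::real. exp (-\<bar>v\<bar>))"
proof -
  have "integrable lborel (\<lambda>v. complex_of_real (exp (-\<bar>v\<bar>)))"
  proof (rule integrable_line_powr_decay[where \<beta> = 2 and T = 1 and C = 2])
    fix v :: real assume v: "1 \<le> \<bar>v\<bar>"
    have "\<bar>v\<bar> ^ 2 \<le> fact 2 * exp \<bar>v\<bar>" by (rule power_le_fact_exp) auto
    then show "norm (complex_of_real (exp (-\<bar>v\<bar>))) \<le> 2 * \<bar>v\<bar> powr (-2)"
      using v by (simp only: norm_of_real) (simp add: powr_minus exp_minus field_simps fact_numeral)
  qed (auto intro!: continuous_intros)
  from integrable_Re[OF this] show ?thesis by simp
qed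

text \<open>Deliberately crude: growth \<open>exp (2 * |Im w|)\<close> is still beaten by the
  squared cosecant. \<open>X\<close> bounds both \<open>norm w\<close> and \<open>1 / norm w\<close>
  (the latter is at most 2, as \<open>Re w >= 1/2\<close>), so the sign of \<open>Re z\<close> does
  not matter, and the argument contributes at most \<open>exp (pi * K)\<close>.\<close>

lemma norm_powr_le_exp:
  assumes "1/2 \<le> Re w" "Re w \<le> c" "norm z \<le> real K"
  shows "norm (w powr z) \<le> fact K * exp (2 * (c + 1) + pi * K) * exp (2 * \<bar>Im w\<bar>)"
proof -
  define X where "X = 2 * (c + 1 + \<bar>Im w\<bar>)"
  have w: "norm w \<le> X" "1 / norm w \<le> X" "norm w > 0" "X \<ge> 1"
  proof -
    have "norm w \<le> \<bar>Re w\<bar> + \<bar>Im w\<bar>" by (rule cmod_le)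
    then show "norm w \<le> X" "X \<ge> 1" using assms by (auto simp: X_def)
    have "norm w \<ge> 1/2" using assms complex_Re_le_cmod[of w] by linarith
    then have "1 / norm w \<le> 1 / (1/2)" by (intro divide_left_mono) (auto intro: mult_pos_pos)
    then have "1 / norm w \<le> 2" by simp
    also have "2 \<le> X" using assms by (simp add: X_def)
    finally show "1 / norm w \<le> X" .
    show "norm w > 0" using \<open>norm w \<ge> 1/2\<close> by linarith
  qed
  have z: "\<bar>Re z\<bar> \<le> real K" "\<bar>Im z\<bar> \<le> real K"
    using assms(3) abs_Re_le_cmod[of z] abs_Im_le_cmod[of z] by linarith+
  have "norm w powr Re z \<le> X powr \<bar>Re z\<bar>"
  proof (cases "Re z \<ge> 0")
    case True
    then show ?thesis using w by (simp add: powr_mono2)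
  next
    case False
    then have "norm w powr Re z = (1 / norm w) powr \<bar>Re z\<bar>"
      using w by (simp add: powr_divide powr_minus_divide[symmetric])
    also have "\<dots> \<le> X powr \<bar>Re z\<bar>" using w by (intro powr_mono2) auto
    finally show ?thesis .
  qed
  also have "\<dots> \<le> X powr real K" using z w by (intro powr_mono) auto
  also have "\<dots> = X ^ K" using w by (simp add: powr_realpow)
  also have "\<dots> \<le> fact K * exp X" using w by (intro power_le_fact_exp) auto
  finally have 1: "norm w powr Re z \<le> fact K * exp X" .
  have "- Im z * Arg w \<le> \<bar>Im z\<bar> * \<bar>Arg w\<bar>" by (metis abs_ge_self abs_minus_cancel abs_mult)
  also have "\<dots> \<le> real K * pi" using z Arg_bounded[of w] by (intro mult_mono) auto
  finally have 2: "exp (- Im z * Arg w) \<le> exp (pi * K)" by (simp add: mult.commute)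
  have "norm (w powr z) \<le> (fact K * exp X) * exp (pi * K)"
    unfolding norm_powr_complex by (intro mult_mono 1 2) auto
  then show ?thesis by (simp add: X_def exp_add algebra_simps)
qed

text \<open>The alternative in the hypothesis describes the two kinds of sides of the rectangles:
  horizontal ones at height at least 1, and vertical ones at half-integers, where the cosine is -1.
  Either way the squared sine is at least an eighth of \<open>exp (2 * pi * |Im w|)\<close>; on
  horizontal sides this needs that exponential to be at least 4.\<close>

lemma norm_cosecant_squared_le:
  assumes "1 \<le> \<bar>Im w\<bar> \<or> cos (2 * pi * Re w) = -1"
  shows "norm ((of_real pi / sin (of_real pi * w)) ^ 2) \<le> 8 * pi\<^sup>2 * exp (- 2 * pi * \<bar>Im w\<bar>)"
proof -
  define v where "v = \<bar>Im w\<bar>"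
  have aux1: "A / 8 \<le> (A + B + 2) / 4" if "A > 0" "B > 0" for A B :: real using that by simp
  have aux2: "A / 8 \<le> (A + B - 2 * c) / 4" if "A \<ge> 4" "B > 0" "c \<le> 1" for A B c :: real using that by argo
  have e: "norm (sin (of_real pi * w)) ^ 2 = (exp (2 * pi * v) + exp (- (2 * pi * v)) - 2 * cos (2 * pi * Re w)) / 4"
  proof -
    have "norm (sin (of_real pi * w)) ^ 2 = (exp (2 * (pi * Im w)) + exp (- (2 * (pi * Im w))) - 2 * cos (2 * (pi * Re w))) / 4"
      by (simp only: norm_sin_squared exp_minus) simp
    also have "exp (2 * (pi * Im w)) + exp (- (2 * (pi * Im w))) = exp (2 * pi * v) + exp (- (2 * pi * v))"
    proof (cases "Im w \<ge> 0")
      case True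
      then have "v = Im w" by (simp add: v_def)
      then show ?thesis by (simp only: mult.assoc)
    next
      case False
      then have v: "v = - Im w" by (simp add: v_def)
      show ?thesis unfolding v by (simp only: mult_minus_right minus_minus mult.assoc add.commute)
    qed
    finally show ?thesis by (simp only: mult.assoc)
  qed
  have "norm (sin (of_real pi * w)) ^ 2 \<ge> exp (2 * pi * v) / 8"
  proof (cases "cos (2 * pi * Re w) = -1")
    case True
    have "norm (sin (of_real pi * w)) ^ 2 = (exp (2 * pi * v) + exp (- (2 * pi * v)) + 2) / 4"
      unfolding e True by simp
    then show ?thesis using aux1[OF exp_gt_zero exp_gt_zero] by (simp only:)
  next
    case False
    then have "v \<ge> 1" using assms by (simp add: v_def)
    then have "3 * 1 \<le> (2 * pi) * v" using pi_gt3 by (intro mult_mono) auto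
    then have "2 * pi * v \<ge> 3" by simp
    then have x: "exp (2 * pi * v) \<ge> 4" using exp_ge_add_one_self[of "2 * pi * v"] by linarith
    have "cos (2 * pi * Re w) \<le> 1" by simp
    then show ?thesis unfolding e by (rule aux2[OF x exp_gt_zero])
  qed
  note le = this
  have E: "exp (2 * pi * v) / 8 > 0" by simp
  then have pos: "norm (sin (of_real pi * w)) ^ 2 > 0" using le by (rule less_le_trans)
  have r: "a / (b / 8) = 8 * a * inverse b" for a b :: real by (cases "b = 0") (auto simp: field_simps)
  have E': "inverse (exp (2 * pi * v)) = exp (- 2 * pi * v)"
    by (simp only: exp_minus[symmetric] mult_minus_left)
  have "norm ((of_real pi / sin (of_real pi * w)) ^ 2) = pi\<^sup>2 / norm (sin (of_real pi * w)) ^ 2"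
    by (simp add: norm_divide norm_power power_divide)
  then show ?thesis
    using divide_left_mono[OF le zero_le_power2[of pi] mult_pos_pos[OF pos E]] unfolding r E' unfolding v_def by (simp only:)
qed

definition jensen_constant :: "real \<Rightarrow> nat \<Rightarrow> real" where
  "jensen_constant c K = fact K * exp (2 * (c + 1) + pi * K) * (8 * pi\<^sup>2)"

text \<open>The power costs \<open>exp (2 * |Im w|)\<close>, the cosecant earns
  \<open>exp (- 2 * pi * |Im w|)\<close>, and \<open>3 <= 2 * pi\<close> leaves
  \<open>exp (- |Im w|)\<close>. The constant depends on \<open>s\<close> only through the bound
  \<open>K\<close>, which gives a majorant locally uniform in \<open>s\<close>.\<close>

lemma jensen_kernel_bound:
  assumes h: "norm (1 - s) \<le> real K" "1/2 \<le> Re w" "Re w \<le> c" "1 \<le> \<bar>Im w\<bar> \<or> cos (2 * pi * Re w) = -1"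
  shows "norm (jensen_kernel s w) \<le> jensen_constant c K * exp (-\<bar>Im w\<bar>)"
proof -
  let ?M = "jensen_constant c K"
  have "norm (jensen_kernel s w) \<le> (fact K * exp (2 * (c + 1) + pi * K) * exp (2 * \<bar>Im w\<bar>)) * (8 * pi\<^sup>2 * exp (- 2 * pi * \<bar>Im w\<bar>))"
    unfolding jensen_kernel_def norm_mult using h
    by (intro mult_mono norm_powr_le_exp norm_cosecant_squared_le) auto
  also have "\<dots> = ?M * exp (2 * \<bar>Im w\<bar> - 2 * pi * \<bar>Im w\<bar>)" by (simp add: jensen_constant_def exp_diff exp_minus field_simps)
  also have "\<dots> \<le> ?M * exp (-\<bar>Im w\<bar>)"
  proof (intro mult_left_mono)
    have "3 * \<bar>Im w\<bar> \<le> 2 * pi * \<bar>Im w\<bar>" using pi_gt3 by (intro mult_right_mono) auto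
    then show "exp (2 * \<bar>Im w\<bar> - 2 * pi * \<bar>Im w\<bar>) \<le> exp (-\<bar>Im w\<bar>)" by simp
  qed (simp add: jensen_constant_def)
  finally show ?thesis .
qed

lemma cos_two_pi_half_integer: "cos (2 * pi * (real N + 1/2)) = -1"
  using cos_2npi[of N] by (simp add: distrib_left cos_add mult_ac)

lemma sin_pi_complex_nonzero:
  assumes "\<And>n::int. w \<noteq> of_int n"
  shows "sin (of_real pi * w) \<noteq> (0::complex)"
proof
  assume "sin (of_real pi * w) = 0"
  then obtain n :: int where "of_real pi * w = of_real (of_int n * pi)" unfolding sin_eq_0 by blast
  then have "w = of_int n" by simp
  then show False using assms by blast
qed

lemma jensen_kernel_holomorphic:
  assumes "\<And>w. w \<in> A \<Longrightarrow> 0 < Re w \<and> (\<forall>n::int. w \<noteq> of_int n)"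
  shows "jensen_kernel s holomorphic_on A"
  unfolding jensen_kernel_def
proof (intro holomorphic_intros)
  fix w assume "w \<in> A"
  then show "w \<notin> \<real>\<^sub>\<le>\<^sub>0" "sin (of_real pi * w) \<noteq> 0"
    using assms[of w] sin_pi_complex_nonzero[of w] by (auto simp: complex_nonpos_Reals_iff)
qed

lemma jensen_kernel_line_continuous:
  "continuous_on UNIV (\<lambda>t. jensen_kernel s (Complex (real N + 1/2) t))"
proof -
  have "jensen_kernel s holomorphic_on {w. Re w = real N + 1/2}"
  proof (rule jensen_kernel_holomorphic, safe)
    fix n :: int assume "Re (of_int n) = real N + 1/2"
    then have "real_of_int (2 * n) = real_of_int (2 * int N + 1)" by simp
    then have "2 * n = 2 * int N + 1" by linarith
    then show False by presburger
  qed auto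
  then have "continuous_on {w. Re w = real N + 1/2} (jensen_kernel s)" by (rule holomorphic_on_imp_continuous_on)
  then show ?thesis
    by (rule continuous_on_vertical_line)
qed

lemma jensen_kernel_integrable: "integrable lborel (\<lambda>t. jensen_kernel s (Complex (real N + 1/2) t))"
proof -
  obtain K :: nat where K: "norm (1 - s) \<le> real K" using real_arch_simple by blast
  define M where "M = jensen_constant (real N + 1/2) K"
  note M = jensen_kernel_bound[where K = K and c = "real N + 1/2", folded M_def]
  show ?thesis
  proof (rule Bochner_Integration.integrable_bound)
    show "integrable lborel (\<lambda>v. M * exp (-\<bar>v\<bar>))" using integrable_exp_minus_abs by simp
    show "(\<lambda>t. jensen_kernel s (Complex (real N + 1/2) t)) \<in> borel_measurable lborel"
      using borel_measurable_continuous_onI[OF jensen_kernel_line_continuous] by simp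
    have "norm (jensen_kernel s (Complex (real N + 1/2) t)) \<le> M * exp (-\<bar>t\<bar>)" for t
      using M[OF K, of "Complex (real N + 1/2) t"] cos_two_pi_half_integer[of N] by simp
    then show "AE t in lborel. norm (jensen_kernel s (Complex (real N + 1/2) t)) \<le> norm (M * exp (-\<bar>t\<bar>))"
      by (intro AE_I2) (metis abs_ge_self order_trans real_norm_def)
  qed
qed

text \<open>By the reflection formula, pi z / sin (pi z) is the product \<open>q z\<close> of two
  Gamma values, holomorphic and equal to 1 at 0. This exhibits the double pole as
  \<open>f z / z ^ 2\<close> without any removable singularity, and the residue is the derivative of
  \<open>f\<close> at 0.\<close>

lemma residue_jensen_kernel:
  assumes "N \<ge> 1"
  shows "residue (jensen_kernel s) (of_nat N) = (1 - s) * of_nat N powr (-s)"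
proof -
  define q where "q = (\<lambda>z::complex. Gamma (1 + z) * Gamma (1 - z))"
  define f where "f = (\<lambda>z::complex. (z + of_nat N) powr (1 - s) * q z ^ 2)"
  have nonpos: "1 + z \<notin> \<int>\<^sub>\<le>\<^sub>0" "1 - z \<notin> \<int>\<^sub>\<le>\<^sub>0" if "z \<in> ball 0 (1/2)" for z :: complex
  proof -
    have "\<bar>Re z\<bar> < 1/2" using that abs_Re_le_cmod[of z] by (simp add: dist_norm)
    then show "1 + z \<notin> \<int>\<^sub>\<le>\<^sub>0" "1 - z \<notin> \<int>\<^sub>\<le>\<^sub>0"
      by (auto elim!: nonpos_Ints_cases dest!: arg_cong[of _ _ Re])
  qed
  have slit: "z + of_nat N \<notin> \<real>\<^sub>\<le>\<^sub>0" if "z \<in> ball 0 (1/2)" for z :: complex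
  proof -
    have "\<bar>Re z\<bar> < 1/2" using that abs_Re_le_cmod[of z] by (simp add: dist_norm)
    then show ?thesis using assms by (auto simp: complex_nonpos_Reals_iff)
  qed
  have holf: "f holomorphic_on ball 0 (1/2)"
    unfolding f_def q_def using nonpos slit by (intro holomorphic_intros) auto
  have eq: "\<forall>\<^sub>F z in at 0. jensen_kernel s (z + of_nat N) = f z / z ^ Suc 1"
    unfolding eventually_at
  proof (intro exI[of _ "1/2"] conjI ballI impI)
    fix z :: complex assume "z \<noteq> 0 \<and> dist z 0 < 1/2"
    then have z: "z \<noteq> 0" "z \<in> ball 0 (1/2)" by auto
    have "sin (of_real pi * (z + of_nat N)) = sin (of_real pi * z) * cos (of_real (pi * real N)) + cos (of_real pi * z) * sin (of_real (pi * real N))"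
      by (simp add: distrib_left sin_add)
    also have "\<dots> = sin (of_real pi * z) * (-1) ^ N"
      by (simp only: cos_of_real sin_of_real mult.commute[of pi "real N"] cos_npi sin_npi) simp
    finally have s2: "sin (of_real pi * (z + of_nat N)) = sin (of_real pi * z) * (-1) ^ N" .
    have nz: "z \<notin> \<int>\<^sub>\<le>\<^sub>0"
    proof
      assume "z \<in> \<int>\<^sub>\<le>\<^sub>0"
      then obtain n where "z = of_int n" "n \<le> 0" by (auto elim!: nonpos_Ints_cases)
      moreover have "norm z < 1/2" using z by (simp add: dist_norm)
      ultimately have "n = 0" by simp
      then show False using z \<open>z = of_int n\<close> by simp
    qed
    have "of_real pi / sin (of_real pi * z) = Gamma z * Gamma (1 - z)" by (simp add: Gamma_reflection_complex)
    also have "\<dots> = q z / z" using Gamma_plus1[of z] nz z by (simp add: q_def add.commute)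
    finally have "of_real pi / sin (of_real pi * z) = q z / z" .
    then have "(of_real pi / sin (of_real pi * (z + of_nat N))) ^ 2 = (q z / z) ^ 2"
      unfolding s2 by (cases "even N") (auto simp: power_divide)
    then show "jensen_kernel s (z + of_nat N) = f z / z ^ Suc 1"
      by (simp add: jensen_kernel_def f_def power_divide power2_eq_square)
  qed auto
  have q0: "q 0 = 1" by (simp add: q_def)
  \<comment> \<open>\<open>q\<close> is even, so only the derivative of the power contributes to the residue.\<close>
  have q': "(q has_field_derivative 0) (at 0)"
  proof -
    have G: "(Gamma has_field_derivative Digamma 1) (at (1::complex))"
      using has_field_derivative_Gamma[of "1::complex" UNIV] by simp
    have 1: "((\<lambda>z. Gamma (1 + z :: complex)) has_field_derivative Digamma 1 * 1) (at 0)"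
      by (rule DERIV_chain2[where f = Gamma]) (auto simp: G intro!: derivative_eq_intros)
    have 2: "((\<lambda>z. Gamma (1 - z :: complex)) has_field_derivative Digamma 1 * (-1)) (at 0)"
      by (rule DERIV_chain2[where f = Gamma]) (auto simp: G intro!: derivative_eq_intros)
    show ?thesis using DERIV_mult[OF 1 2] unfolding q_def by simp
  qed
  have "(f has_field_derivative (1 - s) * of_nat N powr (-s)) (at 0)"
  proof -
    have N0: "(of_nat N :: complex) \<noteq> 0" using assms by simp
    have "((\<lambda>z. (z + of_nat N) powr (1 - s)) has_field_derivative (1 - s) * of_nat N powr (-s)) (at 0)"
      using slit[of 0] N0
      by (auto intro!: derivative_eq_intros simp: powr_diff powr_minus field_simps)
    from DERIV_mult[OF this DERIV_power[OF q', of 2]] show ?thesis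
      unfolding f_def by (simp add: q0)
  qed
  then have d: "deriv f 0 = (1 - s) * of_nat N powr (-s)" by (rule DERIV_imp_deriv)
  have "residue (jensen_kernel s) (of_nat N) = residue (\<lambda>z. jensen_kernel s (z + of_nat N)) 0"
    using residue_shift_0[of "jensen_kernel s" "of_nat N"] by (simp add: add.commute)
  also have "\<dots> = residue (\<lambda>z. f z / z ^ Suc 1) 0" by (rule residue_cong[OF eq refl])
  also have "\<dots> = (deriv ^^ 1) f 0 / fact 1"
    by (rule residue_holomorphic_over_power'[OF _ _ holf]) auto
  finally show ?thesis by (simp add: d)
qed

lemma jensen_integral_shift:
  fixes s :: complex assumes "N \<ge> 1"
  shows "jensen_integral (real N + 1/2) s - jensen_integral (real N - 1/2) s = 2 * pi * ((1 - s) * of_nat N powr (-s))"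
proof -
  obtain K :: nat where K: "norm (1 - s) \<le> real K" using real_arch_simple by blast
  define M where "M = jensen_constant (real N + 1/2) K"
  note M = jensen_kernel_bound[where K = K and c = "real N + 1/2", folded M_def]
  have N': "real N - 1/2 = real (N - 1) + 1/2" using assms by (simp add: of_nat_diff)
  have "(LINT t|lborel. jensen_kernel s (Complex (real N + 1/2) t)) - (LINT t|lborel. jensen_kernel s (Complex (real N - 1/2) t)) 
     = 2 * pi * (\<Sum>p\<in>{of_nat N}. residue (jensen_kernel s) p)"
  \<comment> \<open>The enlarged strip still contains no integer but \<open>N\<close>, and since
    \<open>N >= 1\<close> it stays to the right of 1/4, away from the branch cut of the
    power.\<close>
  proof (rule strip_residue_theorem[where l = "real N - 3/4" and r = "real N + 3/4" and B = "\<lambda>t. M * exp (-t)"])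
    show "jensen_kernel s holomorphic_on {s. real N - 3/4 < Re s \<and> Re s < real N + 3/4} - {of_nat N}"
    proof (rule jensen_kernel_holomorphic, safe)
      fix n :: int assume "real N - 3/4 < Re (of_int n)" "Re (of_int n) < real N + 3/4" "of_int n \<noteq> (of_nat N :: complex)"
      then have "real_of_int n < real_of_int (int N) + 1" "real_of_int (int N) - 1 < real_of_int n" by simp_all
      then have "n = int N" by linarith
      then show False using \<open>of_int n \<noteq> (of_nat N :: complex)\<close> by simp
    qed (use assms in auto)
    show "((\<lambda>t. M * exp (-t)) \<longlongrightarrow> 0) at_top" by real_asymp
    show "norm (jensen_kernel s w) \<le> M * exp (- \<bar>Im w\<bar>)"
      if "real N - 1/2 \<le> Re w" "Re w \<le> real N + 1/2" "1 \<le> \<bar>Im w\<bar>" for w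
      by (rule M) (use that assms K in auto)
    show "integrable lborel (\<lambda>t. jensen_kernel s (Complex (real N - 1/2) t))"
      unfolding N' by (rule jensen_kernel_integrable)
    show "integrable lborel (\<lambda>t. jensen_kernel s (Complex (real N + 1/2) t))"
      by (rule jensen_kernel_integrable)
  qed auto
  moreover have "(\<Sum>p\<in>{of_nat N}. residue (jensen_kernel s) p) = (1 - s) * of_nat N powr (-s)"
    using residue_jensen_kernel[OF assms, of s] by simp
  ultimately show ?thesis unfolding jensen_integral_def by (simp only:)
qed


text \<open>Valid for every \<open>s\<close>, also to the left of 1. This one identity yields the
  continuation, by \<open>N\<close> tending to infinity for \<open>Re s > 1\<close>, and the growth
  bound, by a choice of \<open>N\<close> depending on \<open>s\<close>.\<close>

lemma jensen_integral_eq_partial_sum: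
  fixes s :: complex
  shows "jensen_integral (1/2) s = 2 * pi * ((s - 1) * (\<Sum>n<N. 1 / of_nat (Suc n) powr s)) + jensen_integral (real N + 1/2) s"
proof (induction N)
  case (Suc N)
  have sh: "real (Suc N) - 1/2 = real N + 1/2" by simp
  have "jensen_integral (real N + 1/2) s = jensen_integral (real (Suc N) + 1/2) s - 2 * pi * ((1 - s) * of_nat (Suc N) powr (-s))"
    using jensen_integral_shift[of "Suc N" s] unfolding sh by (simp add: algebra_simps)
  also have "of_nat (Suc N) powr (-s) = 1 / of_nat (Suc N) powr s" by (simp only: powr_minus inverse_eq_divide)
  finally show ?case unfolding Suc by (simp add: algebra_simps diff_divide_distrib)
qed simp

lemma abs_arctan_le: "\<bar>arctan x\<bar> \<le> \<bar>x\<bar>"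
proof -
  have pos: "arctan x \<le> x" if "x \<ge> 0" for x
  proof -
    have "0 - arctan 0 \<le> x - arctan x"
    proof (rule DERIV_nonneg_imp_nondecreasing[OF that])
      fix y :: real
      have "((\<lambda>x. x - arctan x) has_real_derivative 1 - inverse (1 + y\<^sup>2)) (at y)"
        by (auto intro!: derivative_eq_intros)
      moreover have "inverse (1 + y\<^sup>2) \<le> 1" by (simp add: inverse_le_1_iff)
      ultimately show "\<exists>d. ((\<lambda>x. x - arctan x) has_real_derivative d) (at y) \<and> 0 \<le> d" by auto
    qed
    then show ?thesis by simp
  qed
  show ?thesis
  proof (cases "x \<ge> 0")
    case True then show ?thesis using pos[OF True] by simp
  next
    case False then show ?thesis using pos[of "-x"] by (simp add: arctan_minus)
  qed
qed

text \<open>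
For $|\mathrm{Im}\, s| \le N$ the factor $\exp (\mathrm{Im}\, s \cdot \mathrm{Arg}\, w)$ of $|w^{1-s}|$ is at most
$\exp |v|$ on the line $w = N + 1/2 + iv$, and the squared cosecant absorbs it. This makes the
constant independent of $s$.
\<close>
lemma jensen_integral_bound:
  assumes N: "N \<ge> 1" "\<bar>Im s\<bar> \<le> real N"
    and X: "\<And>v. norm (Complex (real N + 1/2) v) powr (1 - Re s) \<le> X * exp \<bar>v\<bar>"
  shows "norm (jensen_integral (real N + 1/2) s) \<le> (LINT v|lborel. 8 * pi\<^sup>2 * exp (-\<bar>v\<bar>)) * X"
proof -
  have X0: "X \<ge> 0" using X[of 0] by (meson exp_gt_zero order_trans powr_ge_zero zero_le_mult_iff not_less)
  have "norm (jensen_kernel s (Complex (real N + 1/2) v)) \<le> X * (8 * pi\<^sup>2 * exp (-\<bar>v\<bar>))" for v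
  proof -
    let ?w = "Complex (real N + 1/2) v"
    have "Arg ?w = arctan (v / (real N + 1/2))" by (subst arg_conv_arctan) (auto simp: complex_eq_iff)
    then have "\<bar>Arg ?w\<bar> \<le> \<bar>v\<bar> / (real N + 1/2)"
      using abs_arctan_le[of "v / (real N + 1/2)"] by (simp add: abs_divide)
    then have "\<bar>Im s\<bar> * \<bar>Arg ?w\<bar> \<le> real N * (\<bar>v\<bar> / (real N + 1/2))"
      using N by (intro mult_mono) auto
    also have "\<dots> \<le> \<bar>v\<bar>"
    proof -
      have "real N * \<bar>v\<bar> \<le> (real N + 1/2) * \<bar>v\<bar>" by (intro mult_right_mono) auto
      then show ?thesis by (simp add: divide_le_eq mult.commute)
    qed
    finally have "\<bar>Im s * Arg ?w\<bar> \<le> \<bar>v\<bar>" by (simp add: abs_mult)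
    then have ex: "exp (- Im (1 - s) * Arg ?w) \<le> exp \<bar>v\<bar>" by (simp add: abs_le_iff)
    have nz: "?w \<noteq> 0" by (auto simp: complex_eq_iff)
    have "norm (?w powr (1 - s)) \<le> (X * exp \<bar>v\<bar>) * exp \<bar>v\<bar>"
      unfolding norm_powr_complex by (intro mult_mono ex) (use X X0 in auto)
    moreover have "norm ((of_real pi / sin (of_real pi * ?w)) ^ 2) \<le> 8 * pi\<^sup>2 * exp (- 2 * pi * \<bar>v\<bar>)"
      using norm_cosecant_squared_le[of ?w] cos_two_pi_half_integer[of N] by simp
    ultimately have "norm (jensen_kernel s ?w) \<le> ((X * exp \<bar>v\<bar>) * exp \<bar>v\<bar>) * (8 * pi\<^sup>2 * exp (- 2 * pi * \<bar>v\<bar>))"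
      unfolding jensen_kernel_def norm_mult using X0 by (intro mult_mono) auto
    also have "\<dots> = X * (8 * pi\<^sup>2 * exp (\<bar>v\<bar> + \<bar>v\<bar> + - 2 * pi * \<bar>v\<bar>))"
      by (simp only: exp_add mult_ac)
    \<comment> \<open>One factor \<open>exp |v|\<close> comes from the hypothesis on
      \<open>X\<close>, the other from the argument; \<open>3 <= 2 * pi\<close> pays for both and
      leaves an integrable exponential.\<close>
    also have "\<dots> \<le> X * (8 * pi\<^sup>2 * exp (-\<bar>v\<bar>))"
    proof (intro mult_left_mono X0)
      have "3 * \<bar>v\<bar> \<le> 2 * pi * \<bar>v\<bar>" using pi_gt3 by (intro mult_right_mono) auto
      then show "exp (\<bar>v\<bar> + \<bar>v\<bar> + - 2 * pi * \<bar>v\<bar>) \<le> exp (-\<bar>v\<bar>)" by simp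
    qed auto
    finally show ?thesis .
  qed
  then have "norm (jensen_integral (real N + 1/2) s) \<le> (LINT v|lborel. X * (8 * pi\<^sup>2 * exp (-\<bar>v\<bar>)))"
    unfolding jensen_integral_def using integrable_exp_minus_abs jensen_kernel_integrable
    by (intro order_trans[OF integral_norm_bound] integral_mono) auto
  then show ?thesis by (simp add: mult.commute)
qed

lemma jensen_integral_entire: "jensen_integral (1/2) holomorphic_on UNIV"
  unfolding jensen_integral_def
proof (rule holomorphic_on_LINT)
  fix s :: complex
  show "(\<lambda>t. jensen_kernel s (Complex (1/2) t)) \<in> borel_measurable lborel"
    using borel_measurable_continuous_onI[OF jensen_kernel_line_continuous[of s 0]] by simp
  \<comment> \<open>The extra 1 makes the same \<open>K\<close>, and so the same majorant, valid on
    all of \<open>ball s 1\<close>.\<close>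
  obtain K :: nat where K: "norm (1 - s) + 1 \<le> real K" using real_arch_simple by blast
  define M where "M = jensen_constant (1/2) K"
  note M = jensen_kernel_bound[where K = K and c = "1/2", folded M_def]
  have "norm (jensen_kernel z (Complex (1/2) t)) \<le> M * exp (-\<bar>t\<bar>)" if "z \<in> ball s 1" for z t
  proof -
    have "norm (1 - z) \<le> norm (1 - s) + norm (s - z)" using norm_triangle_ineq[of "1 - s" "s - z"] by simp
    then have "norm (1 - z) \<le> real K" using that K by (simp add: dist_norm)
    then show ?thesis using M[of z "Complex (1/2) t"] cos_two_pi_half_integer[of 0] by simp
  qed
  then show "\<exists>r>0. \<exists>G. integrable lborel G \<and> (\<forall>z\<in>ball s r \<inter> UNIV. \<forall>x\<in>space lborel. norm (jensen_kernel z (Complex (1/2) x)) \<le> G x)"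
    using integrable_exp_minus_abs by (intro exI[of _ 1] conjI exI[of _ "\<lambda>t. M * exp (-\<bar>t\<bar>)"]) auto
next
  fix x :: real
  have nz: "Complex (1/2) x \<noteq> 0" by (auto simp: complex_eq_iff)
  have "(\<lambda>s. Complex (1/2) x powr (1 - s) * (of_real pi / sin (of_real pi * Complex (1/2) x)) ^ 2) holomorphic_on UNIV"
    using nz by (intro holomorphic_intros) auto
  then show "(\<lambda>s. jensen_kernel s (Complex (1/2) x)) holomorphic_on UNIV"
    unfolding jensen_kernel_def .
qed auto

text \<open>On the line \<open>norm w >= N\<close>, and \<open>1 - Re s\<close> is negative, so
  \<open>jensen_integral_bound\<close> applies with \<open>X = N powr (1 - Re s)\<close>, which
  tends to 0.\<close>

lemma jensen_integral_tendsto_0: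
  fixes s :: complex
  assumes "Re s > 1"
  shows "(\<lambda>N. jensen_integral (real N + 1/2) s) \<longlonglongrightarrow> 0"
proof -
  define C where "C = (LINT v|lborel. 8 * pi\<^sup>2 * exp (-\<bar>v\<bar>) :: real)"
  note J = jensen_integral_bound[folded C_def]
  obtain K :: nat where K: "\<bar>Im s\<bar> \<le> real K" using real_arch_simple by blast
  show ?thesis
  proof (rule Lim_null_comparison)
    show "\<forall>\<^sub>F N in sequentially. norm (jensen_integral (real N + 1/2) s) \<le> C * real N powr (1 - Re s)"
    proof (rule eventually_sequentiallyI[of "max 1 K"])
      fix N assume N: "max 1 K \<le> N"
      show "norm (jensen_integral (real N + 1/2) s) \<le> C * real N powr (1 - Re s)"
      proof (rule J)
        fix v
        have "real N \<le> norm (Complex (real N + 1/2) v)"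
          using complex_Re_le_cmod[of "Complex (real N + 1/2) v"] by simp
        then have "norm (Complex (real N + 1/2) v) powr (1 - Re s) \<le> real N powr (1 - Re s)"
          using N assms by (intro powr_mono2') auto
        also have "\<dots> \<le> real N powr (1 - Re s) * exp \<bar>v\<bar>" by (rule mult_left_mono[of 1 "exp \<bar>v\<bar>" "real N powr (1 - Re s)", simplified])
        finally show "norm (Complex (real N + 1/2) v) powr (1 - Re s) \<le> real N powr (1 - Re s) * exp \<bar>v\<bar>" .
      qed (use N K in auto)
    qed
    show "(\<lambda>N. C * real N powr (1 - Re s)) \<longlonglongrightarrow> 0"
      using assms by (intro tendsto_mult_right_zero tendsto_neg_powr filterlim_real_sequentially) auto
  qed
qed

section \<open>Continuation and growth of the zeta function\<close>

lemma jensen_zeta_sums: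
  fixes s :: complex
  assumes "Re s > 1"
  shows "(\<lambda>n. 1 / of_nat (Suc n) powr s) sums (jensen_integral (1/2) s / (2 * pi * (s - 1)))"
proof -
  have s1: "s - 1 \<noteq> 0" using assms by auto
  have "(\<lambda>N. (jensen_integral (1/2) s - jensen_integral (real N + 1/2) s) / (2 * pi * (s - 1))) \<longlonglongrightarrow> (jensen_integral (1/2) s - 0) / (2 * pi * (s - 1))"
    by (intro tendsto_intros jensen_integral_tendsto_0 assms) (use s1 in auto)
  also have "(\<lambda>N. (jensen_integral (1/2) s - jensen_integral (real N + 1/2) s) / (2 * pi * (s - 1))) = (\<lambda>N. \<Sum>n<N. 1 / of_nat (Suc n) powr s)"
  proof
    fix N
    show "(jensen_integral (1/2) s - jensen_integral (real N + 1/2) s) / (2 * pi * (s - 1)) = (\<Sum>n<N. 1 / of_nat (Suc n) powr s)"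
      unfolding jensen_integral_eq_partial_sum[of s N] using s1 by simp
  qed
  finally show ?thesis by (simp add: sums_def)
qed

text \<open>To unfold the definite description, uniqueness is required: two candidates agree on the
  half-plane \<open>Re s > 1\<close>, hence on the punctured plane because it is connected, and the
  convention at 1 fixes the remaining value.\<close>

lemma riemann_zeta_jensen:
  fixes s :: complex
  shows "riemann_zeta s = (if s = 1 then 0 else jensen_integral (1/2) s / (2 * pi * (s - 1)))"
proof -
  define g where "g = (\<lambda>s::complex. if s = 1 then 0 else jensen_integral (1/2) s / (2 * pi * (s - 1)))"
  have "(\<lambda>s::complex. jensen_integral (1/2) s / (2 * pi * (s - 1))) holomorphic_on -{1}"
    by (intro holomorphic_intros holomorphic_on_subset[OF jensen_integral_entire]) auto
  then have hol: "g holomorphic_on -{1}"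
    by (rule holomorphic_transform) (auto simp: g_def)
  have val: "g s = (\<Sum>n. 1 / of_nat (Suc n) powr s)" if "1 < Re s" for s
    using jensen_zeta_sums[OF that] that by (auto simp: g_def sums_iff)
  have "riemann_zeta = g"
    unfolding riemann_zeta_def
  proof (rule the_equality)
    show "g holomorphic_on -{1} \<and> (\<forall>s. 1 < Re s \<longrightarrow> g s = (\<Sum>n. 1 / of_nat (Suc n) powr s)) \<and> g 1 = 0"
      using hol val by (auto simp: g_def)
    fix h assume h: "h holomorphic_on -{1} \<and> (\<forall>s. 1 < Re s \<longrightarrow> h s = (\<Sum>n. 1 / of_nat (Suc n) powr s)) \<and> h 1 = 0"
    show "h = g"
    proof
      fix s :: complex
      show "h s = g s"
      proof (cases "s = 1")
        case True then show ?thesis using h by (simp add: g_def)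
      next
        case False
        show ?thesis
        proof (rule analytic_continuation_open[of "{s. 1 < Re s}" "-{1}" h g s])
          show "{s. 1 < Re s} \<noteq> {}" by (auto intro!: exI[of _ 2])
          show "connected (- {1::complex})" by (rule connected_punctured_universe) simp
        qed (use h hol val False in \<open>auto simp: open_halfspace_Re_gt\<close>)
      qed
    qed
  qed
  then show ?thesis unfolding g_def by (rule fun_cong)
qed

lemma holomorphic_riemann_zeta: "riemann_zeta holomorphic_on -{1}"
proof -
  have "(\<lambda>s::complex. jensen_integral (1/2) s / (2 * pi * (s - 1))) holomorphic_on -{1}"
    by (intro holomorphic_intros holomorphic_on_subset[OF jensen_integral_entire]) auto
  then show ?thesis by (rule holomorphic_transform) (auto simp: riemann_zeta_jensen)
qed

lemma riemann_zeta_sums: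
  assumes "Re s > 1"
  shows "(\<lambda>n. 1 / of_nat (Suc n) powr s) sums riemann_zeta s"
  using jensen_zeta_sums[OF assms] assms by (auto simp: riemann_zeta_jensen)

text \<open>By the mean value theorem and the monotonicity of \<open>x powr (-\<sigma>)\<close>,
  each term is at most the increment of \<open>x powr (1 - \<sigma>) / (1 - \<sigma>)\<close> over
  the unit interval ending there; the increments telescope.\<close>

lemma sum_powr_le:
  assumes "0 \<le> \<sigma>" "\<sigma> < 1"
  shows "(\<Sum>n<N. real (Suc n) powr (-\<sigma>)) \<le> real N powr (1 - \<sigma>) / (1 - \<sigma>)"
proof (induction N)
  case (Suc N)
  have "real (Suc N) powr (-\<sigma>) \<le> (real (Suc N) powr (1 - \<sigma>) - real N powr (1 - \<sigma>)) / (1 - \<sigma>)"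
  proof -
    have der: "((\<lambda>x. x powr (1 - \<sigma>)) has_real_derivative (1 - \<sigma>) * x powr (-\<sigma>)) (at x)" if "real N < x" for x
      using that by (auto intro!: derivative_eq_intros)
    have "\<exists>l z. real N < z \<and> z < real (Suc N) \<and> DERIV (\<lambda>x. x powr (1 - \<sigma>)) z :> l \<and>
        real (Suc N) powr (1 - \<sigma>) - real N powr (1 - \<sigma>) = (real (Suc N) - real N) * l"
    proof (rule MVT)
      show "continuous_on {real N..real (Suc N)} (\<lambda>x. x powr (1 - \<sigma>))"
        using assms by (intro continuous_on_powr' continuous_intros) auto
    qed (use der in \<open>auto simp: real_differentiable_def\<close>)
    then obtain l z where z: "real N < z" "z < real (Suc N)" "DERIV (\<lambda>x. x powr (1 - \<sigma>)) z :> l"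
        "real (Suc N) powr (1 - \<sigma>) - real N powr (1 - \<sigma>) = l" by auto
    have l: "l = (1 - \<sigma>) * z powr (-\<sigma>)" by (rule DERIV_unique[OF z(3) der[OF z(1)]])
    have "real (Suc N) powr (-\<sigma>) \<le> z powr (-\<sigma>)" using z assms by (intro powr_mono2') auto
    then show ?thesis unfolding z(4) l using assms by simp
  qed
  then show ?case using Suc by (simp add: diff_divide_distrib)
qed simp

text \<open>With \<open>N\<close> of the size of \<open>|Im s|\<close>, the partial sum and the
  Jensen remainder are both of order \<open>N powr (1 - \<sigma>)\<close>. The bound holds on the
  whole half-plane because bases at least 1 make \<open>1 - \<sigma>\<close> the worst exponent, and
  division by \<open>s - 1\<close> costs nothing as \<open>norm (s - 1) >= 1\<close>.\<close>

lemma riemann_zeta_bound: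
  assumes \<sigma>: "0 < \<sigma>" "\<sigma> < 1"
  obtains C where "C \<ge> 0" "\<And>s. \<sigma> \<le> Re s \<Longrightarrow> 1 \<le> \<bar>Im s\<bar> \<Longrightarrow> norm (riemann_zeta s) \<le> C * \<bar>Im s\<bar> powr (1 - \<sigma>)"
proof -
  define C where "C = (LINT v|lborel. 8 * pi\<^sup>2 * exp (-\<bar>v\<bar>) :: real)"
  note jb = jensen_integral_bound[folded C_def]
  have C: "C \<ge> 0" unfolding C_def by (intro integral_nonneg_AE AE_I2) simp
  define C' where "C' = 3 * (1 / (1 - \<sigma>) + C)"
  show thesis
  proof
    show "C' \<ge> 0" using C \<sigma> by (simp add: C'_def)
    fix s :: complex assume s: "\<sigma> \<le> Re s" "1 \<le> \<bar>Im s\<bar>"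
    \<comment> \<open>The least \<open>N\<close> that the uniform remainder bound admits. For x >= 1
      the ceiling of x plus 1 is at most x + 2 <= 3 x, which is the origin of the factor 3 in
      \<open>X\<close> and \<open>C'\<close>.\<close>
    define N where "N = nat \<lceil>\<bar>Im s\<bar>\<rceil>"
    have N: "1 \<le> N" "\<bar>Im s\<bar> \<le> real N" "real N + 1 \<le> 3 * \<bar>Im s\<bar>"
      using s by (auto simp: N_def) linarith+
    have s1: "s \<noteq> 1" using s by auto
    have s1': "norm (s - 1) \<ge> 1" using s abs_Im_le_cmod[of "s - 1"] by simp
    define X where "X = (3 * \<bar>Im s\<bar>) powr (1 - \<sigma>)"
    have X: "X \<ge> 0" "X \<le> 3 * \<bar>Im s\<bar> powr (1 - \<sigma>)" "(real N + 1) powr (1 - \<sigma>) \<le> X"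
    proof -
      have "3 powr (1 - \<sigma>) \<le> 3 powr (1::real)" using \<sigma> by (intro powr_mono) auto
      then show "X \<le> 3 * \<bar>Im s\<bar> powr (1 - \<sigma>)"
        unfolding X_def using s by (simp add: powr_mult mult_right_mono)
      show "(real N + 1) powr (1 - \<sigma>) \<le> X" unfolding X_def using N \<sigma> by (intro powr_mono2) auto
    qed (simp add: X_def)
    have "norm (jensen_integral (real N + 1/2) s) \<le> C * X"
    proof (rule jb[OF N(1,2)])
      fix v
      let ?w = "Complex (real N + 1/2) v"
      have w1: "norm ?w \<ge> 1" using complex_Re_le_cmod[of ?w] N(1) by simp
      have "norm ?w \<le> (real N + 1/2) + \<bar>v\<bar>" using cmod_le[of ?w] by simp
      also have "\<dots> \<le> (real N + 1) * (1 + \<bar>v\<bar>)" by (simp add: algebra_simps)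
      also have "\<dots> \<le> (real N + 1) * exp \<bar>v\<bar>" by (intro mult_left_mono exp_ge_add_one_self) auto
      finally have w2: "norm ?w \<le> (real N + 1) * exp \<bar>v\<bar>" .
      have "norm ?w powr (1 - Re s) \<le> norm ?w powr (1 - \<sigma>)" using w1 s by (intro powr_mono) auto
      also have "\<dots> \<le> ((real N + 1) * exp \<bar>v\<bar>) powr (1 - \<sigma>)" using w2 \<sigma> by (intro powr_mono2) auto
      also have "\<dots> = (real N + 1) powr (1 - \<sigma>) * exp ((1 - \<sigma>) * \<bar>v\<bar>)"
        by (simp add: powr_mult powr_def[of "exp \<bar>v\<bar>"])
      also have "\<dots> \<le> X * exp \<bar>v\<bar>"
      proof (intro mult_mono X)
        have "(1 - \<sigma>) * \<bar>v\<bar> \<le> 1 * \<bar>v\<bar>" using \<sigma> by (intro mult_right_mono) auto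
        then show "exp ((1 - \<sigma>) * \<bar>v\<bar>) \<le> exp \<bar>v\<bar>" by simp
      qed auto
      finally show "norm ?w powr (1 - Re s) \<le> X * exp \<bar>v\<bar>" .
    qed
    moreover have "norm (2 * pi * (s - 1)) \<ge> 1"
    proof -
      have "1 * 1 \<le> (2 * pi) * norm (s - 1)" using s1' pi_gt3 by (intro mult_mono) auto
      then show ?thesis by (simp add: norm_mult)
    qed
    ultimately have J: "norm (jensen_integral (real N + 1/2) s / (2 * pi * (s - 1))) \<le> C * X"
      unfolding norm_divide by (smt (verit) C X(1) divide_le_eq_1 frac_le mult_nonneg_nonneg norm_ge_zero div_by_1)
    have "norm (\<Sum>n<N. 1 / of_nat (Suc n) powr s) \<le> (\<Sum>n<N. real (Suc n) powr (-\<sigma>))"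
    proof (rule sum_norm_le)
      fix n
      have "norm (complex_of_nat (Suc n) powr s) = real (Suc n) powr Re s"
        using norm_powr_of_real_pos[of "real (Suc n)" s] by (simp only: of_real_of_nat_eq of_nat_0_less_iff zero_less_Suc)
      then have "norm (1 / complex_of_nat (Suc n) powr s) = real (Suc n) powr (- Re s)"
        by (simp only: norm_divide norm_one powr_minus_divide)
      also have "\<dots> \<le> real (Suc n) powr (-\<sigma>)" using s by (intro powr_mono) auto
      finally show "norm (1 / complex_of_nat (Suc n) powr s) \<le> real (Suc n) powr (-\<sigma>)" .
    qed
    also have "\<dots> \<le> real N powr (1 - \<sigma>) / (1 - \<sigma>)" by (rule sum_powr_le) (use \<sigma> in auto)
    also have "\<dots> \<le> X / (1 - \<sigma>)"
      using \<sigma> X(3) powr_mono2[of "1 - \<sigma>" "real N" "real N + 1"] by (intro divide_right_mono) auto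
    finally have S: "norm (\<Sum>n<N. 1 / of_nat (Suc n) powr s) \<le> X / (1 - \<sigma>)" .
    have "riemann_zeta s = (\<Sum>n<N. 1 / of_nat (Suc n) powr s) + jensen_integral (real N + 1/2) s / (2 * pi * (s - 1))"
      using s1 unfolding riemann_zeta_jensen by (subst jensen_integral_eq_partial_sum[of s N]) (simp add: add_divide_distrib)
    then have "norm (riemann_zeta s) \<le> X / (1 - \<sigma>) + C * X"
      using order_trans[OF norm_triangle_ineq add_mono[OF S J]] by (simp only:)
    also have "\<dots> = (1 / (1 - \<sigma>) + C) * X" by (simp add: algebra_simps)
    also have "\<dots> \<le> (1 / (1 - \<sigma>) + C) * (3 * \<bar>Im s\<bar> powr (1 - \<sigma>))"
      using C \<sigma> by (intro mult_left_mono X) auto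
    finally show "norm (riemann_zeta s) \<le> C' * \<bar>Im s\<bar> powr (1 - \<sigma>)" unfolding C'_def by (simp only: mult_ac)
  qed
qed

section \<open>Euler products\<close>

definition smooth_numbers :: "nat \<Rightarrow> nat set" where
  "smooth_numbers N = {n. 0 < n \<and> (\<forall>p. prime p \<and> p dvd n \<longrightarrow> p \<le> N)}"

definition multiplicative :: "(nat \<Rightarrow> 'a::comm_semiring_1) \<Rightarrow> bool" where
  "multiplicative a \<longleftrightarrow> a 1 = 1 \<and> (\<forall>m n. 0 < m \<longrightarrow> 0 < n \<longrightarrow> coprime m n \<longrightarrow> a (m * n) = a m * a n)"

lemma smooth_numbers_0: "smooth_numbers 0 = {1}"
proof -
  have "n = 1" if "0 < n" "\<forall>p. prime p \<and> p dvd n \<longrightarrow> p \<le> 0" for n :: nat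
    using that prime_factor_nat[of n] by (metis gr0I le_zero_eq not_prime_0)
  then show ?thesis by (auto simp: smooth_numbers_def)
qed

lemma smooth_numbers_Suc_nonprime:
  "\<not> prime (Suc N) \<Longrightarrow> smooth_numbers (Suc N) = smooth_numbers N"
  unfolding smooth_numbers_def by (auto simp: le_Suc_eq)

text \<open>Splitting off the full power of the largest admissible prime is the induction step of
  the Euler product; the exponent is recovered as a multiplicity.\<close>

lemma smooth_numbers_Suc_prime:
  assumes p: "prime (Suc N)"
  shows "bij_betw (\<lambda>(n, k). n * Suc N ^ k) (smooth_numbers N \<times> UNIV) (smooth_numbers (Suc N))"
  unfolding bij_betw_def
proof
  have cop: "\<not> Suc N dvd n" if "n \<in> smooth_numbers N" for n
    using that p by (auto simp: smooth_numbers_def)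
  show "inj_on (\<lambda>(n, k). n * Suc N ^ k) (smooth_numbers N \<times> UNIV)"
  proof (rule inj_onI, clarify)
    fix n k m l assume nm: "n \<in> smooth_numbers N" "m \<in> smooth_numbers N" and eq: "n * Suc N ^ k = m * Suc N ^ l"
    have mul: "multiplicity (Suc N) (n * Suc N ^ k) = k" if "n \<in> smooth_numbers N" for n k
    proof (rule multiplicity_eqI)
      have "\<not> Suc N ^ k * Suc N dvd Suc N ^ k * n"
        using cop[OF that] by (subst nat_mult_dvd_cancel1) auto
      then show "\<not> Suc N ^ Suc k dvd n * Suc N ^ k" by (simp only: power_Suc2 mult.commute not_False_eq_True)
    qed auto
    have "k = l" using mul[OF nm(1), of k] mul[OF nm(2), of l] eq by simp
    then show "n = m \<and> k = l" using eq by simp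
  qed
  show "(\<lambda>(n, k). n * Suc N ^ k) ` (smooth_numbers N \<times> UNIV) = smooth_numbers (Suc N)"
  proof (intro equalityI subsetI)
    fix x assume "x \<in> (\<lambda>(n, k). n * Suc N ^ k) ` (smooth_numbers N \<times> UNIV)"
    then obtain n k where x: "x = n * Suc N ^ k" "n \<in> smooth_numbers N" by auto
    have "q \<le> Suc N" if "prime q" "q dvd x" for q
    proof -
      have "q dvd n \<or> q dvd Suc N ^ k" using that x prime_dvd_mult_iff by blast
      then show ?thesis
        using x(2) that p by (auto simp: smooth_numbers_def prime_dvd_power_iff dest: prime_dvd_power dvd_imp_le)
    qed
    then show "x \<in> smooth_numbers (Suc N)" using x by (auto simp: smooth_numbers_def)
  next
    fix x assume x: "x \<in> smooth_numbers (Suc N)"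
    then have x0: "x \<noteq> 0" by (simp add: smooth_numbers_def)
    obtain n where n: "x = Suc N ^ multiplicity (Suc N) x * n" "\<not> Suc N dvd n"
      using multiplicity_decompose'[OF x0, of "Suc N"] p by (metis not_prime_unit)
    have "n \<in> smooth_numbers N"
      unfolding smooth_numbers_def
    proof (intro CollectI conjI allI impI)
      show "0 < n" using n x0 by (metis gr0I mult_0_right)
      fix q assume q: "prime q \<and> q dvd n"
      then have "q dvd x" using n(1) by (metis dvd_mult)
      then have "q \<le> Suc N" using x q by (auto simp: smooth_numbers_def)
      moreover have "q \<noteq> Suc N" using n q by auto
      ultimately show "q \<le> N" by simp
    qed
    then show "x \<in> (\<lambda>(n, k). n * Suc N ^ k) ` (smooth_numbers N \<times> UNIV)"
      using n(1) by (auto simp: image_iff intro!: bexI[of _ n] exI[of _ "multiplicity (Suc N) x"] simp: mult.commute)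
  qed
qed

lemma subset_smooth_numbers:
  assumes "F \<subseteq> {0<..}" "\<And>n. n \<in> F \<Longrightarrow> n \<le> N"
  shows "F \<subseteq> smooth_numbers N"
proof
  fix n assume n: "n \<in> F"
  then have "0 < n" "n \<le> N" using assms by auto
  then show "n \<in> smooth_numbers N"
    unfolding smooth_numbers_def using dvd_imp_le order_trans by blast
qed

lemma prod_primes_Suc:
  fixes L :: "nat \<Rightarrow> 'a::comm_monoid_mult"
  shows "(\<Prod>p\<in>{p. prime p \<and> p \<le> Suc N}. L p) = (if prime (Suc N) then L (Suc N) else 1) * (\<Prod>p\<in>{p. prime p \<and> p \<le> N}. L p)"
proof (cases "prime (Suc N)")
  case True
  then have "{p. prime p \<and> p \<le> Suc N} = insert (Suc N) {p. prime p \<and> p \<le> N}" by (auto simp: le_Suc_eq)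
  then show ?thesis using True by simp
next
  case False
  then have "{p. prime p \<and> p \<le> Suc N} = {p. prime p \<and> p \<le> N}" by (auto simp: le_Suc_eq)
  then show ?thesis using False by simp
qed

text \<open>Over smooth numbers the finite Euler product is exact, whether or not the full series
  converges. Absolute summability travels through the induction together with the value, since it
  justifies summing over the pairs \<open>(n, k)\<close> iteratedly.\<close>

lemma euler_product_smooth_numbers:
  fixes a :: "nat \<Rightarrow> 'a::{real_normed_field, banach}"
  assumes mult: "multiplicative a"
    and loc: "\<And>p. prime p \<Longrightarrow> summable (\<lambda>k. norm (a (p ^ k)))" "\<And>p. prime p \<Longrightarrow> (\<lambda>k. a (p ^ k)) sums L p"
  shows "(\<lambda>n. norm (a n)) summable_on smooth_numbers N \<and> (a has_sum (\<Prod>p\<in>{p. prime p \<and> p \<le> N}. L p)) (smooth_numbers N)"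
proof (induction N)
  case 0
  have "{p::nat. prime p \<and> p \<le> 0} = {}" by auto
  then have e: "(\<Prod>p\<in>{p. prime p \<and> p \<le> 0}. L p) = 1" by (simp only: prod.empty)
  have "a 1 = 1" using mult by (simp add: multiplicative_def)
  then show ?case unfolding smooth_numbers_0 e using has_sum_finite[of "{1}" a] by simp
next
  case (Suc N)
  show ?case
  proof (cases "prime (Suc N)")
    case False
    then show ?thesis using Suc by (simp add: smooth_numbers_Suc_nonprime prod_primes_Suc)
  next
    case True
    let ?S = "\<Prod>p\<in>{p. prime p \<and> p \<le> N}. L p"
    define f where "f = (\<lambda>(n, k). a n * a (Suc N ^ k))"
    have af: "a (n * Suc N ^ k) = f (n, k)" if "n \<in> smooth_numbers N" for n k
    proof -
      have "0 < n" "\<not> Suc N dvd n" using that True by (auto simp: smooth_numbers_def)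
      moreover from this have "coprime n (Suc N ^ k)"
        using True by (metis coprime_commute coprime_power_left_iff prime_imp_coprime)
      ultimately show ?thesis using mult by (auto simp: multiplicative_def f_def)
    qed
    have hs: "((\<lambda>k. a (Suc N ^ k)) has_sum L (Suc N)) UNIV"
      by (rule norm_summable_imp_has_sum[OF loc[OF True]])
    have as: "(\<lambda>k. norm (a (Suc N ^ k))) summable_on UNIV"
      using loc(1)[OF True] by (intro norm_summable_imp_summable_on) simp
    have fabs: "(\<lambda>z. norm (f z)) summable_on smooth_numbers N \<times> UNIV"
    proof (rule Infinite_Sum.abs_summable_on_Sigma_iff[THEN iffD2], intro conjI ballI)
      fix x
      show "(\<lambda>y. norm (f (x, y))) summable_on UNIV"
        using summable_on_cmult_right[OF as, of "norm (a x)"] by (simp add: f_def norm_mult)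
    next
      have "(\<lambda>x. norm (a x) * infsum (\<lambda>y. norm (a (Suc N ^ y))) UNIV) summable_on smooth_numbers N"
        using Suc by (intro summable_on_cmult_left) auto
      moreover have "infsum (\<lambda>y. norm (f (x, y))) UNIV = norm (a x) * infsum (\<lambda>y. norm (a (Suc N ^ y))) UNIV" for x
        by (simp add: f_def norm_mult infsum_cmult_right' )
      ultimately show "(\<lambda>x. norm (infsum (\<lambda>y. norm (f (x, y))) UNIV)) summable_on smooth_numbers N"
        by (simp add: abs_mult infsum_nonneg)
    qed
    have "(f has_sum (?S * L (Suc N))) (smooth_numbers N \<times> UNIV)"
    proof (rule has_sum_SigmaI)
      fix x show "((\<lambda>y. f (x, y)) has_sum a x * L (Suc N)) UNIV"
        using has_sum_cmult_right[OF hs, of "a x"] by (simp add: f_def)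
    next
      show "((\<lambda>x. a x * L (Suc N)) has_sum ?S * L (Suc N)) (smooth_numbers N)"
        using Suc by (intro has_sum_cmult_left) auto
      show "f summable_on smooth_numbers N \<times> UNIV" using fabs by (rule abs_summable_summable)
    qed
    moreover have b: "bij_betw (\<lambda>(n, k). n * Suc N ^ k) (smooth_numbers N \<times> UNIV) (smooth_numbers (Suc N))"
      by (rule smooth_numbers_Suc_prime[OF True])
    have eq: "a (case z of (n, k) \<Rightarrow> n * Suc N ^ k) = f z" if "z \<in> smooth_numbers N \<times> UNIV" for z
      using that af by (cases z) auto
    ultimately have "(a has_sum (?S * L (Suc N))) (smooth_numbers (Suc N))"
      by (subst has_sum_reindex_bij_betw[OF b, symmetric]) (simp cong: has_sum_cong add: eq)
    moreover have "(\<lambda>n. norm (a n)) summable_on smooth_numbers (Suc N)"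
      using fabs by (subst summable_on_reindex_bij_betw[OF b, symmetric]) (simp cong: summable_on_cong add: eq)
    ultimately show ?thesis using True by (simp add: prod_primes_Suc mult.commute)
  qed
qed

text \<open>A finite set of positive integers lies in \<open>smooth_numbers N\<close> as soon as
  \<open>N\<close> reaches its maximum, so the smooth sums inherit the convergence of the full sum.
  The tolerance is halved because the limit over finite subsets of \<open>smooth_numbers N\<close>
  preserves only the weak inequality.\<close>

lemma has_sum_smooth_numbers_tendsto:
  fixes a :: "nat \<Rightarrow> 'a::real_normed_vector"
  assumes T: "(a has_sum T) {0<..}" and S: "\<And>N. (a has_sum S N) (smooth_numbers N)"
  shows "S \<longlonglongrightarrow> T"
proof (rule LIMSEQ_I)
  fix e :: real assume e: "e > 0"
  have "\<forall>\<^sub>F F in finite_subsets_at_top {0<..}. dist (sum a F) T < e / 2"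
    using T[unfolded has_sum_def tendsto_iff, rule_format, of "e / 2"] e by simp
  then obtain F where F: "finite F" "F \<subseteq> {0<..}"
      "\<forall>F'. finite F' \<and> F \<subseteq> F' \<and> F' \<subseteq> {0<..} \<longrightarrow> dist (sum a F') T < e / 2"
    unfolding eventually_finite_subsets_at_top by (elim exE conjE) (rule that)
  \<comment> \<open>For empty \<open>F\<close> the maximum is unspecified, which is harmless:
    \<open>K\<close> is only compared with members of \<open>F\<close>.\<close>
  define K where "K = Max F"
  have K: "n \<le> K" if "n \<in> F" for n using Max_ge[OF F(1) that] by (simp only: K_def)
  show "\<exists>n0. \<forall>N\<ge>n0. norm (S N - T) < e"
  proof (intro exI allI impI)
    fix N assume N: "K \<le> N"
    have FN: "F \<subseteq> smooth_numbers N"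
      by (rule subset_smooth_numbers[OF F(2)], rule order_trans[OF K N])
    have "\<forall>\<^sub>F F' in finite_subsets_at_top (smooth_numbers N). norm (sum a F' - T) \<le> e / 2"
      unfolding eventually_finite_subsets_at_top
    proof (intro exI[of _ F] conjI allI impI)
      fix Y assume Y: "finite Y \<and> F \<subseteq> Y \<and> Y \<subseteq> smooth_numbers N"
      moreover have "smooth_numbers N \<subseteq> {0<..}" by (auto simp: smooth_numbers_def)
      ultimately have "finite Y \<and> F \<subseteq> Y \<and> Y \<subseteq> {0<..}" by (meson order_trans)
      then have "dist (sum a Y) T < e / 2" using F(3) by (elim allE impE) 
      then show "norm (sum a Y - T) \<le> e / 2" by (simp add: dist_norm)
    qed (use F FN in auto)
    moreover have "((\<lambda>F'. sum a F' - T) \<longlongrightarrow> S N - T) (finite_subsets_at_top (smooth_numbers N))"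
      using S[of N] unfolding has_sum_def by (intro tendsto_intros)
    ultimately have "norm (S N - T) \<le> e / 2"
      by (intro tendsto_upperbound[OF tendsto_norm]) auto
    then show "norm (S N - T) < e" using e by simp
  qed
qed

text \<open>Takes the place of a growth estimate for the divisor functions: for nonnegative terms
  every finite sum is dominated by a finite Euler product.\<close>

lemma summable_on_if_euler_products_bounded:
  fixes a :: "nat \<Rightarrow> real"
  assumes mult: "multiplicative a" and nonneg: "\<And>n. a n \<ge> 0"
    and loc: "\<And>p. prime p \<Longrightarrow> (\<lambda>k. a (p ^ k)) sums L p"
    and bd: "\<And>N. (\<Prod>p\<in>{p. prime p \<and> p \<le> N}. L p) \<le> B"
  shows "a summable_on {0<..}"
proof (rule nonneg_bdd_above_summable_on)
  have hs: "(a has_sum (\<Prod>p\<in>{p. prime p \<and> p \<le> N}. L p)) (smooth_numbers N)" for N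
    using euler_product_smooth_numbers[OF mult _ loc, of N] loc nonneg by (auto simp: sums_iff)
  show "bdd_above (sum a ` {F. F \<subseteq> {0<..} \<and> finite F})"
  proof (rule bdd_aboveI2)
    fix F :: "nat set" assume F: "F \<in> {F. F \<subseteq> {0<..} \<and> finite F}"
    then have F': "F \<subseteq> {0<..}" "finite F" by auto
    define K where "K = Max F"
    have K: "n \<le> K" if "n \<in> F" for n using Max_ge[OF F'(2) that] by (simp only: K_def)
    have FN: "F \<subseteq> smooth_numbers K"
      by (rule subset_smooth_numbers[OF F'(1) K])
    have "sum a F \<le> (\<Prod>p\<in>{p. prime p \<and> p \<le> K}. L p)"
      using F nonneg by (intro has_sum_mono2[OF has_sum_finite hs FN]) auto
    then show "sum a F \<le> B" using bd[of K] by linarith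
  qed
qed (rule nonneg)

section \<open>Zeta quotients as Dirichlet series\<close>

lemma norm_of_nat_powr:
  assumes "n > 0" shows "norm (complex_of_nat n powr z) = real n powr Re z"
  using norm_powr_of_real_pos[of "real n" z] assms by simp

lemma multiplicative_powr:
  assumes "multiplicative c"
  shows "multiplicative (\<lambda>n. complex_of_real (c n) * of_nat n powr z)"
  using assms by (auto simp: multiplicative_def powr_times_real)

lemma multiplicative_powr_real:
  assumes "multiplicative c"
  shows "multiplicative (\<lambda>n. c n * real n powr z)"
  using assms by (auto simp: multiplicative_def powr_mult)

lemma of_nat_power_powr: "p > 0 \<Longrightarrow> complex_of_nat (p ^ k) powr z = (of_nat p powr z) ^ k"
  by (induction k) (auto simp: powr_times_real)

lemma prime_powr_less_1:
  assumes "prime p" "\<sigma> > 0" shows "real p powr (-\<sigma>) < 1"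
proof -
  have "real p powr (-\<sigma>) < real p powr 0"
    using prime_gt_1_nat[OF assms(1)] assms(2) by (intro powr_less_mono) auto
  then show ?thesis using prime_gt_0_nat[OF assms(1)] by simp
qed

lemma has_sum_Suc_iff: "((\<lambda>n. a (Suc n)) has_sum T) UNIV \<longleftrightarrow> (a has_sum T) {0<..}"
  by (rule has_sum_reindex_bij_witness[of _ "\<lambda>n. n - 1" Suc]) auto

lemma summable_inverse_powr: "\<sigma> > 1 \<Longrightarrow> summable (\<lambda>n. real (Suc n) powr (-\<sigma>))"
  by (subst summable_Suc_iff) (simp add: summable_real_powr_iff)

lemma has_sum_riemann_zeta:
  assumes "Re s > 1"
  shows "((\<lambda>n. of_nat n powr (-s)) has_sum riemann_zeta s) {0<..}"
    and "summable (\<lambda>n. norm (complex_of_nat (Suc n) powr (-s)))"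
proof -
  have "summable (\<lambda>n. real (Suc n) powr (- Re s))" using assms by (rule summable_inverse_powr)
  then show s: "summable (\<lambda>n. norm (complex_of_nat (Suc n) powr (-s)))"
    by (simp only: norm_of_nat_powr[OF zero_less_Suc] uminus_complex.sel)
  have "(\<lambda>n. complex_of_nat (Suc n) powr (-s)) sums riemann_zeta s"
    using riemann_zeta_sums[OF assms] by (simp only: powr_minus_divide)
  from norm_summable_imp_has_sum[OF s this]
  show "((\<lambda>n. of_nat n powr (-s)) has_sum riemann_zeta s) {0<..}"
    by (subst has_sum_Suc_iff[symmetric])
qed

definition zeta_partial :: "nat \<Rightarrow> complex \<Rightarrow> complex" where
  "zeta_partial N s = (\<Prod>p\<in>{p. prime p \<and> p \<le> N}. 1 / (1 - of_nat p powr (-s)))"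

lemma zeta_partial_tendsto:
  assumes "Re s > 1" shows "(\<lambda>N. zeta_partial N s) \<longlonglongrightarrow> riemann_zeta s"
proof (rule has_sum_smooth_numbers_tendsto[OF has_sum_riemann_zeta(1)[OF assms]])
  fix N
  have m: "multiplicative (\<lambda>n. complex_of_nat n powr (-s))"
    using multiplicative_powr[of "\<lambda>_. 1" "-s"] by (simp add: multiplicative_def)
  have x: "norm (of_nat p powr (-s) :: complex) < 1" if "prime p" for p
    using prime_powr_less_1[OF that, of "Re s"] assms prime_gt_0_nat[OF that] by (simp add: norm_of_nat_powr)
  show "((\<lambda>n. of_nat n powr (-s)) has_sum zeta_partial N s) (smooth_numbers N)"
    unfolding zeta_partial_def
  proof (rule euler_product_smooth_numbers[OF m, THEN conjunct2])
    fix p :: nat assume p: "prime p"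
    note e = of_nat_power_powr[OF prime_gt_0_nat[OF p]]
    show "summable (\<lambda>k. norm (complex_of_nat (p ^ k) powr (-s)))"
      unfolding e norm_power using x[OF p] by (intro summable_geometric) auto
    show "(\<lambda>k. complex_of_nat (p ^ k) powr (-s)) sums (1 / (1 - of_nat p powr (-s)))"
      unfolding e using x[OF p] by (rule geometric_sums)
  qed
qed

text \<open>Each reciprocal Euler factor has norm at most 1 + x <= exp x with x = p^(-\<sigma>), so
  the reciprocal of a partial product is at most the exponential of a sum over primes, hence of the
  sum \<open>T\<close> over all integers. Uniformity in \<open>Im s\<close> allows the division by
  zeta at \<open>2 * s\<close> on a whole half-plane.\<close>

lemma riemann_zeta_lower_bound:
  assumes "\<sigma> > 1"
  obtains c where "c > 0" "\<And>s. \<sigma> \<le> Re s \<Longrightarrow> c \<le> norm (riemann_zeta s)"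
proof
  define T where "T = (\<Sum>n. real (Suc n) powr (-\<sigma>))"
  show "exp (-T) > 0" by simp
  fix s assume s: "\<sigma> \<le> Re s"
  then have s1: "Re s > 1" using assms by simp
  have "exp (-T) \<le> norm (zeta_partial N s)" for N
  proof -
    have x: "norm (1 - of_nat p powr (-s) :: complex) \<le> exp (real p powr (-\<sigma>))" "1 - of_nat p powr (-s) \<noteq> (0 :: complex)" if "prime p" for p
    proof -
      have p: "p > 1" using prime_gt_1_nat[OF that] .
      have n: "norm (of_nat p powr (-s) :: complex) = real p powr (- Re s)" using p by (simp add: norm_of_nat_powr)
      have "norm (1 - of_nat p powr (-s) :: complex) \<le> 1 + real p powr (- Re s)"
        using norm_triangle_ineq4[of 1 "of_nat p powr (-s) :: complex"] n by simp
      also have "\<dots> \<le> 1 + real p powr (-\<sigma>)" using p s by (intro add_left_mono powr_mono) auto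
      also have "\<dots> \<le> exp (real p powr (-\<sigma>))" by (rule exp_ge_add_one_self)
      finally show "norm (1 - of_nat p powr (-s) :: complex) \<le> exp (real p powr (-\<sigma>))" .
      have "norm (of_nat p powr (-s) :: complex) < 1" using n prime_powr_less_1[OF that, of "Re s"] s1 by simp
      then show "1 - of_nat p powr (-s) \<noteq> (0 :: complex)" by auto
    qed
    have "norm (\<Prod>p\<in>{p. prime p \<and> p \<le> N}. 1 - of_nat p powr (-s) :: complex) \<le> (\<Prod>p\<in>{p. prime p \<and> p \<le> N}. exp (real p powr (-\<sigma>)))"
      unfolding prod_norm[symmetric] by (intro prod_mono) (use x in auto)
    also have "\<dots> = exp (\<Sum>p\<in>{p. prime p \<and> p \<le> N}. real p powr (-\<sigma>))" by (rule exp_sum[symmetric]) simp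
    also have "\<dots> \<le> exp T"
    proof -
      have "(\<Sum>p\<in>{p. prime p \<and> p \<le> N}. real p powr (-\<sigma>)) \<le> (\<Sum>p\<in>Suc ` {..<N}. real p powr (-\<sigma>))"
      proof (rule sum_mono2)
        show "{p. prime p \<and> p \<le> N} \<subseteq> Suc ` {..<N}"
        proof
          fix p assume "p \<in> {p. prime p \<and> p \<le> N}"
          then have "p = Suc (p - 1)" "p - 1 < N" using prime_gt_0_nat[of p] by auto
          then show "p \<in> Suc ` {..<N}" by blast
        qed
      qed auto
      also have "\<dots> = (\<Sum>n<N. real (Suc n) powr (-\<sigma>))" by (subst sum.reindex) auto
      also have "\<dots> \<le> T" unfolding T_def by (rule sum_le_suminf[OF summable_inverse_powr[OF assms]]) auto
      finally show ?thesis by simp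
    qed
    finally have le: "norm (\<Prod>p\<in>{p. prime p \<and> p \<le> N}. 1 - of_nat p powr (-s) :: complex) \<le> exp T" .
    have nz: "(\<Prod>p\<in>{p. prime p \<and> p \<le> N}. 1 - of_nat p powr (-s) :: complex) \<noteq> 0"
      using x(2) by auto
    have "norm (zeta_partial N s) = inverse (norm (\<Prod>p\<in>{p. prime p \<and> p \<le> N}. 1 - of_nat p powr (-s) :: complex))"
      by (simp add: zeta_partial_def prod_dividef norm_divide inverse_eq_divide)
    also have "\<dots> \<ge> inverse (exp T)" using le nz by (intro le_imp_inverse_le) auto
    finally show ?thesis by (simp add: exp_minus)
  qed
  moreover have "(\<lambda>N. norm (zeta_partial N s)) \<longlonglongrightarrow> norm (riemann_zeta s)"
    by (intro tendsto_norm zeta_partial_tendsto s1)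
  ultimately show "exp (-T) \<le> norm (riemann_zeta s)"
    by (intro LIMSEQ_le_const) auto
qed

lemma riemann_zeta_nonzero: "Re s > 1 \<Longrightarrow> riemann_zeta s \<noteq> 0"
  using riemann_zeta_lower_bound[of "Re s"] by (metis norm_zero not_le order_refl)


text \<open>With x = p^(-s), \<open>loc\<close> is the local Euler factor: 1 / (1 - x)^j belongs to
  the power of zeta at s, and 1 - x^2 to the reciprocal of zeta at 2s. The comparison is exact for
  the products over primes up to \<open>N\<close>, and both sides have limits.\<close>

lemma zeta_quotient_dirichlet_series:
  fixes c :: "nat \<Rightarrow> real"
  assumes mult: "multiplicative c" and nonneg: "\<And>n. c n \<ge> 0"
    and loc: "\<And>p x. prime p \<Longrightarrow> norm (x::complex) < 1 \<Longrightarrow> (\<lambda>k. of_real (c (p ^ k)) * x ^ k) sums ((1 - x\<^sup>2) / (1 - x) ^ j)"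
    and s: "Re s > 1"
  shows "summable (\<lambda>n. c (Suc n) * real (Suc n) powr (- Re s))" (is ?th1)
    and "(\<lambda>n. of_real (c (Suc n)) * of_nat (Suc n) powr (-s)) sums (riemann_zeta s ^ j / riemann_zeta (2 * s))" (is ?th2)
proof -
  define a where "a = (\<lambda>n. complex_of_real (c n) * of_nat n powr (-s))"
  define L where "L = (\<lambda>z p. (1 - (of_nat p powr (-z))\<^sup>2) / (1 - of_nat p powr (-z) :: complex) ^ j)"
  have x: "norm (of_nat p powr (-z) :: complex) < 1" if "prime p" "Re z > 1" for p z
    using prime_powr_less_1[OF that(1), of "Re z"] that prime_gt_0_nat[OF that(1)] by (simp add: norm_of_nat_powr)
  have locz: "(\<lambda>k. complex_of_real (c (p ^ k)) * of_nat (p ^ k) powr (-z)) sums L z p" if "prime p" "Re z > 1" for p z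
    unfolding L_def of_nat_power_powr[OF prime_gt_0_nat[OF that(1)]] by (rule loc[OF that(1) x[OF that]])
  have L_zeta: "(\<Prod>p\<in>{p. prime p \<and> p \<le> N}. L z p) = zeta_partial N z ^ j / zeta_partial N (2 * z)" if "Re z > 1" for N z
  proof -
    have "zeta_partial N z ^ j / zeta_partial N (2 * z) =
        (\<Prod>p\<in>{p. prime p \<and> p \<le> N}. (1 / (1 - of_nat p powr (-z))) ^ j / (1 / (1 - of_nat p powr (- (2 * z)))))"
      by (simp only: zeta_partial_def prod_power_distrib prod_dividef[symmetric])
    also have "\<dots> = (\<Prod>p\<in>{p. prime p \<and> p \<le> N}. L z p)"
    proof (rule prod.cong[OF refl])
      fix p assume p: "p \<in> {p. prime p \<and> p \<le> N}"
      then have "(of_nat p :: complex) \<noteq> 0" using prime_gt_0_nat[of p] by auto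
      then have "of_nat p powr (- (2 * z)) = (of_nat p powr (-z) :: complex)\<^sup>2"
        by (simp add: powr_def exp_double[symmetric] mult.assoc)
      then show "(1 / (1 - of_nat p powr (-z))) ^ j / (1 / (1 - of_nat p powr (- (2 * z)))) = L z p"
        by (simp add: L_def power_divide)
    qed
    finally show ?thesis ..
  qed
  define \<sigma> where "\<sigma> = Re s"
  define r where "r = (\<lambda>n. c n * real n powr (-\<sigma>))"
  have multr: "multiplicative r" unfolding r_def by (rule multiplicative_powr_real[OF mult])
  have r0: "r n \<ge> 0" for n using nonneg by (simp add: r_def)
  have \<sigma>: "Re (of_real \<sigma>) > 1" using s by (simp add: \<sigma>_def)
  have r_complex: "complex_of_real (r n) = of_real (c n) * of_nat n powr (- of_real \<sigma>)" for n
    by (simp add: r_def powr_of_real[symmetric])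
  have rL: "(\<lambda>k. r (p ^ k)) sums Re (L (of_real \<sigma>) p)" if "prime p" for p
    using sums_Re[OF locz[OF that \<sigma>, folded r_complex]] by simp
  have rLc: "complex_of_real (Re (L (of_real \<sigma>) p)) = L (of_real \<sigma>) p" if "prime p" for p
    using sums_unique2[OF locz[OF that \<sigma>, folded r_complex] sums_of_real[OF rL[OF that]]] by simp
  \<comment> \<open>At the real point \<open>\<sigma>\<close> the Euler products converge to the
    zeta quotient and so are bounded; as the coefficients are nonnegative, this settles absolute
    convergence on the whole line \<open>Re s = \<sigma>\<close>.\<close>
  have "r summable_on {0<..}"
  proof -
    have "(\<lambda>N. zeta_partial N (of_real \<sigma>) ^ j / zeta_partial N (2 * of_real \<sigma>)) \<longlonglongrightarrow> riemann_zeta (of_real \<sigma>) ^ j / riemann_zeta (2 * of_real \<sigma>)"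
      using \<sigma> by (intro tendsto_divide tendsto_power zeta_partial_tendsto riemann_zeta_nonzero) auto
    then have "Bseq (\<lambda>N. zeta_partial N (of_real \<sigma>) ^ j / zeta_partial N (2 * of_real \<sigma>))"
      by (intro convergent_imp_Bseq convergentI)
    then obtain B where B: "\<And>N. norm (zeta_partial N (of_real \<sigma>) ^ j / zeta_partial N (2 * of_real \<sigma>)) \<le> B"
      by (elim BseqE) blast
    show ?thesis
    proof (rule summable_on_if_euler_products_bounded[OF multr r0 rL])
      fix N
      have "complex_of_real (\<Prod>p\<in>{p. prime p \<and> p \<le> N}. Re (L (of_real \<sigma>) p)) = zeta_partial N (of_real \<sigma>) ^ j / zeta_partial N (2 * of_real \<sigma>)"
        unfolding L_zeta[OF \<sigma>, symmetric] of_real_prod by (intro prod.cong) (auto simp: rLc)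
      then have "norm (complex_of_real (\<Prod>p\<in>{p. prime p \<and> p \<le> N}. Re (L (of_real \<sigma>) p))) \<le> B" using B by simp
      then show "(\<Prod>p\<in>{p. prime p \<and> p \<le> N}. Re (L (of_real \<sigma>) p)) \<le> B" by (simp only: norm_of_real)
    qed
  qed
  then have rs: "(\<lambda>n. r (Suc n)) summable_on UNIV" unfolding summable_on_def has_sum_Suc_iff .
  then show th1: ?th1 unfolding r_def \<sigma>_def by (rule summable_on_imp_summable)
  have na: "norm (a n) = r n" for n
  proof (cases "n = 0")
    case False
    then show ?thesis using nonneg by (simp add: a_def r_def \<sigma>_def norm_mult norm_of_nat_powr)
  qed (simp add: a_def r_def)
  have as: "summable (\<lambda>n. norm (a (Suc n)))" using rs unfolding na by (rule summable_on_imp_summable)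
  then have sums: "(\<lambda>n. a (Suc n)) sums (\<Sum>n. a (Suc n))" by (rule summable_sums[OF summable_norm_cancel])
  have hs: "(a has_sum (\<Sum>n. a (Suc n))) {0<..}"
    using norm_summable_imp_has_sum[OF as sums] by (simp only: has_sum_Suc_iff)
  have multa: "multiplicative a" unfolding a_def by (rule multiplicative_powr[OF mult])
  have "(\<lambda>N. zeta_partial N s ^ j / zeta_partial N (2 * s)) \<longlonglongrightarrow> (\<Sum>n. a (Suc n))"
  proof (rule has_sum_smooth_numbers_tendsto[OF hs])
    fix N
    show "(a has_sum zeta_partial N s ^ j / zeta_partial N (2 * s)) (smooth_numbers N)"
      unfolding L_zeta[OF s, symmetric]
    proof (rule euler_product_smooth_numbers[OF multa, THEN conjunct2])
      fix p :: nat assume p: "prime p"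
      show "summable (\<lambda>k. norm (a (p ^ k)))" unfolding na using rL[OF p] by (rule sums_summable)
      show "(\<lambda>k. a (p ^ k)) sums L s p" unfolding a_def by (rule locz[OF p s])
    qed
  qed
  moreover have "(\<lambda>N. zeta_partial N s ^ j / zeta_partial N (2 * s)) \<longlonglongrightarrow> riemann_zeta s ^ j / riemann_zeta (2 * s)"
    using s by (intro tendsto_divide tendsto_power zeta_partial_tendsto riemann_zeta_nonzero) auto
  ultimately have "(\<Sum>n. a (Suc n)) = riemann_zeta s ^ j / riemann_zeta (2 * s)" by (rule LIMSEQ_unique)
  then show ?th2 using sums by (simp only: a_def)
qed

section \<open>Divisor functions and their local factors\<close>

lemma divisor_count_mult_coprime:
  assumes "0 < m" "0 < n" "coprime m n"
  shows "divisor_count (m * n) = divisor_count m * divisor_count n"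
proof -
  have "bij_betw (\<lambda>(x, y). x * y) ({d. d dvd m} \<times> {d. d dvd n}) {d. d dvd m * n}"
    unfolding bij_betw_def
  proof
    show "inj_on (\<lambda>(x, y). x * y) ({d. d dvd m} \<times> {d. d dvd n})"
    proof (rule inj_onI, clarify)
      fix a b c d assume h: "a dvd m" "b dvd n" "c dvd m" "d dvd n" "a * b = c * d"
      have "coprime a d" "coprime c b"
        using h assms(3) by (meson coprime_divisors)+
      then have "a dvd c" "c dvd a"
        using h(5) by (metis coprime_dvd_mult_left_iff dvd_triv_left)+
      then have "a = c" by (rule dvd_antisym)
      moreover have "a > 0" using h(1) assms(1) by (metis dvd_pos_nat)
      ultimately show "a = c \<and> b = d" using h(5) by simp
    qed
    show "(\<lambda>(x, y). x * y) ` ({d. d dvd m} \<times> {d. d dvd n}) = {d. d dvd m * n}"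
    proof (intro equalityI subsetI)
      fix x assume "x \<in> {d. d dvd m * n}"
      then obtain a b where "x = a * b" "a dvd m" "b dvd n" by (metis division_decomp mem_Collect_eq)
      then show "x \<in> (\<lambda>(x, y). x * y) ` ({d. d dvd m} \<times> {d. d dvd n})" by (auto simp: image_iff)
    qed (auto intro: mult_dvd_mono)
  qed
  then have "card ({d. d dvd m} \<times> {d. d dvd n}) = card {d. d dvd m * n}" by (rule bij_betw_same_card)
  then show ?thesis by (simp add: divisor_count_def card_cartesian_product)
qed

lemma divisor_count_prime_power:
  assumes "prime p" shows "divisor_count (p ^ k) = Suc k"
proof -
  have "{d. d dvd p ^ k} = (\<lambda>i. p ^ i) ` {..k}"
    using divides_primepow_nat[OF assms] by auto
  moreover have "inj_on (\<lambda>i. p ^ i) {..k}"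
    using prime_gt_1_nat[OF assms] by (intro inj_onI) (simp add: power_inject_exp)
  ultimately show ?thesis by (simp add: divisor_count_def card_image)
qed

text \<open>Cauchy product of the geometric series with its derivative; the inner sums 1 + ... + (k
  + 1) are triangular numbers.\<close>

lemma sums_triangular_numbers:
  fixes x :: complex assumes "norm x < 1"
  shows "(\<lambda>k. of_nat (Suc k * Suc (Suc k)) * x ^ k) sums (2 / (1 - x) ^ 3)"
proof -
  have g: "(\<lambda>k. x ^ k) sums (1 / (1 - x))" by (rule geometric_sums[OF assms])
  have d: "(\<lambda>k. of_nat (Suc k) * x ^ k) sums (1 / (1 - x)\<^sup>2)" by (rule geometric_deriv_sums[OF assms])
  have gn: "summable (\<lambda>k. norm (x ^ k))" using assms by (simp add: norm_power summable_geometric)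
  have dn: "summable (\<lambda>k. norm (of_nat (Suc k) * x ^ k))"
    using sums_summable[OF geometric_deriv_sums[of "norm x"]] assms by (simp add: norm_mult norm_power del: of_nat_Suc)
  have "(\<lambda>k. \<Sum>i\<le>k. (of_nat (Suc i) * x ^ i) * x ^ (k - i)) sums ((1 / (1 - x)\<^sup>2) * (1 / (1 - x)))"
    using Cauchy_product_sums[OF dn gn] unfolding sums_unique[OF d, symmetric] sums_unique[OF g, symmetric] .
  from sums_mult[OF this, of 2]
  have "(\<lambda>k. 2 * (\<Sum>i\<le>k. (of_nat (Suc i) * x ^ i) * x ^ (k - i))) sums (2 / (1 - x) ^ 3)"
    by (simp add: power2_eq_square power3_eq_cube)
  also have "(\<lambda>k. 2 * (\<Sum>i\<le>k. (of_nat (Suc i) * x ^ i) * x ^ (k - i))) = (\<lambda>k. of_nat (Suc k * Suc (Suc k)) * x ^ k)"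
  proof
    fix k
    have "(\<Sum>i\<le>k. (of_nat (Suc i) * x ^ i) * x ^ (k - i)) = (\<Sum>i\<le>k. of_nat (Suc i) * x ^ k)"
      by (intro sum.cong) (auto simp: mult.assoc simp flip: power_add)
    also have "\<dots> = of_nat (\<Sum>i\<le>k. Suc i) * x ^ k" by (simp only: sum_distrib_right of_nat_sum)
    finally have "2 * (\<Sum>i\<le>k. (of_nat (Suc i) * x ^ i) * x ^ (k - i)) = of_nat (2 * (\<Sum>i\<le>k. Suc i)) * x ^ k"
      by (simp only: of_nat_mult of_nat_numeral mult.assoc)
    also have "2 * (\<Sum>i\<le>k. Suc i) = Suc k * Suc (Suc k)" by (induction k) auto
    finally show "2 * (\<Sum>i\<le>k. (of_nat (Suc i) * x ^ i) * x ^ (k - i)) = of_nat (Suc k * Suc (Suc k)) * x ^ k" .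
  qed
  finally show ?thesis .
qed

lemma multiplicative_divisor_count_square: "multiplicative (\<lambda>n. real (divisor_count (n\<^sup>2)))"
  unfolding multiplicative_def
proof (intro conjI allI impI)
  show "real (divisor_count (1\<^sup>2)) = 1" using divisor_count_prime_power[of 2 0] by simp
  fix m n :: nat assume "0 < m" "0 < n" "coprime m n"
  then have "divisor_count (m\<^sup>2 * n\<^sup>2) = divisor_count (m\<^sup>2) * divisor_count (n\<^sup>2)"
    by (intro divisor_count_mult_coprime) auto
  then show "real (divisor_count ((m * n)\<^sup>2)) = real (divisor_count (m\<^sup>2)) * real (divisor_count (n\<^sup>2))"
    by (simp only: power_mult_distrib of_nat_mult)
qed

lemma multiplicative_square_divisor_count: "multiplicative (\<lambda>n. real ((divisor_count n)\<^sup>2))"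
  unfolding multiplicative_def
proof (intro conjI allI impI)
  show "real ((divisor_count 1)\<^sup>2) = 1" using divisor_count_prime_power[of 2 0] by simp
  fix m n :: nat assume "0 < m" "0 < n" "coprime m n"
  then have "divisor_count (m * n) = divisor_count m * divisor_count n"
    by (rule divisor_count_mult_coprime)
  then show "real ((divisor_count (m * n))\<^sup>2) = real ((divisor_count m)\<^sup>2) * real ((divisor_count n)\<^sup>2)"
    by (simp only: power_mult_distrib of_nat_mult)
qed

text \<open>The coefficient is 2k + 1 = 2 (k + 1) - 1, and with y = 1 - x the numerator 2y - y^2
  equals 1 - x^2.\<close>

lemma divisor_count_square_local_sums:
  fixes x :: complex assumes "prime p" "norm x < 1"
  shows "(\<lambda>k. of_real (real (divisor_count ((p ^ k)\<^sup>2))) * x ^ k) sums ((1 - x\<^sup>2) / (1 - x) ^ 3)"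
proof -
  have nz: "1 - x \<noteq> 0" using assms by auto
  have "(\<lambda>k. 2 * (of_nat (Suc k) * x ^ k) - x ^ k) sums (2 * (1 / (1 - x)\<^sup>2) - 1 / (1 - x))"
    by (intro sums_diff sums_mult geometric_deriv_sums geometric_sums assms)
  also have "2 * (1 / (1 - x)\<^sup>2) - 1 / (1 - x) = (1 - x\<^sup>2) / (1 - x) ^ 3"
  proof -
    have "2 * (1 / y\<^sup>2) - 1 / y = (2 * y - y\<^sup>2) / y ^ 3" if "y \<noteq> 0" for y :: complex
      using that by (simp add: diff_divide_distrib power2_eq_square power3_eq_cube)
    moreover have "1 - x\<^sup>2 = 2 * (1 - x) - (1 - x)\<^sup>2" by (simp add: power2_eq_square algebra_simps)
    ultimately show ?thesis using nz by (simp only:)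
  qed
  also have "(\<lambda>k. 2 * (of_nat (Suc k) * x ^ k) - x ^ k) = (\<lambda>k. of_real (real (divisor_count ((p ^ k)\<^sup>2))) * x ^ k)"
    using divisor_count_prime_power[OF assms(1)] by (auto simp: fun_eq_iff power_mult[symmetric] algebra_simps)
  finally show ?thesis .
qed

text \<open>Here (k + 1)^2 = (k + 1)(k + 2) - (k + 1), which calls for the series of triangular
  numbers.\<close>

lemma square_divisor_count_local_sums:
  fixes x :: complex assumes "prime p" "norm x < 1"
  shows "(\<lambda>k. of_real (real ((divisor_count (p ^ k))\<^sup>2)) * x ^ k) sums ((1 - x\<^sup>2) / (1 - x) ^ 4)"
proof -
  have nz: "1 - x \<noteq> 0" using assms by auto
  have "(\<lambda>k. of_nat (Suc k * Suc (Suc k)) * x ^ k - of_nat (Suc k) * x ^ k) sums (2 / (1 - x) ^ 3 - 1 / (1 - x)\<^sup>2)"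
    by (intro sums_diff geometric_deriv_sums sums_triangular_numbers assms)
  also have "2 / (1 - x) ^ 3 - 1 / (1 - x)\<^sup>2 = (1 - x\<^sup>2) / (1 - x) ^ 4"
  proof -
    have "2 / y ^ 3 - 1 / y\<^sup>2 = (2 * y - y\<^sup>2) / y ^ 4" if "y \<noteq> 0" for y :: complex
      using that by (simp add: diff_divide_distrib power2_eq_square power3_eq_cube power4_eq_xxxx)
    moreover have "1 - x\<^sup>2 = 2 * (1 - x) - (1 - x)\<^sup>2" by (simp add: power2_eq_square algebra_simps)
    ultimately show ?thesis using nz by (simp only:)
  qed
  also have "(\<lambda>k. of_nat (Suc k * Suc (Suc k)) * x ^ k - of_nat (Suc k) * x ^ k) = (\<lambda>k. of_real (real ((divisor_count (p ^ k))\<^sup>2)) * x ^ k)"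
    using divisor_count_prime_power[OF assms(1)] by (auto simp: fun_eq_iff power2_eq_square algebra_simps)
  finally show ?thesis .
qed

section \<open>Mellin transforms of smooth functions with decay\<close>

lemma of_real_powr_has_vector_derivative:
  assumes "x > 0"
  shows "((\<lambda>x. complex_of_real x powr z) has_vector_derivative z * of_real x powr (z - 1)) (at x)"
proof -
  have "((\<lambda>w. w powr z) has_field_derivative z * of_real x powr (z - 1)) (at (of_real x))"
    using assms by (intro has_field_derivative_powr) auto
  then show ?thesis by (rule has_vector_derivative_real_field)
qed

lemma continuous_on_of_real_powr: "continuous_on {0<..} (\<lambda>x. complex_of_real x powr z)"
  by (intro continuous_intros) auto

lemma set_integrable_powr_from_0:
  assumes "a > -1" shows "set_integrable lborel {0<..1::real} (\<lambda>x. x powr a)"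
proof -
  have "((\<lambda>x. x powr a) has_integral (1 powr (a+1) / (a+1))) {0..1}"
    by (rule has_integral_powr_from_0) (use assms in auto)
  then have "(\<lambda>t. t powr a) absolutely_integrable_on {0..1}"
    by (intro nonnegative_absolutely_integrable_1) (auto simp: integrable_on_def)
  then have "set_integrable lborel {0..1} (\<lambda>t. t powr a)"
    unfolding set_integrable_def by (subst (asm) integrable_completion) auto
  then show ?thesis by (rule set_integrable_subset) auto
qed

lemma set_integrable_powr_greaterThan_1:
  assumes "a < -1" shows "set_integrable lborel {1::real<..} (\<lambda>x. x powr a)"
proof -
  have "set_integrable lborel {1..} (\<lambda>t. t powr (-(-a)))"
    by (rule set_integrable_powr_atLeast) (use assms in auto)
  then show ?thesis by (intro set_integrable_subset[where A = "{1..}" and B = "{1<..}"]) auto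
qed

text \<open>The exponent \<open>\<rho> = 0\<close> controls the integrand on (0, 1] and
  \<open>\<rho> = A\<close> controls it beyond 1; the conditions on \<open>\<sigma>\<close> make the
  two resulting powers integrable there.\<close>

lemma set_integrable_mult_powr:
  fixes h :: "real \<Rightarrow> complex"
  assumes cont: "continuous_on {0<..} h"
    and bd: "\<And>x \<rho>. 0 < x \<Longrightarrow> 0 \<le> \<rho> \<Longrightarrow> \<rho> \<le> A \<Longrightarrow> norm (h x) \<le> C * x powr (-\<rho>)"
    and \<sigma>: "0 < \<sigma>" "\<sigma> < A"
  shows "set_integrable lborel {0<..} (\<lambda>x. h x * of_real (x powr (\<sigma> - 1)))"
proof -
  have C: "C \<ge> 0" using bd[of 1 0] \<sigma> norm_ge_zero[of "h 1"] by (simp del: norm_ge_zero)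
  have c2: "continuous_on {0<..} (\<lambda>x. h x * of_real (x powr (\<sigma> - 1)))"
    by (intro continuous_intros cont) auto
  have meas: "set_borel_measurable lborel S (\<lambda>x. h x * of_real (x powr (\<sigma> - 1)))" if "S \<subseteq> {0<..}" "S \<in> sets borel" for S
    unfolding set_borel_measurable_def
    using borel_measurable_continuous_on_indicator[OF that(2) continuous_on_subset[OF c2 that(1)]] by simp
  have i1: "set_integrable lborel {0<..1} (\<lambda>x. h x * of_real (x powr (\<sigma> - 1)))"
  proof (rule set_integrable_bound)
    show "set_integrable lborel {0<..1} (\<lambda>x. C * x powr (\<sigma> - 1))"
      using \<sigma> by (intro set_integrable_mult_right set_integrable_powr_from_0) auto
    have "norm (h x * of_real (x powr (\<sigma> - 1))) \<le> norm (C * x powr (\<sigma> - 1))" if "x \<in> {0<..1}" for x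
    proof -
      have "norm (h x) \<le> C" using bd[of x 0] that \<sigma> by simp
      then show ?thesis using C by (simp add: norm_mult mult_right_mono)
    qed
    then show "AE x in lborel. x \<in> {0<..1} \<longrightarrow> norm (h x * of_real (x powr (\<sigma> - 1))) \<le> norm (C * x powr (\<sigma> - 1))"
      by (intro AE_I2) blast
  qed (rule meas, auto)
  have i2: "set_integrable lborel {1<..} (\<lambda>x. h x * of_real (x powr (\<sigma> - 1)))"
  proof (rule set_integrable_bound)
    show "set_integrable lborel {1<..} (\<lambda>x. C * x powr (\<sigma> - A - 1))"
      using \<sigma> by (intro set_integrable_mult_right set_integrable_powr_greaterThan_1) auto
    have "norm (h x * of_real (x powr (\<sigma> - 1))) \<le> norm (C * x powr (\<sigma> - A - 1))" if "x \<in> {1<..}" for x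
    proof -
      have "norm (h x) * x powr (\<sigma> - 1) \<le> (C * x powr (-A)) * x powr (\<sigma> - 1)"
        using bd[of x A] that \<sigma> by (intro mult_right_mono) auto
      also have "\<dots> = C * x powr (\<sigma> - A - 1)" by (simp add: powr_add[symmetric] algebra_simps)
      finally show ?thesis using C by (simp add: norm_mult)
    qed
    then show "AE x in lborel. x \<in> {1<..} \<longrightarrow> norm (h x * of_real (x powr (\<sigma> - 1))) \<le> norm (C * x powr (\<sigma> - A - 1))"
      by (intro AE_I2) blast
  qed (rule meas, auto)
  have "{0<..} = {0<..1} \<union> {1::real<..}" by auto
  then show ?thesis using set_integrable_Un[OF i1 i2] by simp
qed

lemma set_integrable_mult_complex_powr:
  fixes h :: "real \<Rightarrow> complex"
  assumes cont: "continuous_on S h" and S: "S \<in> sets borel" "S \<subseteq> {0<..}"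
    and int: "set_integrable lborel S (\<lambda>x. h x * of_real (x powr Re z))"
  shows "set_integrable lborel S (\<lambda>x. h x * of_real x powr z)"
proof (rule set_integrable_bound[OF int])
  have "continuous_on S (\<lambda>x. h x * of_real x powr z)"
    by (intro continuous_on_mult cont continuous_on_subset[OF continuous_on_of_real_powr S(2)])
  then show "set_borel_measurable lborel S (\<lambda>x. h x * of_real x powr z)"
    unfolding set_borel_measurable_def using borel_measurable_continuous_on_indicator[OF S(1)] by simp
  show "AE x in lborel. x \<in> S \<longrightarrow> norm (h x * of_real x powr z) \<le> norm (h x * of_real (x powr Re z))"
    using S(2) by (intro AE_I2) (auto simp: norm_mult norm_powr_of_real_pos)
qed

section \<open>The Perron kernel with three linear factors\<close>

lemma norm_Complex_squared_ge: "1 \<le> \<bar>c\<bar> \<Longrightarrow> norm (Complex c t) ^ 2 \<ge> 1 + t\<^sup>2"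
  using abs_le_square_iff[of 1 c] by (simp add: cmod_power2)

lemma Im_cubed_le_norm:
  fixes s :: complex
  shows "\<bar>Im s\<bar> ^ 3 \<le> norm (s * (s + 1) * (s + 2))"
proof -
  have "\<bar>Im s\<bar> \<le> norm s" "\<bar>Im s\<bar> \<le> norm (s + 1)" "\<bar>Im s\<bar> \<le> norm (s + 2)"
    using abs_Im_le_cmod[of s] abs_Im_le_cmod[of "s + 1"] abs_Im_le_cmod[of "s + 2"] by simp_all
  then have "\<bar>Im s\<bar> * \<bar>Im s\<bar> * \<bar>Im s\<bar> \<le> norm s * norm (s + 1) * norm (s + 2)"
    by (intro mult_mono) auto
  then show ?thesis by (simp add: norm_mult power3_eq_cube)
qed

text \<open>The denominator is the polynomial that three integrations by parts put in front of the
  Mellin transform, and its degree makes all integrals over vertical lines absolutely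
  convergent.\<close>

definition perron_kernel :: "real \<Rightarrow> complex \<Rightarrow> complex" where
  "perron_kernel u s = of_real u powr s / (s * (s + 1) * (s + 2))"

lemma norm_perron_kernel_le:
  assumes "u > 0" "Im s \<noteq> 0"
  shows "norm (perron_kernel u s) \<le> u powr Re s / \<bar>Im s\<bar> ^ 3"
  unfolding perron_kernel_def norm_divide norm_powr_of_real_pos[OF assms(1)]
proof (rule divide_left_mono[OF Im_cubed_le_norm])
  have "0 < \<bar>Im s\<bar> ^ 3" using assms(2) by simp
  moreover from this have "0 < norm (s * (s + 1) * (s + 2))" using Im_cubed_le_norm by (rule less_le_trans)
  ultimately show "0 < norm (s * (s + 1) * (s + 2)) * \<bar>Im s\<bar> ^ 3" by (rule mult_pos_pos[rotated])
qed simp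

lemma holomorphic_perron_kernel:
  assumes "u > 0" shows "perron_kernel u holomorphic_on - {0, -1, -2}"
proof -
  have "s * (s + 1) * (s + 2) \<noteq> 0" if "s \<in> - {0, -1, -2}" for s :: complex
    using that by (auto simp: add_eq_0_iff2)
  then show ?thesis unfolding perron_kernel_def[abs_def] using assms
    by (intro holomorphic_intros) auto
qed

lemma perron_kernel_integrable:
  assumes "u > 0" "c \<notin> {0, -1, -2}"
  shows "integrable lborel (\<lambda>t. perron_kernel u (Complex c t))"
proof (rule integrable_line_powr_decay[where \<beta> = 3 and T = 1 and C = "u powr c"])
  have "continuous_on {s. Re s = c} (perron_kernel u)"
    using assms(2) by (intro holomorphic_on_imp_continuous_on holomorphic_on_subset[OF holomorphic_perron_kernel[OF assms(1)]]) auto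
  then show "continuous_on UNIV (\<lambda>t. perron_kernel u (Complex c t))"
    by (rule continuous_on_vertical_line)
  fix t :: real assume t: "1 \<le> \<bar>t\<bar>"
  then have "norm (perron_kernel u (Complex c t)) \<le> u powr c / \<bar>t\<bar> ^ 3"
    using norm_perron_kernel_le[OF assms(1), of "Complex c t"] by auto
  also have "\<dots> = u powr c * \<bar>t\<bar> powr (-3)" using t by (simp add: powr_minus powr_realpow[of _ 3, simplified] divide_inverse[symmetric] inverse_eq_divide)
  finally show "norm (perron_kernel u (Complex c t)) \<le> u powr c * \<bar>t\<bar> powr (-3)" .
qed simp

lemma perron_kernel_shift:
  assumes "u > 0" "a < b" "finite P" "P \<subseteq> {0, -1, -2}" "P \<subseteq> {s. a < Re s \<and> Re s < b}"
    and "\<And>p. p \<in> {0, -1, -2::complex} \<Longrightarrow> p \<notin> P \<Longrightarrow> Re p < a \<or> b < Re p"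
  shows "(LINT t|lborel. perron_kernel u (Complex b t)) - (LINT t|lborel. perron_kernel u (Complex a t)) = 2 * pi * (\<Sum>p\<in>P. residue (perron_kernel u) p)"
proof -
  have 1: "a \<notin> {0, -1, -2}" "b \<notin> {0, -1, -2}"
  proof -
    have *: "Re p \<noteq> a \<and> Re p \<noteq> b" if "p \<in> {0, -1, -2}" for p
    proof (cases "p \<in> P")
      case True
      then have "a < Re p" "Re p < b" using assms(5) by blast+
      then show ?thesis by simp
    next
      case False
      then show ?thesis using assms(6)[OF that False] assms(2) by linarith
    qed
    have "0 \<noteq> a \<and> 0 \<noteq> b" "-1 \<noteq> a \<and> -1 \<noteq> b" "-2 \<noteq> a \<and> -2 \<noteq> b"
      using *[of 0] *[of "-1"] *[of "-2"] by simp_all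
    then show "a \<notin> {0, -1, -2}" "b \<notin> {0, -1, -2}" by auto
  qed
  \<comment> \<open>Distances of the two lines from the three poles. Enlarging the strip by the
    minimum \<open>\<delta>\<close> cannot reach a pole outside \<open>P\<close>.\<close>
  define D where "D = {1, \<bar>a\<bar>, \<bar>a + 1\<bar>, \<bar>a + 2\<bar>, \<bar>b\<bar>, \<bar>b + 1\<bar>, \<bar>b + 2\<bar>}"
  define \<delta> where "\<delta> = Min D"
  have D: "finite D" "D \<noteq> {}" unfolding D_def by simp_all
  have "\<forall>x\<in>D. 0 < x" unfolding D_def using 1 by auto
  then have \<delta>: "\<delta> > 0" unfolding \<delta>_def Min_gr_iff[OF D] .
  have m: "\<delta> \<le> x" if "x \<in> D" for x unfolding \<delta>_def by (rule Min_le[OF D(1) that])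
  have \<delta>le: "\<delta> \<le> \<bar>a - Re p\<bar>" "\<delta> \<le> \<bar>b - Re p\<bar>" if "p \<in> {0,-1,-2}" for p :: complex
  proof -
    from that consider "p = 0" | "p = -1" | "p = -2" by blast
    then have "\<bar>a - Re p\<bar> \<in> D \<and> \<bar>b - Re p\<bar> \<in> D" by cases (simp_all add: D_def)
    then show "\<delta> \<le> \<bar>a - Re p\<bar>" "\<delta> \<le> \<bar>b - Re p\<bar>" using m by blast+
  qed
  show ?thesis
  proof (rule strip_residue_theorem[where l = "a - \<delta>" and r = "b + \<delta>" and B = "\<lambda>T. (u powr a + u powr b) / T ^ 3"])
    show "perron_kernel u holomorphic_on {s. a - \<delta> < Re s \<and> Re s < b + \<delta>} - P"
    proof (rule holomorphic_on_subset[OF holomorphic_perron_kernel[OF assms(1)]], rule subsetI, rule ComplI)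
      fix s assume s: "s \<in> {s. a - \<delta> < Re s \<and> Re s < b + \<delta>} - P" "s \<in> {0, -1, -2}"
      have "Re s < a \<or> b < Re s" using assms(6)[OF s(2)] s(1) by simp
      moreover have "a - \<delta> < Re s" "Re s < b + \<delta>" using s(1) by simp_all
      ultimately show False using \<delta>le[OF s(2)] by linarith
    qed
    show "((\<lambda>T. (u powr a + u powr b) / T ^ 3) \<longlongrightarrow> 0) at_top"
      by (rule tendsto_divide_0[OF tendsto_const filterlim_at_top_imp_at_infinity]) real_asymp
    fix s assume s: "a \<le> Re s" "Re s \<le> b" "1 \<le> \<bar>Im s\<bar>"
    have "u powr Re s \<le> u powr a + u powr b"
      using assms(1) s(1,2) by (rule powr_le_powr_add_powr)
    then have "u powr Re s / \<bar>Im s\<bar> ^ 3 \<le> (u powr a + u powr b) / \<bar>Im s\<bar> ^ 3" by (intro divide_right_mono) auto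
    moreover have "Im s \<noteq> 0" using s(3) by auto
    ultimately show "norm (perron_kernel u s) \<le> (u powr a + u powr b) / \<bar>Im s\<bar> ^ 3"
      using norm_perron_kernel_le[OF assms(1)] order_trans by blast
  qed (use assms \<delta> 1 perron_kernel_integrable in auto)
qed

lemma residue_perron_kernel:
  assumes "u > 0"
  shows "residue (perron_kernel u) 0 = 1/2" "residue (perron_kernel u) (-1) = - 1 / of_real u"
    "residue (perron_kernel u) (-2) = 1 / (2 * of_real u ^ 2)"
proof -
  have nz: "z + 1 \<noteq> 0" "z + 2 \<noteq> 0" if "Re z > -1" for z :: complex using that by (auto simp: complex_eq_iff)
  have "residue (\<lambda>w. (of_real u powr w / ((w + 1) * (w + 2))) / (w - 0)) 0 = of_real u powr 0 / ((0 + 1) * (0 + 2))"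
    by (rule residue_simple[where s = "{w. Re w > -1}"])
       (use assms nz in \<open>auto intro!: holomorphic_intros simp: open_halfspace_Re_gt\<close>)
  then show "residue (perron_kernel u) 0 = 1/2"
    using assms by (simp add: perron_kernel_def[abs_def] mult_ac)
  have nz: "z \<noteq> 0" "z + 2 \<noteq> 0" if "z \<in> ball (-1) 1" for z :: complex
  proof -
    have "\<bar>Re (z + 1)\<bar> < 1" using that abs_Re_le_cmod[of "z + 1"] by (simp add: dist_norm norm_minus_commute add.commute)
    then show "z \<noteq> 0" "z + 2 \<noteq> 0" by (auto simp: complex_eq_iff)
  qed
  have "residue (\<lambda>w. (of_real u powr w / (w * (w + 2))) / (w - (-1))) (-1) = of_real u powr (-1) / ((-1) * (-1 + 2))"
    by (rule residue_simple[where s = "ball (-1) 1"]) (use assms nz in \<open>auto intro!: holomorphic_intros\<close>)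
  then show "residue (perron_kernel u) (-1) = - 1 / of_real u"
    using assms by (simp add: perron_kernel_def[abs_def] mult_ac powr_minus_divide)
  have nz: "z \<noteq> 0" "z + 1 \<noteq> 0" if "Re z < -1" for z :: complex using that by (auto simp: complex_eq_iff)
  have "residue (\<lambda>w. (of_real u powr w / (w * (w + 1))) / (w - (-2))) (-2) = of_real u powr (-2) / ((-2) * (-2 + 1))"
    by (rule residue_simple[where s = "{w. Re w < -1}"])
       (use assms nz in \<open>auto intro!: holomorphic_intros simp: open_halfspace_Re_lt\<close>)
  moreover have "complex_of_real u powr (-2) = 1 / of_real u ^ 2"
    using assms by (simp add: powr_minus_divide powr_numeral)
  ultimately show "residue (perron_kernel u) (-2) = 1 / (2 * of_real u ^ 2)"
    using assms by (simp add: perron_kernel_def[abs_def] mult_ac)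
qed

lemma integrable_inverse_1_plus_square: "integrable lborel (\<lambda>t::real. 1 / (1 + t\<^sup>2))"
proof -
  have "integrable lborel (\<lambda>t. complex_of_real (1 / (1 + t\<^sup>2)))"
  proof (rule integrable_line_powr_decay[where \<beta> = 2 and T = 1 and C = 1])
    show "continuous_on UNIV (\<lambda>t. complex_of_real (1 / (1 + t\<^sup>2)))"
      by (intro continuous_intros) (metis add_pos_nonneg less_irrefl zero_le_power2 zero_less_one)
    fix t :: real assume t: "1 \<le> \<bar>t\<bar>"
    have "1 / (1 + t\<^sup>2) \<le> 1 / t\<^sup>2" using t by (intro divide_left_mono) (auto intro!: mult_pos_pos add_pos_nonneg)
    also have "\<dots> = \<bar>t\<bar> powr (-2)" using t by (simp add: powr_minus_divide powr_numeral)
    finally show "norm (complex_of_real (1 / (1 + t\<^sup>2))) \<le> 1 * \<bar>t\<bar> powr (-2)" by (simp only: norm_of_real) simp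
  qed simp
  from integrable_Re[OF this] show ?thesis by simp
qed

lemma norm_perron_line_integral_le:
  assumes "u > 0" "K > 0" "\<And>t. K * (1 + t\<^sup>2) \<le> norm (Complex c t * (Complex c t + 1) * (Complex c t + 2))"
  shows "norm (LINT t|lborel. perron_kernel u (Complex c t)) \<le> u powr c / K * (LINT t|lborel. 1 / (1 + t\<^sup>2))"
proof -
  have "norm (LINT t|lborel. perron_kernel u (Complex c t)) \<le> (LINT t|lborel. u powr c / K * (1 / (1 + t\<^sup>2)))"
  proof (rule order_trans[OF integral_norm_bound], rule integral_mono)
    show "integrable lborel (\<lambda>t. u powr c / K * (1 / (1 + t\<^sup>2)))"
      by (rule integrable_mult_right) (rule integrable_inverse_1_plus_square)
    have "c \<notin> {0, -1, -2}" using assms(3)[of 0] assms(2) by (auto simp: Complex_eq)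
    then show "integrable lborel (\<lambda>t. norm (perron_kernel u (Complex c t)))"
      by (intro integrable_norm perron_kernel_integrable[OF assms(1)])
    fix t :: real
    have p: "1 + t\<^sup>2 > 0" by (intro add_pos_nonneg) auto
    have "norm (perron_kernel u (Complex c t)) = u powr c / norm (Complex c t * (Complex c t + 1) * (Complex c t + 2))"
      using assms(1) by (simp only: perron_kernel_def norm_divide norm_powr_of_real_pos complex.sel)
    also have "\<dots> \<le> u powr c / (K * (1 + t\<^sup>2))"
      using assms p by (intro divide_left_mono) (auto intro!: mult_pos_pos less_le_trans[OF _ assms(3)])
    finally show "norm (perron_kernel u (Complex c t)) \<le> u powr c / K * (1 / (1 + t\<^sup>2))" by simp
  qed
  then show ?thesis by (simp only: integral_mult_right_zero)
qed

text \<open>For \<open>u <= 1\<close> the line moves to the right without meeting a pole; at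
  \<open>u = 1\<close> the power does not decay, and the factor \<open>1 / (n + 1)\<close> extracted
  from the denominator does the work. For \<open>u > 1\<close> the line moves left past all three
  poles, whose residues 1/2 - 1/u + 1/(2 u^2) form the square, and the power itself tends to
  0.\<close>

lemma perron_formula:
  assumes "u > 0" "c > 0"
  shows "(LINT t|lborel. perron_kernel u (Complex c t)) = 2 * pi * (if 1 < u then (1 - 1 / u)\<^sup>2 / 2 else 0)"
proof -
  define J where "J = (LINT t|lborel. 1 / (1 + t\<^sup>2 :: real))"
  let ?I = "\<lambda>c. LINT t|lborel. perron_kernel u (Complex c t)"
  show ?thesis
  proof (cases "1 < u")
    case False
    have eq: "?I (real n + 1 + c) = ?I c" for n
    proof -
      have "?I (real n + 1 + c) - ?I c = 2 * pi * (\<Sum>p\<in>{}. residue (perron_kernel u) p)"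
        by (rule perron_kernel_shift[OF assms(1)]) (use assms in auto)
      then show ?thesis by simp
    qed
    have "norm (?I c) \<le> J / (real n + 1)" for n
    proof -
      define b where "b = real n + 1 + c"
      have b: "b \<ge> real n + 1" "b \<ge> 1" using assms by (auto simp: b_def)
      have "norm (?I b) \<le> u powr b / (real n + 1) * J" unfolding J_def
      proof (rule norm_perron_line_integral_le[OF assms(1)])
        fix t :: real
        let ?s = "Complex b t"
        have n0: "real n + 1 \<le> norm ?s" using complex_Re_le_cmod[of ?s] b by simp
        have "norm ?s ^ 2 \<ge> 1 + t\<^sup>2" using norm_Complex_squared_ge[of b t] b by simp
        moreover have "norm ?s \<le> norm (?s + 1)" "norm ?s \<le> norm (?s + 2)"
          using b by (auto simp: cmod_def power_mono)
        then have "norm ?s * norm ?s \<le> norm (?s + 1) * norm (?s + 2)" by (intro mult_mono) auto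
        ultimately have "1 + t\<^sup>2 \<le> norm (?s + 1) * norm (?s + 2)" by (simp add: power2_eq_square)
        then have "(real n + 1) * (1 + t\<^sup>2) \<le> norm ?s * (norm (?s + 1) * norm (?s + 2))" using n0
          by (intro mult_mono) auto
        then show "(real n + 1) * (1 + t\<^sup>2) \<le> norm (?s * (?s + 1) * (?s + 2))" by (simp only: norm_mult mult.assoc)
      qed simp
      also have "u powr b / (real n + 1) * J \<le> 1 / (real n + 1) * J"
      proof (intro mult_right_mono divide_right_mono)
        show "u powr b \<le> 1" using False assms(1) b by (intro powr_le1) auto
        show "0 \<le> J" unfolding J_def by (intro integral_nonneg_AE AE_I2) auto
      qed auto
      finally show ?thesis using eq[of n] by (simp add: b_def)
    qed
    moreover have "(\<lambda>n. J / (real n + 1)) \<longlonglongrightarrow> 0" by real_asymp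
    ultimately have "norm (?I c) \<le> 0" by (intro LIMSEQ_le_const[where X = "\<lambda>n. J / (real n + 1)"]) auto
    then show ?thesis using False by simp
  next
    case True
    define r where "r = (1 - 1 / u)\<^sup>2 / 2"
    have res: "(\<Sum>p\<in>{0, -1, -2}. residue (perron_kernel u) p) = of_real r"
      using assms(1) by (simp add: residue_perron_kernel[OF assms(1)] r_def power2_eq_square field_simps)
    have eq: "?I c - 2 * pi * r = ?I (- real n - 3)" for n
    proof -
      have "?I c - ?I (- real n - 3) = 2 * pi * (\<Sum>p\<in>{0, -1, -2}. residue (perron_kernel u) p)"
        by (rule perron_kernel_shift[OF assms(1)]) (use assms in auto)
      then show ?thesis unfolding res by (simp add: algebra_simps)
    qed
    have "norm (?I c - 2 * pi * r) \<le> u powr (- real n - 3) * J" for n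
    proof -
      define b where "b = - real n - 3"
      have b: "b \<le> -3" by (auto simp: b_def)
      have "norm (?I b) \<le> u powr b / 1 * J" unfolding J_def
      proof (rule norm_perron_line_integral_le[OF assms(1)])
        fix t :: real
        let ?s = "Complex b t"
        have n0: "1 \<le> norm ?s" using abs_Re_le_cmod[of ?s] b by simp
        have e: "?s + 1 = Complex (b + 1) t" "?s + 2 = Complex (b + 2) t" by (auto simp: complex_eq_iff)
        have "norm (?s + 2) ^ 2 \<ge> 1 + t\<^sup>2" unfolding e using norm_Complex_squared_ge[of "b + 2" t] b by simp
        moreover have "norm (?s + 2) \<le> norm (?s + 1)"
          unfolding e cmod_def using b by (auto simp: power2_eq_square algebra_simps)
        then have "norm (?s + 2) * norm (?s + 2) \<le> norm (?s + 1) * norm (?s + 2)" by (intro mult_mono) auto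
        ultimately have "1 + t\<^sup>2 \<le> norm (?s + 1) * norm (?s + 2)" by (simp add: power2_eq_square)
        then have "1 * (1 + t\<^sup>2) \<le> norm ?s * (norm (?s + 1) * norm (?s + 2))" using n0
          by (intro mult_mono) auto
        then show "1 * (1 + t\<^sup>2) \<le> norm (?s * (?s + 1) * (?s + 2))" by (simp only: norm_mult mult.assoc)
      qed simp
      then show ?thesis unfolding eq[of n] b_def by simp
    qed
    moreover have "(\<lambda>n. u powr (- real n - 3) * J) \<longlonglongrightarrow> 0" using True by real_asymp
    ultimately have "norm (?I c - 2 * pi * r) \<le> 0"
      by (intro LIMSEQ_le_const[where X = "\<lambda>n. u powr (- real n - 3) * J"]) auto
    then show ?thesis using True by (simp add: r_def)
  qed
qed


text \<open>One inequality per derivative, uniform in \<open>\<rho>\<close>, encodes two facts: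
  \<open>\<rho> = 0\<close> is boundedness near 0, the largest \<open>\<rho>\<close> is the decay at
  infinity. Exponents in between can be picked to suit each estimate.\<close>

locale smooth_decaying =
  fixes \<alpha> C :: real and f f1 f2 f3 :: "real \<Rightarrow> complex"
  assumes alpha: "1 < \<alpha>"
    and der: "\<And>x. 0 < x \<Longrightarrow> (f has_vector_derivative f1 x) (at x)"
      "\<And>x. 0 < x \<Longrightarrow> (f1 has_vector_derivative f2 x) (at x)"
      "\<And>x. 0 < x \<Longrightarrow> (f2 has_vector_derivative f3 x) (at x)"
    and cont3: "continuous_on {0<..} f3"
    and bound: "\<And>x \<rho>. 0 < x \<Longrightarrow> 0 \<le> \<rho> \<Longrightarrow> \<rho> \<le> \<alpha> \<Longrightarrow> norm (f x) \<le> C * x powr (-\<rho>)"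
      "\<And>x \<rho>. 0 < x \<Longrightarrow> 0 \<le> \<rho> \<Longrightarrow> \<rho> \<le> \<alpha> + 1 \<Longrightarrow> norm (f1 x) \<le> C * x powr (-\<rho>)"
      "\<And>x \<rho>. 0 < x \<Longrightarrow> 0 \<le> \<rho> \<Longrightarrow> \<rho> \<le> \<alpha> + 2 \<Longrightarrow> norm (f2 x) \<le> C * x powr (-\<rho>)"
      "\<And>x \<rho>. 0 < x \<Longrightarrow> 0 \<le> \<rho> \<Longrightarrow> \<rho> \<le> \<alpha> + 3 \<Longrightarrow> norm (f3 x) \<le> C * x powr (-\<rho>)"
begin

lemma continuous_f: "continuous_on {0<..} f" "continuous_on {0<..} f1" "continuous_on {0<..} f2"
  using der by (auto intro!: continuous_at_imp_continuous_on has_vector_derivative_continuous)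

lemma C_nonneg: "0 \<le> C"
proof -
  have "0 \<le> norm (f 1)" by simp
  also have "\<dots> \<le> C * 1 powr (-0)" using alpha by (intro bound) auto
  finally show ?thesis by simp
qed

lemma integrable_f_powr:
  assumes "0 < Re s" "Re s < \<alpha>"
  shows "set_integrable lborel {0<..} (\<lambda>x. f x * of_real (x powr (Re s - 1)))"
    and "set_integrable lborel {0<..} (\<lambda>x. f x * of_real x powr (s - 1))"
proof -
  show 1: "set_integrable lborel {0<..} (\<lambda>x. f x * of_real (x powr (Re s - 1)))"
    by (rule set_integrable_mult_powr[where A = \<alpha> and C = C]) (use continuous_f bound assms in auto)
  show "set_integrable lborel {0<..} (\<lambda>x. f x * of_real x powr (s - 1))"
    by (rule set_integrable_mult_complex_powr) (use 1 continuous_f in auto)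
qed

lemma integrable_f3_powr:
  assumes "0 < Re s" "Re s < \<alpha>"
  shows "set_integrable lborel {0<..} (\<lambda>x. f3 x * of_real (x powr (Re s + 2)))"
    and "set_integrable lborel {0<..} (\<lambda>x. f3 x * of_real x powr (s + 2))"
proof -
  have "set_integrable lborel {0<..} (\<lambda>x. f3 x * of_real (x powr (Re s + 3 - 1)))"
    by (rule set_integrable_mult_powr[where A = "\<alpha> + 3" and C = C]) (use cont3 bound assms in auto)
  then show 1: "set_integrable lborel {0<..} (\<lambda>x. f3 x * of_real (x powr (Re s + 2)))" by (simp add: add.commute)
  show "set_integrable lborel {0<..} (\<lambda>x. f3 x * of_real x powr (s + 2))"
    by (rule set_integrable_mult_complex_powr) (use 1 cont3 in auto)
qed

lemma mellin_eq_LINT: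
  assumes "0 < Re s" "Re s < \<alpha>"
  shows "mellin f s = (LINT x:{0<..}|lborel. f x * of_real x powr (s - 1))"
  unfolding mellin_def using set_borel_integral_eq_integral(2)[OF integrable_f_powr(2)[OF assms]] by simp

lemma holomorphic_mellin: "mellin f holomorphic_on {s. 0 < Re s \<and> Re s < \<alpha>}"
proof -
  let ?U = "{s. 0 < Re s \<and> Re s < \<alpha>}"
  define F where "F = (\<lambda>s x. indicator {0<..} x *\<^sub>R (f x * complex_of_real x powr (s - 1)))"
  have "?U = {s. 0 < Re s} \<inter> {s. Re s < \<alpha>}" by auto
  then have op: "open ?U" using open_halfspace_Re_gt open_halfspace_Re_lt by (metis open_Int)
  have "(\<lambda>s. LINT x|lborel. F s x) holomorphic_on ?U"
  proof (rule holomorphic_on_LINT[OF op])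
    fix s assume s: "s \<in> ?U"
    show "F s \<in> borel_measurable lborel"
      using borel_measurable_integrable[OF integrable_f_powr(2)[of s, unfolded set_integrable_def]] s unfolding F_def by simp
    define r where "r = min (Re s) (\<alpha> - Re s) / 2"
    have r: "0 < r" "r < Re s" "Re s + r < \<alpha>" using s by (auto simp: r_def min_def field_simps)
    \<comment> \<open>Majorant: the integrands at the two exponents at distance \<open>r\<close>
      from \<open>Re s\<close>, both inside the strip. The form \<open>Re (of_real _)\<close>
      matches the statement of \<open>integrable_f_powr(1)\<close>.\<close>
    define G where "G = (\<lambda>x. norm (indicator {0<..} x *\<^sub>R (f x * of_real (x powr (Re (of_real (Re s - r)) - 1)))) 
        + norm (indicator {0<..} x *\<^sub>R (f x * of_real (x powr (Re (of_real (Re s + r)) - 1)))))"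
    have "integrable lborel G" unfolding G_def
      using r by (intro Bochner_Integration.integrable_add integrable_norm integrable_f_powr(1)[unfolded set_integrable_def]) auto
    moreover have "norm (F z x) \<le> G x" if z: "z \<in> ball s r" for z x
    proof (cases "x > 0")
      case True
      have "\<bar>Re z - Re s\<bar> < r" using z abs_Re_le_cmod[of "s - z"] by (simp add: dist_norm)
      then have zr: "Re s - r \<le> Re z" "Re z \<le> Re s + r" by linarith+
      have "x powr (Re z - 1) \<le> x powr (Re s - r - 1) + x powr (Re s + r - 1)"
        by (rule powr_le_powr_add_powr) (use True zr in auto)
      then have "norm (f x) * x powr (Re z - 1) \<le> norm (f x) * (x powr (Re s - r - 1) + x powr (Re s + r - 1))"
        by (intro mult_left_mono) auto
      then show ?thesis using True by (simp add: F_def G_def norm_mult norm_powr_of_real_pos distrib_left)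
    qed (simp add: F_def G_def)
    ultimately show "\<exists>r>0. \<exists>G. integrable lborel G \<and> (\<forall>z\<in>ball s r \<inter> ?U. \<forall>x\<in>space lborel. norm (F z x) \<le> G x)"
      using r(1) by blast
  next
    fix x :: real
    show "(\<lambda>s. F s x) holomorphic_on ?U"
      unfolding F_def scaleR_conv_of_real by (cases "x = 0") (auto intro!: holomorphic_intros)
  qed
  then show ?thesis
    by (rule holomorphic_transform) (simp add: mellin_eq_LINT F_def set_lebesgue_integral_def)
qed

text \<open>\<open>F\<close> collects the boundary terms of three integrations by parts, so a single
  use of the fundamental theorem replaces them: its derivative \<open>g\<close> is the sum of the
  two integrands, and both boundary values are 0.\<close>

lemma mellin_third_derivative:
  assumes s: "0 < Re s" "Re s < \<alpha>"
  shows "s * (s + 1) * (s + 2) * mellin f s = - (LINT x:{0<..}|lborel. f3 x * of_real x powr (s + 2))"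
proof -
  define \<sigma> where "\<sigma> = Re s"
  define F where "F = (\<lambda>x. f2 x * of_real x powr (s + 2) - (s + 2) * (f1 x * of_real x powr (s + 1)) + (s + 2) * (s + 1) * (f x * of_real x powr s))"
  define g where "g = (\<lambda>x. f3 x * of_real x powr (s + 2) + s * (s + 1) * (s + 2) * (f x * of_real x powr (s - 1)))"
  have e0: "einterval 0 \<infinity> = {0<..}" by (auto simp: einterval_def)
  have int: "set_integrable lborel {0<..} g"
    unfolding g_def by (intro set_integral_add set_integrable_mult_right integrable_f_powr integrable_f3_powr s)
  define K where "K = C + norm (s + 2) * C + norm ((s + 2) * (s + 1)) * C"
  \<comment> \<open>\<open>\<rho> = 0\<close> makes \<open>F\<close> vanish at 0 because \<sigma> >
    0, and \<open>\<rho> = \<alpha>\<close> makes it vanish at infinity because \<sigma> < \<alpha>.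
    The derivative of order \<open>k\<close> is bounded with exponent \<open>\<rho> + k\<close>,
    which cancels the additional factor \<open>x powr k\<close>.\<close>
  have nF: "norm (F x) \<le> K * x powr (\<sigma> - \<rho>)" if x: "0 < x" and \<rho>: "\<rho> \<in> {0, \<alpha>}" for x \<rho>
  proof -
    have *: "norm (y * of_real x powr (s + of_real k)) \<le> C * x powr (\<sigma> - \<rho>)"
      if "norm y \<le> C * x powr (- (\<rho> + k))" for y k
    proof -
      have "norm y * x powr (\<sigma> + k) \<le> (C * x powr (- (\<rho> + k))) * x powr (\<sigma> + k)"
        by (intro mult_right_mono that) auto
      also have "\<dots> = C * x powr (\<sigma> - \<rho>)" by (simp add: powr_add[symmetric])
      finally show ?thesis using x by (simp add: norm_mult norm_powr_of_real_pos \<sigma>_def)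
    qed
    have "norm (f2 x * of_real x powr (s + 2)) \<le> C * x powr (\<sigma> - \<rho>)"
      using *[of "f2 x" 2] bound(3)[OF x, of "\<rho> + 2"] \<rho> alpha by auto
    moreover have "norm (f1 x * of_real x powr (s + 1)) \<le> C * x powr (\<sigma> - \<rho>)"
      using *[of "f1 x" 1] bound(2)[OF x, of "\<rho> + 1"] \<rho> alpha by auto
    moreover have "norm (f x * of_real x powr s) \<le> C * x powr (\<sigma> - \<rho>)"
      using *[of "f x" 0] bound(1)[OF x, of \<rho>] \<rho> alpha by auto
    ultimately have "norm (f2 x * of_real x powr (s + 2)) + norm (s + 2) * norm (f1 x * of_real x powr (s + 1)) 
        + norm ((s + 2) * (s + 1)) * norm (f x * of_real x powr s) \<le> C * x powr (\<sigma> - \<rho>) + norm (s + 2) * (C * x powr (\<sigma> - \<rho>)) + norm ((s + 2) * (s + 1)) * (C * x powr (\<sigma> - \<rho>))"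
      using x by (intro add_mono mult_left_mono) auto
    also have "\<dots> = K * x powr (\<sigma> - \<rho>)" by (simp add: K_def algebra_simps)
    finally show ?thesis unfolding F_def
      by (intro order_trans[OF norm_triangle_ineq] order_trans[OF add_right_mono[OF norm_triangle_ineq4]]) (simp only: norm_mult)
  qed
  have "(LBINT x=0..\<infinity>. g x) = 0 - 0"
  proof (rule interval_integral_FTC_integrable[where F = F])
    show "set_integrable lborel (einterval 0 \<infinity>) g" using int by (simp add: e0)
    show "(F has_vector_derivative g x) (at x)" if "0 < ereal x" for x
    proof -
      have x: "0 < x" using that by simp
      have "(F has_vector_derivative ((f2 x * ((s + 2) * of_real x powr (s + 2 - 1)) + f3 x * of_real x powr (s + 2))
          - (s + 2) * (f1 x * ((s + 1) * of_real x powr (s + 1 - 1)) + f2 x * of_real x powr (s + 1))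
          + (s + 2) * (s + 1) * (f x * (s * of_real x powr (s - 1)) + f1 x * of_real x powr s))) (at x)"
        unfolding F_def
        by (intro has_vector_derivative_add has_vector_derivative_diff has_vector_derivative_mult
            has_vector_derivative_mult_right of_real_powr_has_vector_derivative der x)
      also have "(f2 x * ((s + 2) * of_real x powr (s + 2 - 1)) + f3 x * of_real x powr (s + 2))
          - (s + 2) * (f1 x * ((s + 1) * of_real x powr (s + 1 - 1)) + f2 x * of_real x powr (s + 1))
          + (s + 2) * (s + 1) * (f x * (s * of_real x powr (s - 1)) + f1 x * of_real x powr s) = g x"
      proof -
        have e: "s + 2 - 1 = s + 1" "s + 1 - 1 = s" by simp_all
        show ?thesis unfolding e g_def by (simp add: algebra_simps)
      qed
      finally show ?thesis .
    qed
    show "isCont g x" if "0 < ereal x" for x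
    proof -
      have "continuous_on {0<..} g" unfolding g_def
        by (intro continuous_on_add continuous_on_mult continuous_on_const cont3 continuous_f continuous_on_of_real_powr)
      then show ?thesis using that by (simp add: continuous_on_eq_continuous_at open_greaterThan)
    qed
    have l0: "((\<lambda>x. K * x powr (\<sigma> - 0)) \<longlongrightarrow> 0) (at_right 0)"
      using s by (auto simp: \<sigma>_def intro!: tendsto_mult_right_zero) real_asymp
    have "(F \<longlongrightarrow> 0) (at_right 0)"
    proof (rule Lim_null_comparison[OF _ l0])
      show "\<forall>\<^sub>F x in at_right 0. norm (F x) \<le> K * x powr (\<sigma> - 0)"
        using eventually_at_right_less[of 0] by eventually_elim (rule nF, auto)
    qed
    then show "((F \<circ> real_of_ereal) \<longlongrightarrow> 0) (at_right 0)" by (simp add: zero_ereal_def ereal_tendsto_simps)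
    have l1: "((\<lambda>x. K * x powr (\<sigma> - \<alpha>)) \<longlongrightarrow> 0) at_top"
      using s by (intro tendsto_mult_right_zero tendsto_neg_powr filterlim_ident) (auto simp: \<sigma>_def)
    have "(F \<longlongrightarrow> 0) at_top"
    proof (rule Lim_null_comparison[OF _ l1])
      show "\<forall>\<^sub>F x in at_top. norm (F x) \<le> K * x powr (\<sigma> - \<alpha>)"
        using eventually_gt_at_top[of 0] by eventually_elim (rule nF, auto)
    qed
    then show "((F \<circ> real_of_ereal) \<longlongrightarrow> 0) (at_left \<infinity>)" by (simp add: ereal_tendsto_simps)
  qed simp
  then have "(LINT x:{0<..}|lborel. g x) = 0" by (simp add: interval_lebesgue_integral_def e0)
  then show ?thesis
    unfolding g_def mellin_eq_LINT[OF s]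
    by (simp add: set_integral_add set_integrable_mult_right integrable_f_powr integrable_f3_powr s add_eq_0_iff2 add_eq_0_iff)
qed

text \<open>One constant serves the closed strip, because the power in the integrand is at most the
  sum of the powers at the two edges.\<close>

lemma mellin_bound:
  assumes "0 < a" "a \<le> b" "b < \<alpha>"
  obtains K where "K \<ge> 0" "\<And>s. a \<le> Re s \<Longrightarrow> Re s \<le> b \<Longrightarrow> Im s \<noteq> 0 \<Longrightarrow> norm (mellin f s) \<le> K / \<bar>Im s\<bar> ^ 3"
proof
  define H where "H = (\<lambda>\<sigma> x. norm (indicator {0<..} x *\<^sub>R (f3 x * of_real (x powr (\<sigma> + 2)))))"
  have H: "integrable lborel (H \<sigma>)" if "0 < \<sigma>" "\<sigma> < \<alpha>" for \<sigma>
    unfolding H_def using integrable_f3_powr(1)[of "of_real \<sigma>"] that unfolding set_integrable_def by (intro integrable_norm) auto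
  define K where "K = (LINT x|lborel. H a x + H b x)"
  have iab: "integrable lborel (\<lambda>x. H a x + H b x)" using assms by (intro Bochner_Integration.integrable_add H) auto
  show "K \<ge> 0" unfolding K_def by (intro integral_nonneg_AE AE_I2) (simp add: H_def)
  fix s assume s: "a \<le> Re s" "Re s \<le> b" "Im s \<noteq> 0"
  have s': "0 < Re s" "Re s < \<alpha>" using s assms by auto
  have "norm (LINT x:{0<..}|lborel. f3 x * of_real x powr (s + 2)) \<le> K"
    unfolding K_def set_lebesgue_integral_def
  proof (rule order_trans[OF integral_norm_bound], rule integral_mono)
    show "integrable lborel (\<lambda>x. norm (indicator {0<..} x *\<^sub>R (f3 x * of_real x powr (s + 2))))"
      using integrable_f3_powr(2)[OF s'] unfolding set_integrable_def by (rule integrable_norm)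
    show "integrable lborel (\<lambda>x. H a x + H b x)" by (rule iab)
    fix x :: real
    show "norm (indicator {0<..} x *\<^sub>R (f3 x * complex_of_real x powr (s + 2))) \<le> H a x + H b x"
    proof (cases "x > 0")
      case True
      have "x powr (Re s + 2) \<le> x powr (a + 2) + x powr (b + 2)"
        by (rule powr_le_powr_add_powr) (use True s in auto)
      then have "norm (f3 x) * x powr (Re s + 2) \<le> norm (f3 x) * (x powr (a + 2) + x powr (b + 2))"
        by (intro mult_left_mono) auto
      then show ?thesis using True by (simp add: H_def norm_mult norm_powr_of_real_pos distrib_left)
    qed (simp add: H_def)
  qed
  then have le: "norm (s * (s + 1) * (s + 2)) * norm (mellin f s) \<le> K"
    using mellin_third_derivative[OF s'] by (metis norm_minus_cancel norm_mult)
  have "\<bar>Im s\<bar> ^ 3 * norm (mellin f s) \<le> norm (s * (s + 1) * (s + 2)) * norm (mellin f s)"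
    by (intro mult_right_mono Im_cubed_le_norm) auto
  then have "\<bar>Im s\<bar> ^ 3 * norm (mellin f s) \<le> K" using le by (rule order_trans)
  then show "norm (mellin f s) \<le> K / \<bar>Im s\<bar> ^ 3" using s(3) by (simp add: field_simps)
qed

text \<open>Taylor's formula with integral remainder, based at infinity: every boundary term there
  vanishes, and at the lower end \<open>x\<close> the polynomial weights annihilate all terms but
  \<open>f x\<close>.\<close>

lemma taylor_at_infinity:
  assumes x: "0 < x" and int: "set_integrable lborel {x<..} (\<lambda>y. f3 y * of_real ((y - x)\<^sup>2 / 2))"
  shows "(LINT y:{x<..}|lborel. f3 y * of_real ((y - x)\<^sup>2 / 2)) = - f x"
proof -
  define F where "F = (\<lambda>y. f2 y * of_real ((y - x)\<^sup>2 / 2) - f1 y * of_real (y - x) + f y)"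
  have e0: "einterval (ereal x) \<infinity> = {x<..}" by (auto simp: einterval_def)
  have der': "(F has_vector_derivative f3 y * of_real ((y - x)\<^sup>2 / 2)) (at y)" if y: "0 < y" for y
  proof -
    have 1: "((\<lambda>y. complex_of_real ((y - x)\<^sup>2 / 2)) has_vector_derivative of_real (y - x)) (at y)"
      by (rule has_vector_derivative_of_real) (auto intro!: derivative_eq_intros simp flip: has_real_derivative_iff_has_vector_derivative)
    have 2: "((\<lambda>y. complex_of_real (y - x)) has_vector_derivative of_real 1) (at y)"
      by (rule has_vector_derivative_of_real) (auto intro!: derivative_eq_intros simp flip: has_real_derivative_iff_has_vector_derivative)
    have "(F has_vector_derivative (f2 y * of_real (y - x) + f3 y * of_real ((y - x)\<^sup>2 / 2)) - (f1 y * of_real 1 + f2 y * of_real (y - x)) + f1 y) (at y)"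
      unfolding F_def by (intro has_vector_derivative_add has_vector_derivative_diff has_vector_derivative_mult 1 2 der y)
    then show ?thesis by simp
  qed
  have "(LBINT y=ereal x..\<infinity>. f3 y * of_real ((y - x)\<^sup>2 / 2)) = 0 - f x"
  proof (rule interval_integral_FTC_integrable[where F = F])
    show "set_integrable lborel (einterval (ereal x) \<infinity>) (\<lambda>y. f3 y * of_real ((y - x)\<^sup>2 / 2))" using int by (simp add: e0)
    show "(F has_vector_derivative f3 y * of_real ((y - x)\<^sup>2 / 2)) (at y)" if "ereal x < ereal y" for y
      using der' that x by simp
    show "isCont (\<lambda>y. f3 y * of_real ((y - x)\<^sup>2 / 2)) y" if "ereal x < ereal y" for y
    proof -
      have "isCont f3 y" using cont3 that x by (simp add: continuous_on_eq_continuous_at open_greaterThan)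
      then show ?thesis by (intro continuous_intros) auto
    qed
    have "isCont F x" using der'[OF x] by (rule has_vector_derivative_continuous)
    then have "(F \<longlongrightarrow> F x) (at_right x)" unfolding isCont_def by (rule filterlim_mono) (auto simp: at_le)
    then show "((F \<circ> real_of_ereal) \<longlongrightarrow> f x) (at_right (ereal x))" by (simp add: ereal_tendsto_simps F_def)
    \<comment> \<open>As \<alpha> > 1, the decay exponents 3, 2 and 1 are admissible for
      \<open>f2\<close>, \<open>f1\<close> and \<open>f\<close>; each term is then at most
      \<open>C * y powr (-1)\<close>.\<close>
    have "(F \<longlongrightarrow> 0) at_top"
    proof (rule Lim_null_comparison)
      show "\<forall>\<^sub>F y in at_top. norm (F y) \<le> 3 * C * y powr (-1)"
        using eventually_ge_at_top[of "max 1 x"]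
      proof eventually_elim
        case (elim y)
        then have y: "1 \<le> y" "x \<le> y" by auto
        have "norm (f2 y * of_real ((y - x)\<^sup>2 / 2)) \<le> (C * y powr (-3)) * y\<^sup>2"
        proof -
          have "(y - x)\<^sup>2 \<le> y\<^sup>2" using y x by (intro power_mono) auto
          moreover have "norm (complex_of_real ((y - x)\<^sup>2 / 2)) = (y - x)\<^sup>2 / 2"
            unfolding norm_of_real by simp
          moreover have "(y - x)\<^sup>2 / 2 \<le> (y - x)\<^sup>2" by simp
          ultimately have "norm (complex_of_real ((y - x)\<^sup>2 / 2)) \<le> y\<^sup>2" by argo
          then show ?thesis unfolding norm_mult using y alpha C_nonneg by (intro mult_mono bound) auto
        qed
        also have "\<dots> = C * y powr (-1)"
          using y powr_add[of y "-3" 2] by (simp add: powr_numeral)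
        finally have 1: "norm (f2 y * of_real ((y - x)\<^sup>2 / 2)) \<le> C * y powr (-1)" .
        have "norm (f1 y * of_real (y - x)) \<le> (C * y powr (-2)) * y"
          unfolding norm_mult norm_of_real using y alpha C_nonneg x by (intro mult_mono bound) auto
        also have "\<dots> = C * y powr (-1)"
          using y powr_add[of y "-2" 1] by simp
        finally have 2: "norm (f1 y * of_real (y - x)) \<le> C * y powr (-1)" .
        have 3: "norm (f y) \<le> C * y powr (-1)" using y alpha by (intro bound) auto
        have "norm (F y) \<le> norm (f2 y * of_real ((y - x)\<^sup>2 / 2)) + norm (f1 y * of_real (y - x)) + norm (f y)"
          unfolding F_def by (intro order_trans[OF norm_triangle_ineq] add_right_mono norm_triangle_ineq4)
        also have "\<dots> \<le> C * y powr (-1) + C * y powr (-1) + C * y powr (-1)" by (intro add_mono 1 2 3)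
        finally show ?case by simp
      qed
      show "((\<lambda>y. 3 * C * y powr (-1)) \<longlongrightarrow> 0) at_top"
        by (intro tendsto_mult_right_zero tendsto_neg_powr filterlim_ident) auto
    qed
    then show "((F \<circ> real_of_ereal) \<longlongrightarrow> 0) (at_left \<infinity>)" by (simp add: ereal_tendsto_simps)
  qed simp
  then show ?thesis by (simp add: interval_lebesgue_integral_def e0)
qed

text \<open>Writing the transform through \<open>f3\<close> makes the double integral absolutely
  convergent. After the interchange the integral over the line is a Perron integral, which truncates
  to \<open>y > x\<close> and produces the Taylor weight, so that \<open>taylor_at_infinity\<close>
  returns \<open>f x\<close>.\<close>

lemma mellin_inversion:
  assumes x: "0 < x" and c: "0 < c" "c < \<alpha>"
  shows "(LINT t|lborel. mellin f (Complex c t) * of_real x powr (- Complex c t)) = 2 * pi * f x"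
proof -
  define \<Phi> where "\<Phi> = (\<lambda>t. perron_kernel (1 / x) (Complex c t))"
  have \<Phi>: "integrable lborel \<Phi>" unfolding \<Phi>_def using x c by (intro perron_kernel_integrable) auto
  have h: "set_integrable lborel {0<..} (\<lambda>y. f3 y * of_real (y powr (c + 2)))"
    using integrable_f3_powr(1)[of "of_real c"] c by simp
  have em: "(\<lambda>t. Complex c t + 2) \<in> borel_measurable borel"
    unfolding Complex_eq by (intro borel_measurable_continuous_onI continuous_intros)
  have S: "{0<..} \<in> sets (borel :: real measure)" "{0<..} \<subseteq> {0::real<..}" by auto
  have re: "Re (Complex c t + 2) = c + 2" for t by simp
  note fub = Fubini_powr[OF \<Phi> S h em re]
  \<comment> \<open>\<open>y powr (w + 2)\<close> times \<open>(1 / x) powr w\<close> is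
    \<open>y ^ 2\<close> times \<open>(y / x) powr w\<close>; the square turns the Perron value
    \<open>(1 - x / y)^2 / 2\<close> into the weight \<open>(y - x)^2 / 2\<close>.\<close>
  have inner: "(LINT t|lborel. \<Phi> t * of_real y powr (Complex c t + 2)) = (if x < y then 2 * pi * ((y - x)\<^sup>2 / 2) else 0)" if y: "0 < y" for y
  proof -
    have "\<Phi> t * of_real y powr (Complex c t + 2) = of_real y ^ 2 * perron_kernel (y / x) (Complex c t)" for t
    proof -
      have "complex_of_real y powr (Complex c t + 2) = of_real y powr Complex c t * of_real y ^ 2"
        using y by (simp add: powr_add powr_numeral)
      moreover have "complex_of_real (1 / x) powr Complex c t * of_real y powr Complex c t = of_real (y / x) powr Complex c t"
        using x y powr_times_real[of "of_real (1/x)" "of_real y" "Complex c t"] by (simp add: Reals_of_real)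
      ultimately show ?thesis by (simp add: \<Phi>_def perron_kernel_def)
    qed
    then have "(LINT t|lborel. \<Phi> t * of_real y powr (Complex c t + 2)) = of_real y ^ 2 * (LINT t|lborel. perron_kernel (y / x) (Complex c t))"
      by simp
    also have "(LINT t|lborel. perron_kernel (y / x) (Complex c t)) = 2 * pi * (if 1 < y / x then (1 - 1 / (y / x))\<^sup>2 / 2 else 0)"
      using x y c by (intro perron_formula) auto
    also have "complex_of_real y ^ 2 * complex_of_real (2 * pi * (if 1 < y / x then (1 - 1 / (y / x))\<^sup>2 / 2 else 0)) = complex_of_real (2 * pi * (if x < y then (y * (1 - x / y))\<^sup>2 / 2 else 0))"
      using x y by (auto simp: power_mult_distrib)
    also have "y * (1 - x / y) = y - x" using y by (simp add: field_simps)
    finally show ?thesis by simp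
  qed
  have ind: "indicator {0<..} y *\<^sub>R (f3 y * (LINT t|lborel. \<Phi> t * of_real y powr (Complex c t + 2))) = 
      (2 * pi) * (indicator {x<..} y *\<^sub>R (f3 y * of_real ((y - x)\<^sup>2 / 2)))" for y
    using inner[of y] x by (auto simp: indicator_def)
  \<comment> \<open>The integrability presupposed by \<open>taylor_at_infinity\<close> is the second
    half of Fubini's theorem, freed of the factor 2 pi.\<close>
  have int: "set_integrable lborel {x<..} (\<lambda>y. f3 y * of_real ((y - x)\<^sup>2 / 2))"
  proof -
    note i = fub(2)[unfolded set_integrable_def ind]
    have "integrable lborel (\<lambda>y. (1 / complex_of_real (2 * pi)) * (complex_of_real (2 * pi) * (indicator {x<..} y *\<^sub>R (f3 y * of_real ((y - x)\<^sup>2 / 2)))))"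
      by (rule integrable_mult_right[OF i])
    moreover have "(1 / complex_of_real (2 * pi)) * (complex_of_real (2 * pi) * z) = z" for z by simp
    ultimately show ?thesis unfolding set_integrable_def by (simp only:)
  qed
  have "(LINT t|lborel. mellin f (Complex c t) * of_real x powr (- Complex c t))
      = (LINT t|lborel. - (\<Phi> t * (LINT y:{0<..}|lborel. f3 y * of_real y powr (Complex c t + 2))))"
  proof (rule Bochner_Integration.integral_cong[OF refl])
    fix t
    let ?s = "Complex c t"
    have "?s \<noteq> 0" "?s + 1 \<noteq> 0" "?s + 2 \<noteq> 0" using c by (auto simp: complex_eq_iff)
    then have s0: "?s * (?s + 1) * (?s + 2) \<noteq> 0" by simp
    have "mellin f ?s = - (LINT y:{0<..}|lborel. f3 y * of_real y powr (?s + 2)) / (?s * (?s + 1) * (?s + 2))"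
    proof -
      have "?s * (?s + 1) * (?s + 2) * mellin f ?s = - (LINT y:{0<..}|lborel. f3 y * of_real y powr (?s + 2))"
        by (rule mellin_third_derivative) (use c in auto)
      then show ?thesis using nonzero_mult_div_cancel_left[OF s0, of "mellin f ?s"] by (simp only:)
    qed
    moreover have "complex_of_real x powr (- ?s) = of_real (1 / x) powr ?s"
      using x by (simp add: powr_def Ln_of_real ln_div del: of_real_divide)
    ultimately show "mellin f ?s * of_real x powr (- ?s) = - (\<Phi> t * (LINT y:{0<..}|lborel. f3 y * of_real y powr (?s + 2)))"
      by (simp add: \<Phi>_def perron_kernel_def)
  qed
  also have "\<dots> = - (LINT t|lborel. \<Phi> t * (LINT y:{0<..}|lborel. f3 y * of_real y powr (Complex c t + 2)))" by simp
  also have "\<dots> = - ((2 * pi) * (LINT y:{x<..}|lborel. f3 y * of_real ((y - x)\<^sup>2 / 2)))"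
    using fub(1) unfolding set_lebesgue_integral_def ind by (simp only: integral_mult_right_zero)
  also have "\<dots> = 2 * pi * f x" using taylor_at_infinity[OF x int] by simp
  finally show ?thesis .
qed

end

section \<open>Moving the line of integration\<close>

lemma of_real_powr_divide_has_vector_derivative:
  assumes "0 < x" "z \<noteq> 0"
  shows "((\<lambda>x. of_real x powr z / z) has_vector_derivative complex_of_real x powr (z - 1)) (at x)"
  using has_vector_derivative_divide[OF of_real_powr_has_vector_derivative[OF assms(1)], of z z] assms(2) by simp

lemma isCont_of_real_powr: "0 < x \<Longrightarrow> isCont (\<lambda>x. complex_of_real x powr z) x"
  using continuous_on_of_real_powr[of z] by (simp add: continuous_on_eq_continuous_at open_greaterThan)

lemma LINT_powr_unit_interval:
  assumes "0 < Re z"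
  shows "set_integrable lborel {0<..<1} (\<lambda>x. complex_of_real x powr (z - 1))"
    and "(LINT x:{0<..<1}|lborel. complex_of_real x powr (z - 1)) = 1 / z"
proof -
  have z: "z \<noteq> 0" using assms by auto
  have "set_integrable lborel {0<..1} (\<lambda>x. x powr (Re z - 1))" by (rule set_integrable_powr_from_0) (use assms in auto)
  then have "set_integrable lborel {0<..<1::real} (\<lambda>x. x powr (Re z - 1))" by (rule set_integrable_subset) auto
  then have "integrable lborel (\<lambda>x. complex_of_real (indicator {0<..<1} x *\<^sub>R x powr (Re z - 1)))"
    unfolding set_integrable_def by (rule integrable_of_real)
  then have "set_integrable lborel {0<..<1} (\<lambda>x. complex_of_real (x powr (Re z - 1)))"
    unfolding set_integrable_def by (simp add: scaleR_conv_of_real)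
  then have "set_integrable lborel {0<..<1} (\<lambda>x. 1 * complex_of_real x powr (z - 1))"
    by (intro set_integrable_mult_complex_powr) auto
  then show int: "set_integrable lborel {0<..<1} (\<lambda>x. complex_of_real x powr (z - 1))" by simp
  have e: "einterval 0 1 = {0<..<1}" by (auto simp: einterval_def one_ereal_def)
  have "(LBINT x=0..1. complex_of_real x powr (z - 1)) = 1 / z - 0"
  proof (rule interval_integral_FTC_integrable[where F = "\<lambda>x. of_real x powr z / z"])
    show "set_integrable lborel (einterval 0 1) (\<lambda>x. complex_of_real x powr (z - 1))" using int by (simp add: e)
    show "((\<lambda>x. of_real x powr z / z) has_vector_derivative of_real x powr (z - 1)) (at x)" if "0 < ereal x" for x
      using that z by (intro of_real_powr_divide_has_vector_derivative) (auto simp: one_ereal_def)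
    show "isCont (\<lambda>x. complex_of_real x powr (z - 1)) x" if "0 < ereal x" for x
      using that by (intro isCont_of_real_powr) simp
    have "((\<lambda>x. complex_of_real x powr z / z) \<longlongrightarrow> 0) (at_right 0)"
    proof (rule Lim_null_comparison)
      show "\<forall>\<^sub>F x in at_right 0. norm (complex_of_real x powr z / z) \<le> x powr Re z / norm z"
        using eventually_at_right_less[of 0] by eventually_elim (simp add: norm_divide norm_powr_of_real_pos)
      have "((\<lambda>x. x powr Re z) \<longlongrightarrow> 0) (at_right 0)" using assms by real_asymp
      then show "((\<lambda>x. x powr Re z / norm z) \<longlongrightarrow> 0) (at_right 0)" by (rule tendsto_divide_zero)
    qed
    then show "(((\<lambda>x. complex_of_real x powr z / z) \<circ> real_of_ereal) \<longlongrightarrow> 0) (at_right 0)"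
      by (simp add: zero_ereal_def ereal_tendsto_simps)
    have "isCont (\<lambda>x. complex_of_real x powr z / z) 1"
      using z by (intro continuous_intros) auto
    then have "((\<lambda>x. complex_of_real x powr z / z) \<longlongrightarrow> of_real 1 powr z / z) (at_left 1)"
      unfolding isCont_def by (rule filterlim_mono) (auto simp: at_le)
    then show "(((\<lambda>x. complex_of_real x powr z / z) \<circ> real_of_ereal) \<longlongrightarrow> 1 / z) (at_left 1)"
      by (simp add: one_ereal_def ereal_tendsto_simps)
  qed simp
  then show "(LINT x:{0<..<1}|lborel. complex_of_real x powr (z - 1)) = 1 / z"
    by (simp add: interval_lebesgue_integral_def e)
qed

text \<open>The sign is opposite to that on the unit interval. This is what makes the two halves of
  the Mellin integral combine into a difference of line integrals.\<close>

lemma LINT_powr_1_infinity: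
  assumes "Re z < 0"
  shows "set_integrable lborel {1<..} (\<lambda>x. complex_of_real x powr (z - 1))"
    and "(LINT x:{1<..}|lborel. complex_of_real x powr (z - 1)) = - 1 / z"
proof -
  have z: "z \<noteq> 0" using assms by auto
  have "set_integrable lborel {1<..} (\<lambda>x. x powr (Re z - 1))" by (rule set_integrable_powr_greaterThan_1) (use assms in auto)
  then have "integrable lborel (\<lambda>x. complex_of_real (indicator {1<..} x *\<^sub>R x powr (Re z - 1)))"
    unfolding set_integrable_def by (rule integrable_of_real)
  then have "set_integrable lborel {1<..} (\<lambda>x. complex_of_real (x powr (Re z - 1)))"
    unfolding set_integrable_def by (simp add: scaleR_conv_of_real)
  then have "set_integrable lborel {1<..} (\<lambda>x. 1 * complex_of_real x powr (z - 1))"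
    by (intro set_integrable_mult_complex_powr) auto
  then show int: "set_integrable lborel {1<..} (\<lambda>x. complex_of_real x powr (z - 1))" by simp
  have e: "einterval 1 \<infinity> = {1<..}" by (auto simp: einterval_def one_ereal_def)
  have "(LBINT x=1..\<infinity>. complex_of_real x powr (z - 1)) = 0 - 1 / z"
  proof (rule interval_integral_FTC_integrable[where F = "\<lambda>x. of_real x powr z / z"])
    show "set_integrable lborel (einterval 1 \<infinity>) (\<lambda>x. complex_of_real x powr (z - 1))" using int by (simp add: e)
    show "((\<lambda>x. of_real x powr z / z) has_vector_derivative of_real x powr (z - 1)) (at x)" if "1 < ereal x" for x
      using that z by (intro of_real_powr_divide_has_vector_derivative) (auto simp: one_ereal_def)
    show "isCont (\<lambda>x. complex_of_real x powr (z - 1)) x" if "1 < ereal x" for x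
      using that by (intro isCont_of_real_powr) (simp add: one_ereal_def)
    have "isCont (\<lambda>x. complex_of_real x powr z / z) 1"
      using z by (intro continuous_intros) auto
    then have "((\<lambda>x. complex_of_real x powr z / z) \<longlongrightarrow> of_real 1 powr z / z) (at_right 1)"
      unfolding isCont_def by (rule filterlim_mono) (auto simp: at_le)
    then show "(((\<lambda>x. complex_of_real x powr z / z) \<circ> real_of_ereal) \<longlongrightarrow> 1 / z) (at_right 1)"
      by (simp add: one_ereal_def ereal_tendsto_simps)
    have "((\<lambda>x. complex_of_real x powr z / z) \<longlongrightarrow> 0) at_top"
    proof (rule Lim_null_comparison)
      show "\<forall>\<^sub>F x in at_top. norm (complex_of_real x powr z / z) \<le> x powr Re z / norm z"
        using eventually_gt_at_top[of 0] by eventually_elim (simp add: norm_divide norm_powr_of_real_pos)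
      have "((\<lambda>x. x powr Re z) \<longlongrightarrow> 0) at_top" using assms by (intro tendsto_neg_powr filterlim_ident)
      then show "((\<lambda>x. x powr Re z / norm z) \<longlongrightarrow> 0) at_top" by (rule tendsto_divide_zero)
    qed
    then show "(((\<lambda>x. complex_of_real x powr z / z) \<circ> real_of_ereal) \<longlongrightarrow> 0) (at_left \<infinity>)"
      by (simp add: ereal_tendsto_simps)
  qed simp
  then show "(LINT x:{1<..}|lborel. complex_of_real x powr (z - 1)) = - 1 / z"
    by (simp add: interval_lebesgue_integral_def e)
qed

text \<open>\<open>a n\<close> is the coefficient of the integer \<open>Suc n\<close>. A growth
  exponent of \<open>Z\<close> below 2, set against the cubic decay of \<open>mellin f\<close>,
  leaves a decay exponent above 1 and thus absolutely convergent line integrals.\<close>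

locale dirichlet_mellin = smooth_decaying +
  fixes a :: "nat \<Rightarrow> real" and Z :: "complex \<Rightarrow> complex"
  assumes a_nonneg: "\<And>n. 0 \<le> a n"
    and a_summable: "\<And>\<sigma>. 1 < \<sigma> \<Longrightarrow> summable (\<lambda>n. a n * real (Suc n) powr (-\<sigma>))"
    and Z_sums: "\<And>s. 1 < Re s \<Longrightarrow> (\<lambda>n. of_real (a n) * of_nat (Suc n) powr (-s)) sums Z s"
    and Z_holomorphic: "Z holomorphic_on {s. 1/2 < Re s} - {1}"
    and Z_bound: "\<And>\<sigma>. 1/2 < \<sigma> \<Longrightarrow> \<sigma> < 1 \<Longrightarrow>
        \<exists>K \<beta>. \<beta> < 2 \<and> (\<forall>s. \<sigma> \<le> Re s \<longrightarrow> 1 \<le> \<bar>Im s\<bar> \<longrightarrow> norm (Z s) \<le> K * \<bar>Im s\<bar> powr \<beta>)"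
begin

definition \<Psi> :: "complex \<Rightarrow> complex" where "\<Psi> w = Z w * mellin f w"

definition G :: "real \<Rightarrow> complex" where
  "G x = (\<Sum>n. of_real (a n) * f (real (Suc n) * x)) - residue (\<lambda>w. \<Psi> w * of_real x powr (- w)) 1"

lemma \<Psi>_holomorphic: "\<Psi> holomorphic_on {s. 1/2 < Re s \<and> Re s < \<alpha>} - {1}"
  unfolding \<Psi>_def[abs_def]
  by (intro holomorphic_on_mult holomorphic_on_subset[OF Z_holomorphic] holomorphic_on_subset[OF holomorphic_mellin]) auto

lemma \<Psi>_bound:
  assumes "1/2 < \<sigma>" "\<sigma> < 1" "\<sigma> \<le> b" "b < \<alpha>"
  obtains K \<beta> where "0 \<le> K" "1 < \<beta>" "\<And>w. \<sigma> \<le> Re w \<Longrightarrow> Re w \<le> b \<Longrightarrow> 1 \<le> \<bar>Im w\<bar> \<Longrightarrow> norm (\<Psi> w) \<le> K * \<bar>Im w\<bar> powr (-\<beta>)"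
proof -
  obtain K1 \<beta> where 1: "\<beta> < 2" "\<And>s. \<sigma> \<le> Re s \<Longrightarrow> 1 \<le> \<bar>Im s\<bar> \<Longrightarrow> norm (Z s) \<le> K1 * \<bar>Im s\<bar> powr \<beta>"
    using Z_bound[OF assms(1,2)] by auto
  obtain K2 where 2: "K2 \<ge> 0" "\<And>s. \<sigma> \<le> Re s \<Longrightarrow> Re s \<le> b \<Longrightarrow> Im s \<noteq> 0 \<Longrightarrow> norm (mellin f s) \<le> K2 / \<bar>Im s\<bar> ^ 3"
    using mellin_bound[of \<sigma> b] assms by auto
  show thesis
  proof
    show "0 \<le> \<bar>K1\<bar> * K2" using 2 by simp
    show "1 < 3 - \<beta>" using 1 by simp
    fix w assume w: "\<sigma> \<le> Re w" "Re w \<le> b" "1 \<le> \<bar>Im w\<bar>"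
    then have w0: "Im w \<noteq> 0" by auto
    have "norm (Z w) \<le> \<bar>K1\<bar> * \<bar>Im w\<bar> powr \<beta>"
      using 1(2)[OF w(1,3)] by (rule order_trans) (intro mult_right_mono, auto)
    then have "norm (\<Psi> w) \<le> (\<bar>K1\<bar> * \<bar>Im w\<bar> powr \<beta>) * (K2 / \<bar>Im w\<bar> ^ 3)"
      unfolding \<Psi>_def norm_mult using 2(2)[OF w(1,2) w0] by (intro mult_mono) auto
    also have "\<dots> = \<bar>K1\<bar> * K2 * (\<bar>Im w\<bar> powr \<beta> / \<bar>Im w\<bar> ^ 3)" by simp
    also have "\<bar>Im w\<bar> powr \<beta> / \<bar>Im w\<bar> ^ 3 = \<bar>Im w\<bar> powr (- (3 - \<beta>))"
      using w0 by (simp add: powr_diff powr_numeral)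
    finally show "norm (\<Psi> w) \<le> \<bar>K1\<bar> * K2 * \<bar>Im w\<bar> powr (- (3 - \<beta>))" .
  qed
qed

lemma \<Psi>_line_continuous:
  assumes "1/2 < c" "c < \<alpha>" "c \<noteq> 1"
  shows "continuous_on UNIV (\<lambda>t. \<Psi> (Complex c t))"
proof -
  have "continuous_on {s. Re s = c} \<Psi>"
    using assms by (intro holomorphic_on_imp_continuous_on holomorphic_on_subset[OF \<Psi>_holomorphic]) auto
  then show ?thesis
    by (rule continuous_on_vertical_line)
qed

lemma \<Psi>_line_integrable:
  assumes c: "1/2 < c" "c < \<alpha>" "c \<noteq> 1"
  shows "integrable lborel (\<lambda>t. \<Psi> (Complex c t))"
proof -
  \<comment> \<open>The bound for \<open>\<Psi>\<close> starts from an abscissa between 1/2 and 1;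
    3/4 supplies one when the line lies to the right of 1.\<close>
  have h: "1/2 < min c (3/4)" "min c (3/4) < 1" "min c (3/4) \<le> c" using c by auto
  obtain K \<beta> where K: "0 \<le> K" "1 < \<beta>" "\<And>w. min c (3/4) \<le> Re w \<Longrightarrow> Re w \<le> c \<Longrightarrow> 1 \<le> \<bar>Im w\<bar> \<Longrightarrow> norm (\<Psi> w) \<le> K * \<bar>Im w\<bar> powr (-\<beta>)"
    by (rule \<Psi>_bound[OF h c(2)]) (rule that)
  show ?thesis
  proof (rule integrable_line_powr_decay[OF \<Psi>_line_continuous[OF c] K(2)])
    fix t :: real assume "1 \<le> \<bar>t\<bar>"
    then show "norm (\<Psi> (Complex c t)) \<le> K * \<bar>t\<bar> powr (-\<beta>)" using K(3)[of "Complex c t"] by simp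
  qed
qed

lemma integrable_line_mult_powr:
  assumes "integrable lborel (\<lambda>t. \<phi> (Complex c t))" "0 < x"
  shows "integrable lborel (\<lambda>t. \<phi> (Complex c t) * complex_of_real x powr (- Complex c t))"
proof (rule Bochner_Integration.integrable_bound)
  show "integrable lborel (\<lambda>t. of_real (x powr (-c)) * \<phi> (Complex c t))" using assms(1) by (rule integrable_mult_right)
  have "(\<lambda>t. complex_of_real x powr (- Complex c t)) \<in> borel_measurable borel"
    using assms(2) by (intro borel_measurable_continuous_onI) (auto simp: Complex_eq intro!: continuous_intros)
  then show "(\<lambda>t. \<phi> (Complex c t) * complex_of_real x powr (- Complex c t)) \<in> borel_measurable lborel"
    using borel_measurable_integrable[OF assms(1)] by measurable
  show "AE t in lborel. norm (\<phi> (Complex c t) * complex_of_real x powr (- Complex c t)) \<le> norm (of_real (x powr (-c)) * \<phi> (Complex c t))"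
    using assms(2) by (intro AE_I2) (simp add: norm_mult norm_powr_of_real_pos mult.commute)
qed

lemma mellin_line_integrable:
  assumes "0 < c" "c < \<alpha>"
  shows "integrable lborel (\<lambda>t. mellin f (Complex c t))"
proof -
  obtain K where K: "K \<ge> 0" "\<And>s. c \<le> Re s \<Longrightarrow> Re s \<le> c \<Longrightarrow> Im s \<noteq> 0 \<Longrightarrow> norm (mellin f s) \<le> K / \<bar>Im s\<bar> ^ 3"
    using mellin_bound[of c c] assms by auto
  have "continuous_on {s. Re s = c} (mellin f)"
    using assms by (intro holomorphic_on_imp_continuous_on holomorphic_on_subset[OF holomorphic_mellin]) auto
  then have cont: "continuous_on UNIV (\<lambda>t. mellin f (Complex c t))"
    by (rule continuous_on_vertical_line)
  show ?thesis
  proof (rule integrable_line_powr_decay[OF cont])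
    show "(1::real) < 3" by simp
    fix t :: real assume t: "1 \<le> \<bar>t\<bar>"
    then have "norm (mellin f (Complex c t)) \<le> K / \<bar>t\<bar> ^ 3" using K(2)[of "Complex c t"] by auto
    also have "\<dots> = K * \<bar>t\<bar> powr (-3)" using t by (simp add: powr_minus_divide powr_numeral)
    finally show "norm (mellin f (Complex c t)) \<le> K * \<bar>t\<bar> powr (-3)" .
  qed
qed

text \<open>Mellin inversion term by term. Sum and integral may be exchanged because the norm of the
  n-th term splits into \<open>a n * real (Suc n) powr (-c)\<close>, summable as
  \<open>c > 1\<close>, and an integrable function of \<open>t\<close> free of
  \<open>n\<close>.\<close>

lemma dirichlet_sum_eq_line_integral:
  assumes x: "0 < x" and c: "1 < c" "c < \<alpha>"
  shows "2 * pi * (\<Sum>n. of_real (a n) * f (real (Suc n) * x)) = (LINT t|lborel. \<Psi> (Complex c t) * of_real x powr (- Complex c t))"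
proof -
  define g where "g = (\<lambda>n t. of_real (a n) * (mellin f (Complex c t) * of_real (real (Suc n) * x) powr (- Complex c t)))"
  have xn: "0 < real (Suc n) * x" for n using x by simp
  have mi: "integrable lborel (\<lambda>t. mellin f (Complex c t))" using c by (intro mellin_line_integrable) auto
  have gi: "integrable lborel (g n)" for n
    unfolding g_def by (intro integrable_mult_right integrable_line_mult_powr mi xn)
  have ng: "norm (g n t) = (a n * real (Suc n) powr (-c)) * (x powr (-c) * norm (mellin f (Complex c t)))" for n t
  proof -
    have "norm (complex_of_real (real (Suc n) * x) powr (- Complex c t)) = real (Suc n) powr (-c) * x powr (-c)"
      unfolding norm_powr_of_real_pos[OF xn] using x by (simp add: powr_mult del: of_nat_Suc)
    then show ?thesis unfolding g_def norm_mult using a_nonneg[of n] by (simp del: of_nat_Suc)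
  qed
  have "(\<lambda>n. integral\<^sup>L lborel (g n)) sums (LINT t|lborel. (\<Sum>n. g n t))"
  proof (rule sums_integral)
    show "AE t in lborel. summable (\<lambda>n. norm (g n t))"
      unfolding ng by (intro AE_I2 summable_mult2 a_summable c)
    show "summable (\<lambda>n. LINT t|lborel. norm (g n t))"
      unfolding ng integral_mult_right_zero by (intro summable_mult2 a_summable c)
  qed (rule gi)
  moreover have "integral\<^sup>L lborel (g n) = 2 * pi * (of_real (a n) * f (real (Suc n) * x))" for n
    unfolding g_def using mellin_inversion[OF xn, of c n] c by simp
  moreover have "(\<Sum>n. g n t) = \<Psi> (Complex c t) * of_real x powr (- Complex c t)" for t
  proof -
    have "(\<lambda>n. (of_real (a n) * of_nat (Suc n) powr (- Complex c t)) * (mellin f (Complex c t) * of_real x powr (- Complex c t)))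
       sums (Z (Complex c t) * (mellin f (Complex c t) * of_real x powr (- Complex c t)))"
      using c by (intro sums_mult2 Z_sums) auto
    also have "(\<lambda>n. (of_real (a n) * of_nat (Suc n) powr (- Complex c t)) * (mellin f (Complex c t) * of_real x powr (- Complex c t))) = (\<lambda>n. g n t)"
    proof
      fix n
      have "complex_of_real (real (Suc n) * x) powr (- Complex c t) = of_nat (Suc n) powr (- Complex c t) * of_real x powr (- Complex c t)"
        using x powr_times_real[of "of_nat (Suc n)" "of_real x" "- Complex c t"] by (simp del: of_nat_Suc)
      then show "(of_real (a n) * of_nat (Suc n) powr (- Complex c t)) * (mellin f (Complex c t) * of_real x powr (- Complex c t)) = g n t"
        by (simp only: g_def mult_ac)
    qed
    finally show ?thesis by (simp add: \<Psi>_def sums_iff mult.assoc)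
  qed
  ultimately have "(\<lambda>n. 2 * pi * (of_real (a n) * f (real (Suc n) * x))) sums (LINT t|lborel. \<Psi> (Complex c t) * of_real x powr (- Complex c t))"
    by simp
  from sums_mult[OF this, of "1 / (2 * pi)"]
  have "(\<lambda>n. of_real (a n) * f (real (Suc n) * x)) sums ((LINT t|lborel. \<Psi> (Complex c t) * of_real x powr (- Complex c t)) / (2 * pi))"
    by simp
  then show ?thesis by (simp add: sums_iff)
qed

text \<open>The left-hand side is free of \<open>\<sigma>\<close>: between 1/2 and 1 the line may be
  chosen at will, even differently for different \<open>x\<close>, and \<open>G_mellin\<close>
  exploits this.\<close>

lemma G_eq_line_integral:
  assumes x: "0 < x" and \<sigma>: "1/2 < \<sigma>" "\<sigma> < 1"
  shows "2 * pi * G x = (LINT t|lborel. \<Psi> (Complex \<sigma> t) * of_real x powr (- Complex \<sigma> t))"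
proof -
  define c where "c = (1 + \<alpha>) / 2"
  have c: "1 < c" "c < \<alpha>" using alpha by (auto simp: c_def)
  define \<Theta> where "\<Theta> = (\<lambda>w. \<Psi> w * complex_of_real x powr (- w))"
  obtain K \<beta> where K: "0 \<le> K" "1 < \<beta>" "\<And>w. \<sigma> \<le> Re w \<Longrightarrow> Re w \<le> c \<Longrightarrow> 1 \<le> \<bar>Im w\<bar> \<Longrightarrow> norm (\<Psi> w) \<le> K * \<bar>Im w\<bar> powr (-\<beta>)"
    using \<Psi>_bound[of \<sigma> c] \<sigma> c by auto
  define M where "M = x powr (-c) + x powr (-\<sigma>)"
  have "(LINT t|lborel. \<Theta> (Complex c t)) - (LINT t|lborel. \<Theta> (Complex \<sigma> t)) = 2 * pi * (\<Sum>p\<in>{1}. residue \<Theta> p)"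
  proof (rule strip_residue_theorem[where l = "1/2" and r = \<alpha> and Y = 1 and B = "\<lambda>T. (K * M) * T powr (-\<beta>)"])
    show "\<Theta> holomorphic_on {s. 1/2 < Re s \<and> Re s < \<alpha>} - {1}"
      unfolding \<Theta>_def using x by (intro holomorphic_intros \<Psi>_holomorphic) auto
    show "((\<lambda>T. (K * M) * T powr (-\<beta>)) \<longlongrightarrow> 0) at_top"
      using K(2) by (intro tendsto_mult_right_zero tendsto_neg_powr filterlim_ident) auto
    show "integrable lborel (\<lambda>t. \<Theta> (Complex \<sigma> t))" "integrable lborel (\<lambda>t. \<Theta> (Complex c t))"
      unfolding \<Theta>_def using \<sigma> c alpha x by (auto intro!: integrable_line_mult_powr \<Psi>_line_integrable)
    fix w assume w: "\<sigma> \<le> Re w" "Re w \<le> c" "1 \<le> \<bar>Im w\<bar>"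
    have "x powr (- Re w) \<le> M"
      unfolding M_def by (rule powr_le_powr_add_powr) (use x w in auto)
    then have "norm (\<Theta> w) \<le> (K * \<bar>Im w\<bar> powr (-\<beta>)) * M"
      unfolding \<Theta>_def norm_mult norm_powr_of_real_pos[OF x] using K w by (intro mult_mono) auto
    then show "norm (\<Theta> w) \<le> (K * M) * \<bar>Im w\<bar> powr (-\<beta>)" by (simp only: mult_ac)
  qed (use \<sigma> c in auto)
  moreover have "(LINT t|lborel. \<Theta> (Complex c t)) = 2 * pi * (\<Sum>n. of_real (a n) * f (real (Suc n) * x))"
    unfolding \<Theta>_def using dirichlet_sum_eq_line_integral[OF x c] by simp
  ultimately have "2 * pi * (\<Sum>n. of_real (a n) * f (real (Suc n) * x)) - (LINT t|lborel. \<Theta> (Complex \<sigma> t)) = 2 * pi * residue \<Theta> 1" by simp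
  moreover have "2 * pi * G x = 2 * pi * (\<Sum>n. of_real (a n) * f (real (Suc n) * x)) - 2 * pi * residue \<Theta> 1"
    by (simp only: G_def \<Theta>_def right_diff_distrib)
  ultimately have "2 * pi * G x = (LINT t|lborel. \<Theta> (Complex \<sigma> t))" by (simp add: algebra_simps)
  then show ?thesis unfolding \<Theta>_def .
qed

text \<open>Serves both pieces of the half-line. Fubini moves the integral over \<open>S\<close>
  inside the line integral, where it acts on the pure power \<open>x powr (s - w - 1)\<close> and
  yields the explicit kernel \<open>k\<close>.\<close>

lemma G_mellin_part:
  assumes S: "S \<in> sets borel" "S \<subseteq> {0<..}" and \<sigma>: "1/2 < \<sigma>" "\<sigma> < 1"
    and int: "\<And>t. set_integrable lborel S (\<lambda>x. complex_of_real x powr (s - Complex \<sigma> t - 1))"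
    and val: "\<And>t. (LINT x:S|lborel. complex_of_real x powr (s - Complex \<sigma> t - 1)) = k t"
  shows "((\<lambda>x. G x * of_real x powr (s - 1)) has_integral (1 / (2 * pi)) * (LINT t|lborel. \<Psi> (Complex \<sigma> t) * k t)) S"
proof -
  have xS: "0 < x" if "x \<in> S" for x using that S(2) by auto
  have split: "of_real x powr (s - 1) * of_real x powr (- Complex \<sigma> t) = complex_of_real x powr (s - Complex \<sigma> t - 1)" if "x \<in> S" for x t
    using xS[OF that] by (simp add: powr_add[symmetric] algebra_simps)
  \<comment> \<open>At height \<open>t = 0\<close> the exponent of the line is the real number
    \<open>\<sigma>\<close>, so this instance of \<open>int\<close> is the integrability that
    \<open>Fubini_powr\<close> asks for.\<close>
  have h: "set_integrable lborel S (\<lambda>x. of_real x powr (s - 1) * of_real (x powr (-\<sigma>)))"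
  proof -
    have "of_real x powr (s - 1) * of_real (x powr (-\<sigma>)) = complex_of_real x powr (s - Complex \<sigma> 0 - 1)" if "x \<in> S" for x
      using split[OF that, of 0] xS[OF that] by (simp add: powr_of_real[symmetric] Complex_eq)
    then show ?thesis using int[of 0] by (simp cong: set_integrable_cong)
  qed
  have em: "(\<lambda>t. - Complex \<sigma> t) \<in> borel_measurable borel"
    unfolding Complex_eq by (intro borel_measurable_continuous_onI continuous_intros)
  have re: "Re (- Complex \<sigma> t) = -\<sigma>" for t by simp
  have \<Psi>i: "integrable lborel (\<lambda>t. \<Psi> (Complex \<sigma> t))" using \<sigma> alpha by (intro \<Psi>_line_integrable) auto
  note fub = Fubini_powr[OF \<Psi>i S h em re]
  have inner: "(LINT x:S|lborel. of_real x powr (s - 1) * of_real x powr (- Complex \<sigma> t)) = k t" for t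
    unfolding val[symmetric] by (rule set_lebesgue_integral_cong) (use S split in auto)
  have outer: "of_real x powr (s - 1) * (LINT t|lborel. \<Psi> (Complex \<sigma> t) * of_real x powr (- Complex \<sigma> t)) = (2 * pi) * (G x * of_real x powr (s - 1))" if "x \<in> S" for x
    unfolding G_eq_line_integral[OF xS[OF that] \<sigma>, symmetric] by simp
  have i: "set_integrable lborel S (\<lambda>x. (2 * pi) * (G x * of_real x powr (s - 1)))"
    using fub(2) by (simp cong: set_integrable_cong add: outer)
  have v: "(LINT x:S|lborel. (2 * pi) * (G x * of_real x powr (s - 1))) = (LINT t|lborel. \<Psi> (Complex \<sigma> t) * k t)"
  proof -
    have "(LINT x:S|lborel. (2 * pi) * (G x * of_real x powr (s - 1))) = (LINT x:S|lborel. of_real x powr (s - 1) * (LINT t|lborel. \<Psi> (Complex \<sigma> t) * of_real x powr (- Complex \<sigma> t)))"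
    proof (rule set_lebesgue_integral_cong)
      show "S \<in> sets lborel" using S by simp
    qed (use outer[symmetric] in blast)
    then show ?thesis using fub(1) unfolding inner by (simp only:)
  qed
  have "((\<lambda>x. (2 * pi) * (G x * of_real x powr (s - 1))) has_integral (LINT t|lborel. \<Psi> (Complex \<sigma> t) * k t)) S"
    using set_borel_integral_eq_integral[OF i] unfolding v by (simp add: has_integral_iff)
  from has_integral_mult_right[OF this, of "1 / (2 * pi)"] show ?thesis by simp
qed

text \<open>No single line serves all \<open>x\<close>: integrating
  \<open>x powr (s - w - 1)\<close> near 0 requires \<open>Re w < Re s\<close>, near infinity
  \<open>Re w > Re s\<close>.\<close>

lemma G_mellin:
  assumes s: "1/2 < Re s" "Re s < 1"
  shows "((\<lambda>x. G x * of_real x powr (s - 1)) has_integral \<Psi> s) {0<..}"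
proof -
  define \<sigma>1 where "\<sigma>1 = (1/2 + Re s) / 2"
  define \<sigma>2 where "\<sigma>2 = (1 + Re s) / 2"
  have \<sigma>: "1/2 < \<sigma>1" "\<sigma>1 < Re s" "Re s < \<sigma>2" "\<sigma>2 < 1" using s by (auto simp: \<sigma>1_def \<sigma>2_def)
  define \<Theta> where "\<Theta> = (\<lambda>w. \<Psi> w / (w - s))"
  obtain K \<beta> where K: "0 \<le> K" "1 < \<beta>" "\<And>w. \<sigma>1 \<le> Re w \<Longrightarrow> Re w \<le> \<sigma>2 \<Longrightarrow> 1 \<le> \<bar>Im w\<bar> \<Longrightarrow> norm (\<Psi> w) \<le> K * \<bar>Im w\<bar> powr (-\<beta>)"
    using \<Psi>_bound[of \<sigma>1 \<sigma>2] \<sigma> alpha by auto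
  have \<Psi>hol: "\<Psi> holomorphic_on {w. 1/2 < Re w \<and> Re w < 1}"
    using alpha by (intro holomorphic_on_subset[OF \<Psi>_holomorphic]) auto
  have \<Theta>i: "integrable lborel (\<lambda>t. \<Theta> (Complex c t))" if c: "1/2 < c" "c < 1" "c \<noteq> Re s" for c
  proof (rule Bochner_Integration.integrable_bound)
    have \<Psi>i: "integrable lborel (\<lambda>t. \<Psi> (Complex c t))" using c alpha by (intro \<Psi>_line_integrable) auto
    show "integrable lborel (\<lambda>t. of_real (1 / \<bar>c - Re s\<bar>) * \<Psi> (Complex c t))" by (rule integrable_mult_right[OF \<Psi>i])
    have nz: "Complex c t - s \<noteq> 0" for t using c(3) by (auto simp: complex_eq_iff)
    have "(\<lambda>t. 1 / (Complex c t - s)) \<in> borel_measurable borel"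
      using nz by (intro borel_measurable_continuous_onI) (auto simp: Complex_eq intro!: continuous_intros)
    then have "(\<lambda>t. \<Psi> (Complex c t) * (1 / (Complex c t - s))) \<in> borel_measurable lborel"
      using borel_measurable_integrable[OF \<Psi>i] by measurable
    then show "(\<lambda>t. \<Theta> (Complex c t)) \<in> borel_measurable lborel" by (simp add: \<Theta>_def)
    have "norm (\<Theta> (Complex c t)) \<le> norm (of_real (1 / \<bar>c - Re s\<bar>) * \<Psi> (Complex c t))" for t
    proof -
      have "\<bar>c - Re s\<bar> \<le> norm (Complex c t - s)" using abs_Re_le_cmod[of "Complex c t - s"] by simp
      then have "norm (\<Psi> (Complex c t)) / norm (Complex c t - s) \<le> norm (\<Psi> (Complex c t)) / \<bar>c - Re s\<bar>"
        using c(3) nz by (intro divide_left_mono mult_pos_pos) auto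
      then show ?thesis by (simp add: \<Theta>_def norm_divide norm_mult)
    qed
    then show "AE t in lborel. norm (\<Theta> (Complex c t)) \<le> norm (of_real (1 / \<bar>c - Re s\<bar>) * \<Psi> (Complex c t))" by (intro AE_I2)
  qed
  have "(LINT t|lborel. \<Theta> (Complex \<sigma>2 t)) - (LINT t|lborel. \<Theta> (Complex \<sigma>1 t)) = 2 * pi * (\<Sum>p\<in>{s}. residue \<Theta> p)"
  \<comment> \<open>\<open>Y = 1 + |Im s|\<close> guarantees \<open>norm (w - s) >= 1\<close> on the
    horizontal sides, so the bound for \<open>\<Psi>\<close> carries over to \<open>\<Theta>\<close>
    unchanged.\<close>
  proof (rule strip_residue_theorem[where l = "1/2" and r = 1 and Y = "1 + \<bar>Im s\<bar>" and B = "\<lambda>T. K * T powr (-\<beta>)"])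
    show "\<Theta> holomorphic_on {w. 1/2 < Re w \<and> Re w < 1} - {s}"
      unfolding \<Theta>_def by (intro holomorphic_intros holomorphic_on_subset[OF \<Psi>hol]) auto
    show "((\<lambda>T. K * T powr (-\<beta>)) \<longlongrightarrow> 0) at_top"
      using K(2) by (intro tendsto_mult_right_zero tendsto_neg_powr filterlim_ident) auto
    show "integrable lborel (\<lambda>t. \<Theta> (Complex \<sigma>1 t))" "integrable lborel (\<lambda>t. \<Theta> (Complex \<sigma>2 t))"
      using \<sigma> s by (auto intro!: \<Theta>i)
    fix w assume w: "\<sigma>1 \<le> Re w" "Re w \<le> \<sigma>2" "1 + \<bar>Im s\<bar> \<le> \<bar>Im w\<bar>"
    have "1 \<le> \<bar>Im (w - s)\<bar>" using w(3) by simp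
    then have n1: "1 \<le> norm (w - s)" using abs_Im_le_cmod[of "w - s"] by linarith
    have "norm (\<Theta> w) \<le> norm (\<Psi> w) / 1"
      unfolding \<Theta>_def norm_divide using n1 by (intro divide_left_mono) auto
    also have "\<dots> \<le> K * \<bar>Im w\<bar> powr (-\<beta>)" using K(3)[of w] w by simp
    finally show "norm (\<Theta> w) \<le> K * \<bar>Im w\<bar> powr (-\<beta>)" .
  qed (use \<sigma> s in auto)
  moreover have "residue \<Theta> s = \<Psi> s"
  proof -
    have "{w. 1/2 < Re w \<and> Re w < 1} = {w. 1/2 < Re w} \<inter> {w. Re w < 1}" by auto
    then have "open {w. 1/2 < Re w \<and> Re w < 1}" using open_halfspace_Re_gt open_halfspace_Re_lt by (metis open_Int)
    then show ?thesis unfolding \<Theta>_def by (rule residue_simple) (use s \<Psi>hol in auto)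
  qed
  ultimately have cauchy: "(LINT t|lborel. \<Theta> (Complex \<sigma>2 t)) - (LINT t|lborel. \<Theta> (Complex \<sigma>1 t)) = 2 * pi * \<Psi> s" by simp
  have p1: "((\<lambda>x. G x * of_real x powr (s - 1)) has_integral (1 / (2 * pi)) * (LINT t|lborel. \<Psi> (Complex \<sigma>1 t) * (1 / (s - Complex \<sigma>1 t)))) {0<..<1}"
  proof (rule G_mellin_part)
    have z: "0 < Re (s - Complex \<sigma>1 t)" for t using \<sigma> by simp
    show "set_integrable lborel {0<..<1} (\<lambda>x. complex_of_real x powr (s - Complex \<sigma>1 t - 1))"
      "(LINT x:{0<..<1}|lborel. complex_of_real x powr (s - Complex \<sigma>1 t - 1)) = 1 / (s - Complex \<sigma>1 t)" for t
      by (rule LINT_powr_unit_interval[OF z])+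
  qed (use \<sigma> in auto)
  have p2: "((\<lambda>x. G x * of_real x powr (s - 1)) has_integral (1 / (2 * pi)) * (LINT t|lborel. \<Psi> (Complex \<sigma>2 t) * (- 1 / (s - Complex \<sigma>2 t)))) {1<..}"
  proof (rule G_mellin_part)
    have z: "Re (s - Complex \<sigma>2 t) < 0" for t using \<sigma> by simp
    show "set_integrable lborel {1<..} (\<lambda>x. complex_of_real x powr (s - Complex \<sigma>2 t - 1))"
      "(LINT x:{1<..}|lborel. complex_of_real x powr (s - Complex \<sigma>2 t - 1)) = - 1 / (s - Complex \<sigma>2 t)" for t
      by (rule LINT_powr_1_infinity[OF z])+
  qed (use \<sigma> in auto)
  have e1: "\<Psi> w * (1 / (s - w)) = - \<Theta> w" for w
    unfolding \<Theta>_def by (metis minus_diff_eq minus_divide_right mult.right_neutral times_divide_eq_right)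
  have e2: "\<Psi> w * (- 1 / (s - w)) = \<Theta> w" for w
    using e1[of w] by simp
  have "((\<lambda>x. G x * of_real x powr (s - 1)) has_integral (1 / (2 * pi)) * (LINT t|lborel. - \<Theta> (Complex \<sigma>1 t)) + (1 / (2 * pi)) * (LINT t|lborel. \<Theta> (Complex \<sigma>2 t))) ({0<..<1} \<union> {1<..})"
    using p1 p2 unfolding e1 e2
  proof (rule has_integral_Un)
    have "{0<..<1} \<inter> {1::real<..} = {}" by auto
    then show "negligible ({0<..<1} \<inter> {1::real<..})" by simp
  qed
  moreover have "(1 / (2 * pi)) * (LINT t|lborel. - \<Theta> (Complex \<sigma>1 t)) + (1 / (2 * pi)) * (LINT t|lborel. \<Theta> (Complex \<sigma>2 t)) = \<Psi> s"
  proof -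
    have "(1 / (2 * pi)) * (LINT t|lborel. - \<Theta> (Complex \<sigma>1 t)) + (1 / (2 * pi)) * (LINT t|lborel. \<Theta> (Complex \<sigma>2 t)) = (1 / (2 * pi)) * ((LINT t|lborel. \<Theta> (Complex \<sigma>2 t)) - (LINT t|lborel. \<Theta> (Complex \<sigma>1 t)))"
      by (simp add: algebra_simps)
    also have "\<dots> = \<Psi> s" unfolding cauchy by simp
    finally show ?thesis .
  qed
  \<comment> \<open>The two pieces miss only the point 1, which is negligible.\<close>
  ultimately have int: "((\<lambda>x. G x * of_real x powr (s - 1)) has_integral \<Psi> s) ({0<..<1} \<union> {1<..})" by simp
  have n1: "negligible {x \<in> ({0<..<1} \<union> {1<..}) - {0<..}. G x * of_real x powr (s - 1) \<noteq> 0}"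
    by (rule negligible_subset[of "{1}"]) auto
  have n2: "negligible {x \<in> {0<..} - ({0<..<1} \<union> {1<..}). G x * of_real x powr (s - 1) \<noteq> 0}"
    by (rule negligible_subset[of "{1}"]) auto
  show ?thesis by (rule iffD1[OF has_integral_spike_set_eq[OF n1 n2] int])
qed

end

text \<open>The class controls the derivatives only from some \<open>X\<close> on. Compactness
  bounds them on the initial interval, and enlarging the constant makes one decay bound valid for
  all positive \<open>x\<close>, where the derivatives relative to the half-line are also
  two-sided.\<close>

lemma M_class_smooth_decaying:
  assumes M: "M_class \<alpha> m f" and "\<alpha> > 1" "m \<ge> 3"
  obtains C f1 f2 f3 where "smooth_decaying \<alpha> C f f1 f2 f3"
proof -
  obtain D where D: "D 0 = f" "\<forall>j<m. \<forall>x\<ge>0. (D j has_vector_derivative D (Suc j) x) (at x within {0..})"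
     "\<forall>j\<le>m. continuous_on {0..} (D j)" "\<forall>j\<le>m. \<exists>C X. \<forall>x\<ge>X. norm (D j x) \<le> C * x powr (- \<alpha> - real j)"
    using M unfolding M_class_def by blast
  have "\<exists>C. \<forall>x>0. norm (D j x) \<le> C \<and> norm (D j x) \<le> C * x powr (- (\<alpha> + real j))" if j: "j \<le> m" for j
  proof -
    obtain C X where CX: "\<And>x. x \<ge> X \<Longrightarrow> norm (D j x) \<le> C * x powr (- \<alpha> - real j)" using D(4) j by blast
    define Y where "Y = max 1 X"
    have Y: "Y \<ge> 1" "Y \<ge> X" by (auto simp: Y_def)
    have "continuous_on {0..} (D j)" using D(3) j by blast
    then have "continuous_on {0..Y} (D j)" by (rule continuous_on_subset) auto
    then have "compact (D j ` {0..Y})" by (rule compact_continuous_image) simp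
    then have "bounded (D j ` {0..Y})" by (rule compact_imp_bounded)
    then obtain B where "\<forall>y\<in>D j ` {0..Y}. norm y \<le> B" unfolding bounded_iff ..
    then have B: "norm (D j x) \<le> B" if "x \<in> {0..Y}" for x using that by blast
    have B0: "B \<ge> 0" using B[of 0] Y norm_ge_zero[of "D j 0"] by (simp del: norm_ge_zero)
    define e where "e = \<alpha> + real j"
    have e: "e > 0" using assms by (simp add: e_def)
    \<comment> \<open>For \<open>x <= Y\<close> the product \<open>Y powr e * x powr (-e)\<close> is
      at least 1, so the factor \<open>Y powr e\<close> lifts the compact bound \<open>B\<close> to
      a decay bound.\<close>
    define M where "M = \<bar>C\<bar> + B * Y powr e"
    have YM: "Y powr e \<ge> 1" using Y e by (intro ge_one_powr_ge_zero) auto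
    have "norm (D j x) \<le> M \<and> norm (D j x) \<le> M * x powr (-e)" if x: "0 < x" for x
    proof (cases "x \<le> Y")
      case True
      have "norm (D j x) \<le> B" using B x True by auto
      moreover have "B \<le> B * Y powr e" using B0 YM by (simp add: mult_le_cancel_left1)
      moreover have "B \<le> (B * Y powr e) * x powr (-e)"
      proof -
        have "1 = x powr e * x powr (-e)" using x by (simp add: powr_add[symmetric])
        also have "\<dots> \<le> Y powr e * x powr (-e)" using True x e by (intro mult_right_mono powr_mono2) auto
        finally have "B * 1 \<le> B * (Y powr e * x powr (-e))" using B0 by (intro mult_left_mono) auto
        then show ?thesis by (simp add: mult.assoc)
      qed
      moreover have "(B * Y powr e) * x powr (-e) \<le> M * x powr (-e)" unfolding M_def by (intro mult_right_mono) auto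
      moreover have "B * Y powr e \<le> M" by (simp add: M_def)
      ultimately show ?thesis by linarith
    next
      case False
      have "norm (D j x) \<le> C * x powr (-e)" using CX[of x] False Y by (simp add: e_def)
      also have "\<dots> \<le> M * x powr (-e)"
      proof (rule mult_right_mono)
        have "0 \<le> B * Y powr e" using B0 by simp
        then show "C \<le> M" unfolding M_def using abs_ge_self[of C] by linarith
      qed simp
      finally have 1: "norm (D j x) \<le> M * x powr (-e)" .
      have "M * x powr (-e) \<le> M * 1"
      proof (intro mult_left_mono)
        have "x powr (-e) \<le> x powr 0" using False Y e by (intro powr_mono) auto
        then show "x powr (-e) \<le> 1" using x by simp
        show "M \<ge> 0" using B0 by (simp add: M_def)
      qed
      then show ?thesis using 1 by simp
    qed
    then show ?thesis unfolding e_def by blast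
  qed
  then obtain C where C: "\<And>j x. j \<le> m \<Longrightarrow> x > 0 \<Longrightarrow> norm (D j x) \<le> C j" "\<And>j x. j \<le> m \<Longrightarrow> x > 0 \<Longrightarrow> norm (D j x) \<le> C j * x powr (- (\<alpha> + real j))"
    by metis
  define C0 where "C0 = \<bar>C 0\<bar> + \<bar>C 1\<bar> + \<bar>C 2\<bar> + \<bar>C 3\<bar>"
  \<comment> \<open>Boundedness and decay together bound the derivative by the minimum of 1 and the
    fastest power, which lies below \<open>x powr (-\<rho>)\<close> for every admissible
    \<open>\<rho>\<close>.\<close>
  have bd: "norm (D j x) \<le> C0 * x powr (-\<rho>)" if "j \<in> {0,1,2,3}" "x > 0" "0 \<le> \<rho>" "\<rho> \<le> \<alpha> + real j" for j x \<rho>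
  proof -
    have j: "j \<le> m" using that assms by auto
    have C0: "C j \<le> C0" "0 \<le> C0" using that by (auto simp: C0_def)
    have "min 1 (x powr (- (\<alpha> + real j))) \<le> x powr (-\<rho>)"
    proof (cases "x \<ge> 1")
      case True
      then have "x powr (- (\<alpha> + real j)) \<le> x powr (-\<rho>)" using that by (intro powr_mono) auto
      then show ?thesis by simp
    next
      case False
      then have "x powr (-0) \<le> x powr (-\<rho>)" using that by (intro powr_mono') auto
      then show ?thesis using that by simp
    qed
    then have "C0 * min 1 (x powr (- (\<alpha> + real j))) \<le> C0 * x powr (-\<rho>)" using C0 by (intro mult_left_mono)
    moreover have "norm (D j x) \<le> C0 * min 1 (x powr (- (\<alpha> + real j)))"
    proof -
      have "norm (D j x) \<le> C0 * 1" using C(1)[OF j that(2)] C0 by simp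
      moreover have "norm (D j x) \<le> C0 * x powr (- (\<alpha> + real j))"
        using C(2)[OF j that(2)] mult_right_mono[OF C0(1), of "x powr (- (\<alpha> + real j))"] by simp
      ultimately show ?thesis by (simp add: min_def)
    qed
    ultimately show ?thesis by linarith
  qed
  have der: "(D j has_vector_derivative D (Suc j) x) (at x)" if "j < m" "x > 0" for j x
  proof -
    have "(D j has_vector_derivative D (Suc j) x) (at x within {0..})" using D(2) that by simp
    moreover have "at x within {0..} = at x" using that by (intro at_within_interior) (simp add: interior_real_atLeast)
    ultimately show ?thesis by simp
  qed
  have "smooth_decaying \<alpha> C0 (D 0) (D (Suc 0)) (D (Suc (Suc 0))) (D (Suc (Suc (Suc 0))))"
  proof
    show "continuous_on {0<..} (D (Suc (Suc (Suc 0))))"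
    proof (rule continuous_on_subset)
      show "continuous_on {0..} (D (Suc (Suc (Suc 0))))" using D(3) assms(3) by (simp add: numeral_3_eq_3)
    qed auto
  qed (use assms in \<open>auto intro!: der bd\<close>)
  then show thesis using that unfolding D(1) by blast
qed

section \<open>The quotients of zeta values in the half-plane to the right of 1/2\<close>

lemma holomorphic_zeta_quotient:
  "(\<lambda>w. riemann_zeta w ^ j / riemann_zeta (2 * w)) holomorphic_on {s. 1/2 < Re s} - {1}"
proof -
  have "(\<lambda>w. riemann_zeta (2 * w)) holomorphic_on {s. 1/2 < Re s} - {1}"
    by (rule holomorphic_on_compose[of "\<lambda>w. 2 * w" _ riemann_zeta, unfolded o_def])
       (auto intro!: holomorphic_intros holomorphic_on_subset[OF holomorphic_riemann_zeta] dest: arg_cong[of _ _ Re])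
  moreover have "riemann_zeta holomorphic_on {s. 1/2 < Re s} - {1}"
    by (rule holomorphic_on_subset[OF holomorphic_riemann_zeta]) auto
  ultimately show ?thesis
    by (intro holomorphic_on_divide holomorphic_on_power) (auto intro!: riemann_zeta_nonzero)
qed

lemma zeta_quotient_bound:
  assumes "1/2 < \<sigma>" "\<sigma> < 1" "j \<le> 4"
  shows "\<exists>K \<beta>. \<beta> < 2 \<and> (\<forall>s. \<sigma> \<le> Re s \<longrightarrow> 1 \<le> \<bar>Im s\<bar> \<longrightarrow> norm (riemann_zeta s ^ j / riemann_zeta (2 * s)) \<le> K * \<bar>Im s\<bar> powr \<beta>)"
proof -
  obtain C where C: "C \<ge> 0" "\<And>s. \<sigma> \<le> Re s \<Longrightarrow> 1 \<le> \<bar>Im s\<bar> \<Longrightarrow> norm (riemann_zeta s) \<le> C * \<bar>Im s\<bar> powr (1 - \<sigma>)"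
    using riemann_zeta_bound[of \<sigma>] assms by auto
  obtain c where c: "c > 0" "\<And>s. 2 * \<sigma> \<le> Re s \<Longrightarrow> c \<le> norm (riemann_zeta s)"
    using riemann_zeta_lower_bound[of "2 * \<sigma>"] assms by auto
  have "norm (riemann_zeta s ^ j / riemann_zeta (2 * s)) \<le> C ^ j / c * \<bar>Im s\<bar> powr (real j * (1 - \<sigma>))" if s: "\<sigma> \<le> Re s" "1 \<le> \<bar>Im s\<bar>" for s
  proof -
    have "norm (riemann_zeta s) ^ j \<le> (C * \<bar>Im s\<bar> powr (1 - \<sigma>)) ^ j" by (intro power_mono C(2) s) auto
    also have "\<dots> = C ^ j * \<bar>Im s\<bar> powr (real j * (1 - \<sigma>))"
    proof -
      have "(\<bar>Im s\<bar> powr (1 - \<sigma>)) ^ j = (\<bar>Im s\<bar> powr (1 - \<sigma>)) powr real j"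
        using s by (intro powr_realpow[symmetric]) auto
      also have "\<dots> = \<bar>Im s\<bar> powr (real j * (1 - \<sigma>))" by (simp add: powr_powr mult.commute)
      finally show ?thesis by (simp only: power_mult_distrib)
    qed
    finally have "norm (riemann_zeta s) ^ j / norm (riemann_zeta (2 * s)) \<le> (C ^ j * \<bar>Im s\<bar> powr (real j * (1 - \<sigma>))) / c"
      using c s C(1) by (intro frac_le) auto
    then show ?thesis by (simp add: norm_divide norm_power)
  qed
  moreover have "real j * (1 - \<sigma>) < 2"
  proof -
    have "real j * (1 - \<sigma>) \<le> 4 * (1 - \<sigma>)" using assms by (intro mult_right_mono) auto
    then show ?thesis using assms by simp
  qed
  ultimately show ?thesis by blast
qed

text \<open>All arithmetic sits in the local factor (1 - x^2) / (1 - x)^j, so both parts of the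
  theorem are instances; \<open>j <= 4\<close> secures the growth exponent j (1 - \<sigma>) <
  2.\<close>

lemma mellin_zeta_quotient:
  fixes c :: "nat \<Rightarrow> real"
  assumes "smooth_decaying \<alpha> C f f1 f2 f3" "j \<le> 4"
    and "multiplicative c" "\<And>n. c n \<ge> 0"
    and "\<And>p x. prime p \<Longrightarrow> norm (x::complex) < 1 \<Longrightarrow> (\<lambda>k. of_real (c (p ^ k)) * x ^ k) sums ((1 - x\<^sup>2) / (1 - x) ^ j)"
    and "1/2 < Re s" "Re s < 1"
  shows "((\<lambda>x. ((\<Sum>n. of_real (c (Suc n)) * f (real (Suc n) * x))
             - residue (\<lambda>w. riemann_zeta w ^ j / riemann_zeta (2 * w) * mellin f w * of_real x powr (- w)) 1)
            * of_real x powr (s - 1)) has_integral (riemann_zeta s ^ j / riemann_zeta (2 * s) * mellin f s)) {0<..}"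
proof -
  interpret smooth_decaying \<alpha> C f f1 f2 f3 by fact
  interpret dirichlet_mellin \<alpha> C f f1 f2 f3 "\<lambda>n. c (Suc n)" "\<lambda>w. riemann_zeta w ^ j / riemann_zeta (2 * w)"
  proof
    show "0 \<le> c (Suc n)" for n by (rule assms)
    show "summable (\<lambda>n. c (Suc n) * real (Suc n) powr (-\<sigma>))" if "1 < \<sigma>" for \<sigma>
      using zeta_quotient_dirichlet_series(1)[OF assms(3,4,5), where s = "of_real \<sigma>"] that by simp
    show "(\<lambda>n. of_real (c (Suc n)) * of_nat (Suc n) powr (-s)) sums (riemann_zeta s ^ j / riemann_zeta (2 * s))" if "1 < Re s" for s
      by (rule zeta_quotient_dirichlet_series(2)[OF assms(3,4,5) that])
    show "\<exists>K \<beta>. \<beta> < 2 \<and> (\<forall>s. \<sigma> \<le> Re s \<longrightarrow> 1 \<le> \<bar>Im s\<bar> \<longrightarrow> norm (riemann_zeta s ^ j / riemann_zeta (2 * s)) \<le> K * \<bar>Im s\<bar> powr \<beta>)"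
      if "1/2 < \<sigma>" "\<sigma> < 1" for \<sigma> by (rule zeta_quotient_bound[OF that assms(2)])
  qed (rule holomorphic_zeta_quotient)
  show ?thesis using G_mellin[OF assms(6,7)] unfolding G_def \<Psi>_def .
qed

theorem theorem6:
  fixes \<alpha> :: real and m :: nat and f :: "real \<Rightarrow> complex"
  assumes "\<alpha> > 1" and "m \<ge> 3" and "M_class \<alpha> m f"
  shows "\<forall>s. 1/2 < Re s \<and> Re s < 1 \<longrightarrow>
     ((\<lambda>x. ((\<Sum>n. of_nat (divisor_count ((Suc n)^2)) * f (real (Suc n) * x))
             - residue (\<lambda>w. riemann_zeta w ^ 3 / riemann_zeta (2 * w) * mellin f w
                              * of_real x powr (- w)) 1)
            * of_real x powr (s - 1))
       has_integral (riemann_zeta s ^ 3 / riemann_zeta (2 * s) * mellin f s)) {0<..}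
   \<and> ((\<lambda>x. ((\<Sum>n. of_nat ((divisor_count (Suc n))^2) * f (real (Suc n) * x))
             - residue (\<lambda>w. riemann_zeta w ^ 4 / riemann_zeta (2 * w) * mellin f w
                              * of_real x powr (- w)) 1)
            * of_real x powr (s - 1))
       has_integral (riemann_zeta s ^ 4 / riemann_zeta (2 * s) * mellin f s)) {0<..}"
proof (intro allI impI, elim conjE, goal_cases)
  case (1 s)
  obtain C f1 f2 f3 where sd: "smooth_decaying \<alpha> C f f1 f2 f3"
    using M_class_smooth_decaying[OF assms(3,1,2)] by blast
  show ?case
    using mellin_zeta_quotient[OF sd _ multiplicative_divisor_count_square _ divisor_count_square_local_sums 1]
      mellin_zeta_quotient[OF sd _ multiplicative_square_divisor_count _ square_divisor_count_local_sums 1]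
    by (simp only: of_real_of_nat_eq of_nat_0_le_iff le_numeral_extra numeral_le_iff semiring_norm simp_thms)
qed

end
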